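(* Let $V$ be a finite dimensional real vector space with lattice $\Lambda$ and let $P$ be a (nonempty) rational polyhedron in $V$. Let $q(\lambda,k)$ be a quasi-polynomial function on $\Lambda\oplus\mathbb{Z}$. Let $r$ be the restriction of $q$ to $E_P\cap(\Lambda\oplus\mathbb{Z})$ and let $r_{pol}$ be the polynomial part of $r$ on $E_P\cap(V\oplus\mathbb{Z})$. Assume that the quasi-polynomial function $r$ is homogeneous of degree $d_0$. For $k\ge1$ consider the distribution on $V$ $$\langle\Theta(P;q)(k),\varphi\rangle=\sum_{\lambda\in kP\cap\Lambda}q(\lambda,k)\varphi(\lambda/k).$$ Then $\Theta(P;q)(k)$ admits an asymptotic expansion when $k\to\infty$ of the form $$k^{\dim P}k^{d_0}\sum_{n=0}^\infty\frac{1}{k^n}\langle\theta_n(k),\varphi\rangle$$ with distributions $\theta_n(k)$ periodic in $k$. Furthermore, the term $k^{d_0}\langle\theta_0(k),\varphi\rangle$ is given by $$k^{d_0}\langle\theta_0(k),\varphi\rangle=\int_P r_{pol}(k\xi,k)\varphi(\xi)\,d\xi.$$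
   Context: Test functions $\varphi$ are smooth with compact support on $V$. A function on a lattice $L$ is periodic if it is invariant under translation by $DL$ for some positive integer $D$. Quasi-polynomial functions on a lattice $L$ (in a real vector space $U=L\otimes\mathbb{R}$) are the elements of the algebra generated by polynomials and periodic functions on $L$. A quasi-polynomial function on $L$ is homogeneous of degree $d$ if it is a linear combination of functions $\gamma\mapsto g^\gamma h(\gamma)$ with $g\in U^*/L^*$ of finite order ($g^\gamma=e^{2i\pi\langle G,\gamma\rangle}$ for a representative $G\in U^*$ of $g$) and $h$ a homogeneous polynomial of degree $d$ on $U$. For $L=\Lambda\oplus\mathbb{Z}$ this degree is called the total degree. Polynomial part: let $q(\lambda,k)$ be a quasi-polynomial function on $\Lambda\oplus\mathbb{Z}$. There is a sublattice $\Gamma\subset\Lambda$ of finite index $d_\Gamma$, and functions $p_\gamma(\xi,k)$, polynomial in $\xi\in V$ and quasi-polynomial in $k\in\mathbb{Z}$, such that $q(\lambda,k)=p_\gamma(\lambda,k)$ for all $\lambda\in\gamma+\Gamma$. Set $q_{pol}(\xi,k)=\frac{1}{d_\Gamma}\sum_{\gamma\in\Lambda/\Gamma}p_\gamma(\xi,k)$; it does not depend on $\Gamma$. The same definition applies to any lattice in place of $\Lambda$. Let $C_P=\{(t\xi,t):t\ge0,\xi\in P\}\subset V\oplus\mathbb{R}$ and let $E_P$ be the vector space generated by $C_P$. Let $R_P$ be the affine space generated by $P$ in $V$, ${\rm lin}(P)$ the linear space parallel to $R_P$, and $\Lambda_0=\Lambda\cap{\rm lin}(P)$. The integral over $P$ is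 taken with respect to the canonical translation invariant measure on $R_P$, i.e. the one coming from the Lebesgue measure on ${\rm lin}(P)$ associated to the lattice $\Lambda_0$. The set $I_P=\{k\in\mathbb{Z}:kR_P\cap\Lambda\ne\emptyset\}$ is an ideal of $\mathbb{Z}$, generated by a smallest $k_0>0$. Choose $\alpha\in R_P$ with $k_0\alpha\in\Lambda$. The map $(\xi_0,t)\mapsto(\xi_0+tk_0\alpha,tk_0)$ identifies ${\rm lin}(P)\oplus\mathbb{R}$ with $E_P$ and $\Lambda_0\oplus\mathbb{Z}$ with $E_P\cap(\Lambda\oplus\mathbb{Z})$. Let $q^\alpha(\gamma,u)=r(\gamma+uk_0\alpha,uk_0)$, a quasi-polynomial function on $\Lambda_0\oplus\mathbb{Z}$, with polynomial part $q^\alpha_{pol}(\xi,u)$, $\xi\in{\rm lin}(P)$, $u\in\mathbb{Z}$ (relative to $\Lambda_0$). For $(\xi,k)\in E_P\cap(V\oplus\mathbb{Z})$ define $r_{pol}(\xi,k)=0$ if $k\notin I_P$, and $r_{pol}(\xi,k)=q^\alpha_{pol}(\xi-uk_0\alpha,u)$ if $k=uk_0\in I_P$. This does not depend on the choice of $\alpha$. A family $\theta(k)$ of distributions is periodic in $k\in\mathbb{Z}$ if there is a positive integer $D$ with $\langle\theta(k_1+Dk),\varphi\rangle=\langle\theta(k_1),\varphi\rangle$ for all integers $k_1,k$ and all $\varphi$. That $\Theta(k)$, $k\ge1$, admits the asymptotic expansion $k^{n_0}\sum_{n\ge0}k^{-n}\langle\theta_n(k),\varphi\rangle$ means: each $\theta_n(k)$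 is periodic in $k$, and for every test function $\varphi$ and integer $N\ge0$, $\langle\Theta(k),\varphi\rangle=k^{n_0}\sum_{n=0}^N k^{-n}\langle\theta_n(k),\varphi\rangle+o(k^{n_0-N})$ as $k\to\infty$. *)

theory Defs
  imports "HOL-Analysis.Analysis" "HOL-Library.Landau_Symbols"
begin

section \<open>Lattices and quasi-polynomial functions\<close>

definition lattice_basis :: "'a::real_vector set \<Rightarrow> 'a set \<Rightarrow> bool" where
  "lattice_basis B L \<longleftrightarrow> finite B \<and> independent B \<and>
     L = {x. \<exists>c::'a \<Rightarrow> int. x = (\<Sum>b\<in>B. of_int (c b) *\<^sub>R b)}"

text \<open>A lattice need not have full rank in the ambient type: it is a lattice in the vector
  space \<open>span L\<close>, which may be a proper subspace.\<close>

definition is_lattice :: "'a::real_vector set \<Rightarrow> bool" where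
  "is_lattice L \<longleftrightarrow> (\<exists>B. lattice_basis B L)"

definition periodic_on :: "'a::real_vector set \<Rightarrow> ('a \<Rightarrow> complex) \<Rightarrow> bool" where
  "periodic_on L f \<longleftrightarrow> (\<exists>D::nat. D > 0 \<and> (\<forall>x\<in>L. \<forall>y\<in>L. f (x + real D *\<^sub>R y) = f x))"

text \<open>Functions on a lattice \<open>L\<close> are represented by functions on the ambient vector space of which
  only the values on \<open>L\<close> matter; this is what the rule \<open>restrict\<close> below expresses. Polynomials and
  linear forms on \<open>span L\<close> are restrictions of those on the ambient space, so the latter are used.\<close>

inductive quasi_polynomial :: "'a::real_normed_vector set \<Rightarrow> ('a \<Rightarrow> complex) \<Rightarrow> bool"
  for L where
  polynomial: "polynomial_function f \<Longrightarrow> quasi_polynomial L f"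
| periodic: "periodic_on L f \<Longrightarrow> quasi_polynomial L f"
| add: "quasi_polynomial L f \<Longrightarrow> quasi_polynomial L g \<Longrightarrow> quasi_polynomial L (\<lambda>x. f x + g x)"
| mult: "quasi_polynomial L f \<Longrightarrow> quasi_polynomial L g \<Longrightarrow> quasi_polynomial L (\<lambda>x. f x * g x)"
| restrict: "quasi_polynomial L f \<Longrightarrow> (\<And>x. x \<in> L \<Longrightarrow> g x = f x) \<Longrightarrow> quasi_polynomial L g"

definition homogeneous_polynomial :: "nat \<Rightarrow> ('a::real_normed_vector \<Rightarrow> complex) \<Rightarrow> bool" where
  "homogeneous_polynomial d h \<longleftrightarrow> polynomial_function h \<and>
     (\<forall>t x. h (t *\<^sub>R x) = of_real (t ^ d) * h x)"

text \<open>The linear form \<open>G\<close> represents an element of finite order of \<open>U\<^sup>*/L\<^sup>*\<close>, where \<open>U = span L\<close>.\<close>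

definition finite_order_mod_dual :: "'a::real_vector set \<Rightarrow> ('a \<Rightarrow> real) \<Rightarrow> bool" where
  "finite_order_mod_dual L G \<longleftrightarrow> linear G \<and>
     (\<exists>m::nat. m > 0 \<and> (\<forall>x\<in>L. real m * G x \<in> \<int>))"

definition homogeneous_quasi_polynomial ::
    "'a::real_normed_vector set \<Rightarrow> nat \<Rightarrow> ('a \<Rightarrow> complex) \<Rightarrow> bool" where
  "homogeneous_quasi_polynomial L d f \<longleftrightarrow>
     (\<exists>(m::nat) c G h.
        (\<forall>i<m. finite_order_mod_dual L (G i) \<and> homogeneous_polynomial d (h i)) \<and>
        (\<forall>x\<in>L. f x = (\<Sum>i<m. c i * (exp (2 * \<i> * of_real pi * of_real (G i x)) * h i x))))"


section \<open>The polynomial part\<close>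

text \<open>Functions \<open>p(\<xi>, k)\<close> which are polynomial in \<open>\<xi>\<close> and quasi-polynomial in the integer \<open>k\<close>.
  Integers are embedded in \<^typ>\<open>real\<close>, so that a direct sum \<open>L \<oplus> \<int>\<close> is the lattice \<open>L \<times> \<int>\<close> of the
  vector space \<^typ>\<open>'a \<times> real\<close>.\<close>

definition poly_quasi_poly :: "('a::real_normed_vector \<times> real \<Rightarrow> complex) \<Rightarrow> bool" where
  "poly_quasi_poly p \<longleftrightarrow>
     (\<exists>(m::nat) f g. (\<forall>i<m. polynomial_function (f i) \<and> quasi_polynomial \<int> (g i)) \<and>
        (\<forall>\<xi>. \<forall>k\<in>\<int>. p (\<xi>, k) = (\<Sum>i<m. f i \<xi> * g i k)))"

definition lattice_cosets :: "'a::real_vector set \<Rightarrow> 'a set \<Rightarrow> 'a set set" where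
  "lattice_cosets L \<Gamma> = (\<lambda>\<gamma>. (+) \<gamma> ` \<Gamma>) ` L"

definition polynomial_decomposition ::
    "'a::real_normed_vector set \<Rightarrow> ('a \<times> real \<Rightarrow> complex) \<Rightarrow> 'a set \<Rightarrow>
     ('a set \<Rightarrow> 'a \<times> real \<Rightarrow> complex) \<Rightarrow> bool" where
  "polynomial_decomposition L q \<Gamma> p \<longleftrightarrow>
     is_lattice \<Gamma> \<and> \<Gamma> \<subseteq> L \<and> finite (lattice_cosets L \<Gamma>) \<and>
     (\<forall>C \<in> lattice_cosets L \<Gamma>. poly_quasi_poly (p C) \<and>
        (\<forall>x\<in>C. \<forall>k\<in>\<int>. q (x, k) = p C (x, k)))"

text \<open>The polynomial part of a quasi-polynomial function on \<open>L \<oplus> \<int>\<close>. Its values on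
  \<open>span L \<times> \<int>\<close> do not depend on the chosen decomposition; no other values are meaningful.\<close>

definition polynomial_part ::
    "'a::real_normed_vector set \<Rightarrow> ('a \<times> real \<Rightarrow> complex) \<Rightarrow> 'a \<times> real \<Rightarrow> complex" where
  "polynomial_part L q = (SOME Q. \<exists>\<Gamma> p. polynomial_decomposition L q \<Gamma> p \<and>
     Q = (\<lambda>x. (\<Sum>C \<in> lattice_cosets L \<Gamma>. p C x) / of_nat (card (lattice_cosets L \<Gamma>))))"


section \<open>Rational polyhedra\<close>

text \<open>Linear forms on a Euclidean space are written as inner products; \<open>a\<close> is rational when it takes
  rational values on the lattice \<open>L\<close>.\<close>

definition rational_polyhedron :: "'a::euclidean_space set \<Rightarrow> 'a set \<Rightarrow> bool" where
  "rational_polyhedron L P \<longleftrightarrow>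
     (\<exists>F. finite F \<and> P = \<Inter>F \<and>
        (\<forall>h\<in>F. \<exists>a b. a \<noteq> 0 \<and> (\<forall>x\<in>L. a \<bullet> x \<in> \<rat>) \<and> b \<in> \<rat> \<and> h = {x. a \<bullet> x \<le> b}))"

definition cone_over :: "'a::real_vector set \<Rightarrow> ('a \<times> real) set" where
  "cone_over P = {(t *\<^sub>R \<xi>, t) | t \<xi>. t \<ge> 0 \<and> \<xi> \<in> P}"

text \<open>The space \<open>E\<^sub>P\<close>.\<close>

definition cone_space :: "'a::real_vector set \<Rightarrow> ('a \<times> real) set" where
  "cone_space P = span (cone_over P)"

text \<open>The linear space parallel to the affine hull of \<open>P\<close>.\<close>

definition lin_space :: "'a::real_vector set \<Rightarrow> 'a set" where
  "lin_space P = {x - y | x y. x \<in> affine hull P \<and> y \<in> affine hull P}"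

text \<open>The ideal \<open>I\<^sub>P\<close> of \<open>\<int>\<close> and its positive generator \<open>k\<^sub>0\<close>.\<close>

definition index_ideal :: "'a::real_vector set \<Rightarrow> 'a set \<Rightarrow> real set" where
  "index_ideal L P = {k \<in> \<int>. (*\<^sub>R) k ` (affine hull P) \<inter> L \<noteq> {}}"

definition index_gen :: "'a::real_vector set \<Rightarrow> 'a set \<Rightarrow> nat" where
  "index_gen L P = (LEAST k. k > 0 \<and> real k \<in> index_ideal L P)"

definition index_point :: "'a::real_vector set \<Rightarrow> 'a set \<Rightarrow> 'a" where
  "index_point L P = (SOME \<alpha>. \<alpha> \<in> affine hull P \<and> real (index_gen L P) *\<^sub>R \<alpha> \<in> L)"

text \<open>The polynomial part, on \<open>E\<^sub>P \<inter> (V \<oplus> \<int>)\<close>, of a quasi-polynomial function \<open>r\<close> on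
  \<open>E\<^sub>P \<inter> (L \<oplus> \<int>)\<close>. It does not depend on the choice of \<^const>\<open>index_point\<close>.\<close>

definition cone_polynomial_part ::
    "'a::real_normed_vector set \<Rightarrow> 'a set \<Rightarrow> ('a \<times> real \<Rightarrow> complex) \<Rightarrow> 'a \<times> real \<Rightarrow> complex" where
  "cone_polynomial_part L P r = (\<lambda>(\<xi>, k).
     (let k0 = real (index_gen L P);
          \<alpha> = index_point L P;
          q\<^sub>\<alpha> = (\<lambda>(\<gamma>, u). r (\<gamma> + (u * k0) *\<^sub>R \<alpha>, u * k0));
          u = k / k0
      in if k \<in> index_ideal L P
         then polynomial_part (L \<inter> lin_space P) q\<^sub>\<alpha> (\<xi> - (u * k0) *\<^sub>R \<alpha>, u)
         else 0))"

text \<open>The translation invariant measure on the affine hull of \<open>P\<close> for which a fundamental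
  parallelepiped of \<open>L \<inter> lin_space P\<close> has measure one, as a measure on the ambient space: the image
  of Lebesgue measure under coordinates given by a lattice basis. It depends neither on the basis
  nor on the base point. If \<open>P\<close> is a point it is the Dirac measure at that point.\<close>

definition hull_measure :: "'a::euclidean_space set \<Rightarrow> 'a set \<Rightarrow> 'a measure" where
  "hull_measure L P =
     (let B = (SOME B. lattice_basis B (L \<inter> lin_space P));
          x0 = (SOME x. x \<in> affine hull P)
      in distr (\<Pi>\<^sub>M b\<in>B. lborel) borel (\<lambda>t. x0 + (\<Sum>b\<in>B. t b *\<^sub>R b)))"


section \<open>Test functions, distributions and asymptotic expansions\<close>

primrec iterated_deriv ::
    "'a list \<Rightarrow> ('a::real_normed_vector \<Rightarrow> 'b::real_normed_vector) \<Rightarrow> 'a \<Rightarrow> 'b" where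
  "iterated_deriv [] f = f"
| "iterated_deriv (v # vs) f = (\<lambda>x. frechet_derivative (iterated_deriv vs f) (at x) v)"

text \<open>Differentiability of all iterated partial derivatives includes their continuity, so this
  is the usual class of infinitely differentiable functions.\<close>

definition smooth :: "('a::euclidean_space \<Rightarrow> 'b::real_normed_vector) \<Rightarrow> bool" where
  "smooth f \<longleftrightarrow> (\<forall>vs \<in> lists Basis. \<forall>x. iterated_deriv vs f differentiable at x)"

definition test_function :: "('a::euclidean_space \<Rightarrow> complex) \<Rightarrow> bool" where
  "test_function \<phi> \<longleftrightarrow> smooth \<phi> \<and> compact (closure {x. \<phi> x \<noteq> 0})"

text \<open>Linear forms on test functions, continuous in the sense of the usual seminorm estimates on
  each compact set. The values of \<open>T\<close> on other functions are irrelevant.\<close>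

definition distribution :: "(('a::euclidean_space \<Rightarrow> complex) \<Rightarrow> complex) \<Rightarrow> bool" where
  "distribution T \<longleftrightarrow>
     (\<forall>\<phi> \<psi>. test_function \<phi> \<longrightarrow> test_function \<psi> \<longrightarrow> T (\<lambda>x. \<phi> x + \<psi> x) = T \<phi> + T \<psi>) \<and>
     (\<forall>c \<phi>. test_function \<phi> \<longrightarrow> T (\<lambda>x. c * \<phi> x) = c * T \<phi>) \<and>
     (\<forall>K. compact K \<longrightarrow> (\<exists>(C::real) (N::nat). \<forall>\<phi>. test_function \<phi> \<longrightarrow> {x. \<phi> x \<noteq> 0} \<subseteq> K \<longrightarrow>
        norm (T \<phi>) \<le> C * (\<Sum>vs \<in> {vs \<in> lists Basis. length vs \<le> N}.
                              SUP x. norm (iterated_deriv vs \<phi> x))))"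

definition periodic_family ::
    "(int \<Rightarrow> ('a::euclidean_space \<Rightarrow> complex) \<Rightarrow> complex) \<Rightarrow> bool" where
  "periodic_family \<theta> \<longleftrightarrow>
     (\<exists>D::int. D > 0 \<and> (\<forall>k1 k \<phi>. test_function \<phi> \<longrightarrow> \<theta> (k1 + D * k) \<phi> = \<theta> k1 \<phi>))"

text \<open>\<open>\<Theta>(k)\<close> admits the asymptotic expansion \<open>k\<^sup>n\<^sup>0 \<Sum>\<^sub>n k\<^sup>-\<^sup>n \<theta>\<^sub>n(k)\<close> with distributions \<open>\<theta>\<^sub>n(k)\<close>
  periodic in \<open>k\<close>.\<close>

definition has_asymptotic_expansion ::
    "(nat \<Rightarrow> ('a::euclidean_space \<Rightarrow> complex) \<Rightarrow> complex) \<Rightarrow> nat \<Rightarrow>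
     (nat \<Rightarrow> int \<Rightarrow> ('a \<Rightarrow> complex) \<Rightarrow> complex) \<Rightarrow> bool" where
  "has_asymptotic_expansion \<Theta> n0 \<theta> \<longleftrightarrow>
     (\<forall>n k. distribution (\<theta> n k)) \<and>
     (\<forall>n. periodic_family (\<theta> n)) \<and>
     (\<forall>\<phi> N. test_function \<phi> \<longrightarrow>
        (\<lambda>k. \<Theta> k \<phi> - of_nat k ^ n0 * (\<Sum>n\<le>N. \<theta> n (int k) \<phi> / of_nat k ^ n))
          \<in> o(\<lambda>k. of_nat k powi (int n0 - int N)))"

text \<open>For a test function the sum has finitely many nonzero terms if \<open>k \<ge> 1\<close>.\<close>

definition Theta ::
    "'a::euclidean_space set \<Rightarrow> 'a set \<Rightarrow> ('a \<times> real \<Rightarrow> complex) \<Rightarrow> nat \<Rightarrow>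
     ('a \<Rightarrow> complex) \<Rightarrow> complex" where
  "Theta L P q k \<phi> =
     (\<Sum>\<^sub>\<infinity>x \<in> (*\<^sub>R) (real k) ` P \<inter> L. q (x, real k) * \<phi> (x /\<^sub>R real k))"

end

theory Submission
  imports Defs
begin

text \<open>Choose a basis \<open>B\<close> of \<open>\<Lambda>\<^sub>0\<close>. If \<open>k\<^sub>0\<close> divides \<open>k\<close>, the lattice points of \<open>k P\<close> are the
  \<open>k \<alpha> + \<Sum> n\<^sub>b b\<close> whose integer coordinates satisfy finitely many inequalities \<open>f (n, k) \<ge> 0\<close> with
  integral linear forms \<open>f\<close>; otherwise there are none. By homogeneity the summand is \<open>k\<^bsup>d\<^sub>0\<^esup>\<close> times a
  combination of periodic coefficients \<open>c (n, k)\<close> and test functions evaluated at \<open>\<alpha> + \<Sum> (n\<^sub>b / k) b\<close>.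

  Fourier--Motzkin elimination, carried out on indicator functions, writes the indicator of the
  polyhedron as a linear combination of indicators of simplicial cones, that is, of images of
  \<open>{\<mu>. \<mu>\<^sub>j \<ge> 0 for j \<in> J}\<close> under rational affine maps. Splitting \<open>\<mu>\<close> into residue classes reduces
  everything to sums of \<open>\<phi>\<close> over shifted orthants \<open>(\<nu> + \<rho>) / k\<close>. For those, Taylor expansion of \<open>\<phi>\<close> around
  the point \<open>(\<nu> + \<rho>) / k\<close> of each cell of side \<open>1 / k\<close> expresses the integral of \<open>\<phi>\<close> over the
  orthant through the lattice sums of the derivatives of \<open>\<phi>\<close>, with leading term the lattice sum of
  \<open>\<phi>\<close> itself, and this triangular system is solved for the lattice sums.

  Once the expansion exists, its leading term is the limit of Riemann sums along a residue class of
  \<open>k\<close>: the mean of the coefficient over residues times an integral over \<open>P\<close>. The same mean computes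
  the polynomial part, because residues are equidistributed among the cosets of any sublattice.\<close>

section \<open>Test functions and distributions\<close>

text \<open>Orthants are what removes boundary terms: cells of side 1/k tile an orthant exactly,
  whereas a general facet cuts through cells at every scale. The inequalities of P are kept
  homogeneous in (n, k), so one decomposition into cones serves every k > 0; the divisibility
  conditions created by rational changes of coordinates are moved into coefficients that are
  periodic in (n, k). The polynomial factor of the summand never meets the lattice sum: since h (k
  \<xi>, k) is a power of k times h (\<xi>, 1), the latter is absorbed into the test function. The
  decomposition into cones is far from unique, and its integrals are not tracked. Only the existence
  of an expansion is extracted from it; afterwards the leading coefficient is forced by a limit. In
  the same way \<open>polynomial_part\<close> is an unspecified choice among decompositions, so its
  value is computed for an arbitrary sublattice, with residues fine enough to see both that
  sublattice and the period of the coefficients.\<close>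

lemma iterated_deriv_append:
  "iterated_deriv (us @ vs) f = iterated_deriv us (iterated_deriv vs f)"
  by (induction us) auto

text \<open>The last direction of a list is differentiated first, so peeling lists from the right
  keeps the function inside \<open>X\<close>. Taking a whole class of functions for \<open>X\<close>
  replaces formulas for higher derivatives.\<close>

lemma smooth_coinduct:
  assumes "f \<in> X" and "\<And>g x. g \<in> X \<Longrightarrow> g differentiable (at x)"
    and "\<And>g v. g \<in> X \<Longrightarrow> v \<in> Basis \<Longrightarrow> iterated_deriv [v] g \<in> X"
  shows "smooth f"
proof -
  have "iterated_deriv vs g \<in> X" if "vs \<in> lists Basis" "g \<in> X" for vs g
    using that
  proof (induction vs arbitrary: g rule: rev_induct)
    case (snoc v vs)
    then show ?case
      using assms(3)[of g v] by (simp add: iterated_deriv_append del: iterated_deriv.simps)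
  qed simp
  then show ?thesis
    unfolding smooth_def using assms(1,2) by blast
qed

lemma smooth_iterated_deriv_Basis:
  assumes "smooth f" "vs \<in> lists Basis"
  shows "smooth (iterated_deriv vs f)"
  using assms unfolding smooth_def
  by (metis append_in_lists_conv iterated_deriv_append)

lemma smooth_differentiable: "smooth f \<Longrightarrow> f differentiable (at x)"
  unfolding smooth_def by (metis iterated_deriv.simps(1) lists.Nil)

lemma smooth_continuous: "smooth f \<Longrightarrow> continuous_on S f"
  by (meson continuous_at_imp_continuous_on differentiable_imp_continuous_within smooth_differentiable)

lemma frechet_derivative_eq:
  "(f has_derivative f') (at x) \<Longrightarrow> frechet_derivative f (at x) = f'"
  by (metis frechet_derivative_at)

lemma has_frechet_derivative:
  "f differentiable (at x) \<Longrightarrow> (f has_derivative frechet_derivative f (at x)) (at x)"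
  by (simp add: frechet_derivative_works)

text \<open>The product rule turns the derivative of a product into a sum of products, so closing
  under both operations yields a set stable under coordinate derivatives, as
  \<open>smooth_coinduct\<close> asks.\<close>

inductive_set smooth_algebra :: "('a::euclidean_space \<Rightarrow> complex) set" where
  smooth: "smooth f \<Longrightarrow> f \<in> smooth_algebra"
| add: "f \<in> smooth_algebra \<Longrightarrow> g \<in> smooth_algebra \<Longrightarrow> (\<lambda>x. f x + g x) \<in> smooth_algebra"
| mult: "f \<in> smooth_algebra \<Longrightarrow> g \<in> smooth_algebra \<Longrightarrow> (\<lambda>x. f x * g x) \<in> smooth_algebra"

lemma iterated_deriv_add:
  assumes "\<And>x. f differentiable (at x)" "\<And>x. g differentiable (at x)"
  shows "iterated_deriv [v] (\<lambda>x. f x + g x) = (\<lambda>x. iterated_deriv [v] f x + iterated_deriv [v] g x)"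
proof
  fix x
  have "((\<lambda>x. f x + g x) has_derivative
      (\<lambda>h. frechet_derivative f (at x) h + frechet_derivative g (at x) h)) (at x)"
    by (intro has_derivative_add has_frechet_derivative assms)
  then show "iterated_deriv [v] (\<lambda>x. f x + g x) x = iterated_deriv [v] f x + iterated_deriv [v] g x"
    by (simp add: frechet_derivative_eq)
qed

lemma iterated_deriv_mult:
  fixes f g :: "'a::euclidean_space \<Rightarrow> complex"
  assumes "\<And>x. f differentiable (at x)" "\<And>x. g differentiable (at x)"
  shows "iterated_deriv [v] (\<lambda>x. f x * g x) =
    (\<lambda>x. f x * iterated_deriv [v] g x + iterated_deriv [v] f x * g x)"
proof
  fix x
  have "((\<lambda>x. f x * g x) has_derivative
      (\<lambda>h. f x * frechet_derivative g (at x) h + frechet_derivative f (at x) h * g x)) (at x)"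
    by (intro has_derivative_mult has_frechet_derivative assms)
  then show "iterated_deriv [v] (\<lambda>x. f x * g x) x =
      f x * iterated_deriv [v] g x + iterated_deriv [v] f x * g x"
    by (simp add: frechet_derivative_eq)
qed

lemma smooth_algebra_imp_smooth:
  assumes "f \<in> smooth_algebra"
  shows "smooth f"
proof (rule smooth_coinduct[OF assms])
  show diff: "g differentiable (at x)" if "g \<in> smooth_algebra" for g :: "'a \<Rightarrow> complex" and x
    using that by (induction) (auto intro: smooth_differentiable)
  show "iterated_deriv [v] g \<in> smooth_algebra"
    if "g \<in> smooth_algebra" "v \<in> Basis" for g :: "'a \<Rightarrow> complex" and v
    using that
  proof induction
    case (smooth f)
    then have "smooth (iterated_deriv [v] f)"
      by (intro smooth_iterated_deriv_Basis) auto
    then show ?case by (rule smooth_algebra.smooth)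
  next
    case (add f g)
    then show ?case
      using iterated_deriv_add[of f g v, OF diff diff] by (simp add: smooth_algebra.add)
  next
    case (mult f g)
    then show ?case
      using iterated_deriv_mult[of f g v, OF diff diff]
      by (simp add: smooth_algebra.add smooth_algebra.mult)
  qed
qed

lemma smooth_add:
  fixes f g :: "'a::euclidean_space \<Rightarrow> complex"
  assumes "smooth f" "smooth g"
  shows "smooth (\<lambda>x. f x + g x)"
  using assms smooth_algebra_imp_smooth[OF smooth_algebra.add[OF smooth_algebra.smooth smooth_algebra.smooth]]
  by blast

lemma smooth_mult:
  fixes f g :: "'a::euclidean_space \<Rightarrow> complex"
  assumes "smooth f" "smooth g"
  shows "smooth (\<lambda>x. f x * g x)"
  using assms smooth_algebra_imp_smooth[OF smooth_algebra.mult[OF smooth_algebra.smooth smooth_algebra.smooth]]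
  by blast

lemma smooth_const: "smooth (\<lambda>_. c)"
proof (rule smooth_coinduct[where X = "range (\<lambda>c _. c)"])
  fix g :: "'a \<Rightarrow> 'b" and v assume "g \<in> range (\<lambda>c _. c)"
  then obtain c where "g = (\<lambda>_. c)" by blast
  then have "iterated_deriv [v] g = (\<lambda>_. 0)"
    by (simp add: frechet_derivative_eq[OF has_derivative_const])
  then show "iterated_deriv [v] g \<in> range (\<lambda>c _. c)" by simp
qed auto

lemma smooth_sum:
  fixes f :: "'i \<Rightarrow> 'a::euclidean_space \<Rightarrow> complex"
  assumes "\<And>i. i \<in> I \<Longrightarrow> smooth (f i)"
  shows "smooth (\<lambda>x. \<Sum>i\<in>I. f i x)"
  using assms by (induction I rule: infinite_finite_induct) (auto simp: smooth_const smooth_add)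

lemma smooth_of_real_linear:
  assumes "bounded_linear l"
  shows "smooth (\<lambda>x. complex_of_real (l x))"
proof (rule smooth_coinduct[where X = "insert (\<lambda>x. complex_of_real (l x)) (range (\<lambda>c _. c))"])
  have D: "((\<lambda>x. complex_of_real (l x)) has_derivative (\<lambda>h. of_real (l h))) (at x)" for x
    by (intro bounded_linear_imp_has_derivative bounded_linear_compose[OF bounded_linear_of_real] assms)
  show "g differentiable (at x)"
    if "g \<in> insert (\<lambda>x. complex_of_real (l x)) (range (\<lambda>c _. c))" for g x
    using that differentiableI[OF D] by auto
  show "iterated_deriv [v] g \<in> insert (\<lambda>x. complex_of_real (l x)) (range (\<lambda>c _. c))"
    if "g \<in> insert (\<lambda>x. complex_of_real (l x)) (range (\<lambda>c _. c))" for g v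
    using that by (auto simp: frechet_derivative_eq[OF D] frechet_derivative_eq[OF has_derivative_const])
qed simp

lemma smooth_of_real_polynomial:
  assumes "real_polynomial_function p"
  shows "smooth (\<lambda>x. complex_of_real (p x))"
  using assms
  by induction (auto intro: smooth_of_real_linear smooth_const smooth_add smooth_mult)

lemma smooth_polynomial:
  fixes p :: "'a::euclidean_space \<Rightarrow> complex"
  assumes "polynomial_function p"
  shows "smooth p"
proof -
  have "real_polynomial_function (\<lambda>x. Re (p x))" "real_polynomial_function (\<lambda>x. Im (p x))"
    using assms bounded_linear_Re bounded_linear_Im unfolding polynomial_function_def o_def by auto
  then have "smooth (\<lambda>x. of_real (Re (p x)) + \<i> * of_real (Im (p x)))"
    by (intro smooth_add smooth_mult smooth_const smooth_of_real_polynomial)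
  then show ?thesis by (simp add: complex_eq[symmetric])
qed

text \<open>\<open>smooth\<close> speaks of coordinate directions, while lattice sums are
  differentiated along arbitrary vectors; linearity of the Frechet derivative expresses the latter
  through the former.\<close>

lemma iterated_deriv_direction:
  fixes f :: "'a::euclidean_space \<Rightarrow> complex"
  assumes "\<And>x. f differentiable (at x)"
  shows "iterated_deriv [v] f = (\<lambda>x. \<Sum>b\<in>Basis. of_real (v \<bullet> b) * iterated_deriv [b] f x)"
proof
  fix x
  have "linear (frechet_derivative f (at x))"
    using assms has_frechet_derivative linear_frechet_derivative by blast
  then have "frechet_derivative f (at x) (\<Sum>b\<in>Basis. (v \<bullet> b) *\<^sub>R b) =
      (\<Sum>b\<in>Basis. (v \<bullet> b) *\<^sub>R frechet_derivative f (at x) b)"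
    by (simp add: linear_sum linear_cmul)
  then show "iterated_deriv [v] f x = (\<Sum>b\<in>Basis. of_real (v \<bullet> b) * iterated_deriv [b] f x)"
    by (simp add: euclidean_representation scaleR_conv_of_real)
qed

lemma smooth_iterated_deriv:
  fixes f :: "'a::euclidean_space \<Rightarrow> complex"
  assumes "smooth f"
  shows "smooth (iterated_deriv vs f)"
proof (induction vs)
  case (Cons v vs)
  have "smooth (iterated_deriv [v] (iterated_deriv vs f))"
    using Cons
    by (subst iterated_deriv_direction)
      (auto intro!: smooth_differentiable smooth_sum smooth_mult smooth_const
        smooth_iterated_deriv_Basis simp del: iterated_deriv.simps)
  then show ?case by simp
qed (use assms in simp)

text \<open>Off the closed set \<open>K\<close> the function vanishes on a neighbourhood, so
  differentiation cannot enlarge the support. One compact set therefore controls all derivatives of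
  a test function.\<close>

lemma iterated_deriv_support:
  fixes f :: "'a::euclidean_space \<Rightarrow> complex"
  assumes "closed K" "{x. f x \<noteq> 0} \<subseteq> K"
  shows "{x. iterated_deriv vs f x \<noteq> 0} \<subseteq> K"
proof (induction vs)
  case (Cons v vs)
  have "iterated_deriv (v # vs) f x = 0" if "x \<notin> K" for x
  proof -
    have "((\<lambda>_. 0::complex) has_derivative (\<lambda>_. 0)) (at x)" by simp
    then have "(iterated_deriv vs f has_derivative (\<lambda>_. 0)) (at x)"
      using Cons assms(1) that
      by (elim has_derivative_transform_within_open[where s = "- K"]) (auto simp: open_Compl)
    then show ?thesis by (simp add: frechet_derivative_eq)
  qed
  then show ?case by blast
qed (use assms in simp)

section \<open>Test functions and their seminorms\<close>

lemma test_function_altdef: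
  "test_function \<phi> \<longleftrightarrow> smooth \<phi> \<and> (\<exists>K. compact K \<and> {x. \<phi> x \<noteq> 0} \<subseteq> K)"
  unfolding test_function_def
  by (meson bounded_closure bounded_subset closed_closure closure_subset compact_eq_bounded_closed)

lemma test_function_add:
  assumes "test_function \<phi>" "test_function \<psi>"
  shows "test_function (\<lambda>x. \<phi> x + \<psi> x)"
proof -
  obtain K L where "compact K" "{x. \<phi> x \<noteq> 0} \<subseteq> K" "compact L" "{x. \<psi> x \<noteq> 0} \<subseteq> L"
    using assms unfolding test_function_altdef by auto
  moreover from this have "\<phi> x + \<psi> x = 0" if "x \<notin> K \<union> L" for x
    using that by (metis (mono_tags, lifting) Un_iff add_0 mem_Collect_eq subset_iff)
  ultimately have "compact (K \<union> L) \<and> {x. \<phi> x + \<psi> x \<noteq> 0} \<subseteq> K \<union> L" by blast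
  then show ?thesis
    using assms unfolding test_function_altdef by (blast intro: smooth_add)
qed

lemma test_function_mult:
  assumes "smooth h" "test_function \<phi>"
  shows "test_function (\<lambda>x. h x * \<phi> x)"
proof -
  obtain K where "compact K" "{x. \<phi> x \<noteq> 0} \<subseteq> K"
    using assms unfolding test_function_altdef by auto
  moreover from this have "{x. h x * \<phi> x \<noteq> 0} \<subseteq> K" by auto
  ultimately show ?thesis
    using assms unfolding test_function_altdef by (blast intro: smooth_mult)
qed

lemma test_function_iterated_deriv:
  assumes "test_function \<phi>"
  shows "test_function (iterated_deriv vs \<phi>)"
proof -
  obtain K where "compact K" "{x. \<phi> x \<noteq> 0} \<subseteq> K" and sm: "smooth \<phi>"
    using assms unfolding test_function_altdef by auto
  then have "compact K \<and> {x. iterated_deriv vs \<phi> x \<noteq> 0} \<subseteq> K"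
    using iterated_deriv_support compact_imp_closed by blast
  then show ?thesis
    unfolding test_function_altdef using smooth_iterated_deriv[OF sm] by blast
qed

lemma test_function_cmult: "test_function \<phi> \<Longrightarrow> test_function (\<lambda>x. c * \<phi> x)"
  by (intro test_function_mult smooth_const)

lemma test_function_bounded:
  assumes "test_function \<phi>"
  obtains C where "\<And>x. norm (\<phi> x) \<le> C" "C \<ge> 0"
proof -
  obtain K where K: "compact K" "{x. \<phi> x \<noteq> 0} \<subseteq> K" and "smooth \<phi>"
    using assms unfolding test_function_altdef by auto
  have "bounded (\<phi> ` K)"
    using K(1) \<open>smooth \<phi>\<close> by (intro compact_imp_bounded compact_continuous_image smooth_continuous)
  then obtain C where C: "\<And>x. x \<in> K \<Longrightarrow> norm (\<phi> x) \<le> C"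
    unfolding bounded_iff by auto
  have "norm (\<phi> x) \<le> max C 0" for x
    using C[of x] K(2) by (cases "\<phi> x = 0") auto
  then show ?thesis using that by (meson max.cobounded2)
qed

definition test_seminorm :: "nat \<Rightarrow> ('a::euclidean_space \<Rightarrow> complex) \<Rightarrow> real" where
  "test_seminorm N \<phi> =
    (\<Sum>vs \<in> {vs \<in> lists Basis. length vs \<le> N}. SUP x. norm (iterated_deriv vs \<phi> x))"

lemma finite_Basis_lists: "finite {vs \<in> lists (Basis::'a::euclidean_space set). length vs \<le> N}"
  using finite_lists_length_le[of "Basis::'a set" N] by (simp add: lists_eq_set)

lemma bdd_above_iterated_deriv:
  "test_function \<phi> \<Longrightarrow> bdd_above (range (\<lambda>x. norm (iterated_deriv vs \<phi> x)))"
  using test_function_bounded[OF test_function_iterated_deriv[of \<phi> vs]]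
  by (metis bdd_aboveI2)

lemma test_seminorm_ge:
  assumes "test_function \<phi>" "vs \<in> lists Basis" "length vs \<le> N"
  shows "norm (iterated_deriv vs \<phi> x) \<le> test_seminorm N \<phi>"
proof -
  have "norm (iterated_deriv vs \<phi> x) \<le> (SUP x. norm (iterated_deriv vs \<phi> x))"
    using assms by (intro cSUP_upper bdd_above_iterated_deriv) auto
  also have "\<dots> \<le> test_seminorm N \<phi>"
    \<comment> \<open>The other summands are nonnegative: each supremum dominates the norm at an
      arbitrary point, here \<open>undefined\<close>.\<close>
    unfolding test_seminorm_def
    using assms finite_Basis_lists
    by (intro member_le_sum)
      (auto intro!: cSUP_upper2[where x = undefined] bdd_above_iterated_deriv)
  finally show ?thesis .
qed

lemma test_seminorm_nonneg: "test_function \<phi> \<Longrightarrow> test_seminorm N \<phi> \<ge> 0"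
  using order_trans[OF norm_ge_zero test_seminorm_ge[of \<phi> "[]" N undefined]] by simp

lemma test_seminorm_le:
  assumes "\<And>vs x. vs \<in> lists Basis \<Longrightarrow> length vs \<le> N \<Longrightarrow> norm (iterated_deriv vs \<phi> x) \<le> C vs"
  shows "test_seminorm N \<phi> \<le> (\<Sum>vs \<in> {vs \<in> lists Basis. length vs \<le> N}. C vs)"
  unfolding test_seminorm_def using assms by (intro sum_mono cSUP_least) auto

lemma test_seminorm_mono:
  assumes "test_function \<phi>" "M \<le> N"
  shows "test_seminorm M \<phi> \<le> test_seminorm N \<phi>"
  unfolding test_seminorm_def using assms finite_Basis_lists
  by (intro sum_mono2) (auto intro!: cSUP_upper2[where x = undefined] bdd_above_iterated_deriv)

section \<open>Operations on distributions\<close>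

lemma distribution_altdef:
  "distribution T \<longleftrightarrow>
     (\<forall>\<phi> \<psi>. test_function \<phi> \<longrightarrow> test_function \<psi> \<longrightarrow> T (\<lambda>x. \<phi> x + \<psi> x) = T \<phi> + T \<psi>) \<and>
     (\<forall>c \<phi>. test_function \<phi> \<longrightarrow> T (\<lambda>x. c * \<phi> x) = c * T \<phi>) \<and>
     (\<forall>K. compact K \<longrightarrow> (\<exists>C N. \<forall>\<phi>. test_function \<phi> \<longrightarrow> {x. \<phi> x \<noteq> 0} \<subseteq> K \<longrightarrow>
        norm (T \<phi>) \<le> C * test_seminorm N \<phi>))"
  unfolding distribution_def test_seminorm_def by blast

lemma distribution_addD:
  "distribution T \<Longrightarrow> test_function \<phi> \<Longrightarrow> test_function \<psi> \<Longrightarrow> T (\<lambda>x. \<phi> x + \<psi> x) = T \<phi> + T \<psi>"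
  unfolding distribution_def by blast

lemma distribution_cmultD:
  "distribution T \<Longrightarrow> test_function \<phi> \<Longrightarrow> T (\<lambda>x. c * \<phi> x) = c * T \<phi>"
  unfolding distribution_def by blast

text \<open>Precomposition with a linear operator that respects compact supports and costs
  \<open>m\<close> derivatives keeps continuity: the bounds for the finitely many words of length at
  most \<open>N\<close> add up to one seminorm of order \<open>m + N\<close>. It serves coordinate
  derivatives with \<open>m = 1\<close> and multiplication by a smooth function with
  \<open>m = 0\<close>.\<close>

lemma distribution_compose:
  assumes T: "distribution T"
    and L: "\<And>\<phi>. test_function \<phi> \<Longrightarrow> test_function (L \<phi>)"
      "\<And>\<phi> \<psi>. test_function \<phi> \<Longrightarrow> test_function \<psi> \<Longrightarrow> L (\<lambda>x. \<phi> x + \<psi> x) = (\<lambda>x. L \<phi> x + L \<psi> x)"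
      "\<And>c \<phi>. test_function \<phi> \<Longrightarrow> L (\<lambda>x. c * \<phi> x) = (\<lambda>x. c * L \<phi> x)"
      "\<And>K \<phi>. compact K \<Longrightarrow> test_function \<phi> \<Longrightarrow> {x. \<phi> x \<noteq> 0} \<subseteq> K \<Longrightarrow> {x. L \<phi> x \<noteq> 0} \<subseteq> K"
    and bound: "\<And>K vs. compact K \<Longrightarrow> vs \<in> lists Basis \<Longrightarrow> \<exists>C. \<forall>\<phi>. test_function \<phi> \<longrightarrow>
      {x. \<phi> x \<noteq> 0} \<subseteq> K \<longrightarrow> (\<forall>x. norm (iterated_deriv vs (L \<phi>) x) \<le> C * test_seminorm (m + length vs) \<phi>)"
  shows "distribution (\<lambda>\<phi>. T (L \<phi>))"
  unfolding distribution_altdef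
proof (intro conjI allI impI)
  fix K :: "'a set" assume K: "compact K"
  obtain C N where CN: "\<And>\<phi>. test_function \<phi> \<Longrightarrow> {x. \<phi> x \<noteq> 0} \<subseteq> K \<Longrightarrow> norm (T \<phi>) \<le> C * test_seminorm N \<phi>"
    using T K unfolding distribution_altdef by meson
  obtain D where D: "\<And>vs \<phi> x. vs \<in> lists Basis \<Longrightarrow> test_function \<phi> \<Longrightarrow> {x. \<phi> x \<noteq> 0} \<subseteq> K \<Longrightarrow>
      norm (iterated_deriv vs (L \<phi>) x) \<le> D vs * test_seminorm (m + length vs) \<phi>"
    using bound[OF K] by metis
  define E where "E = \<bar>C\<bar> * (\<Sum>vs \<in> {vs \<in> lists (Basis::'a set). length vs \<le> N}. \<bar>D vs\<bar>)"
  have "norm (T (L \<phi>)) \<le> E * test_seminorm (m + N) \<phi>"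
    if \<phi>: "test_function \<phi>" "{x. \<phi> x \<noteq> 0} \<subseteq> K" for \<phi>
  proof -
    have "norm (T (L \<phi>)) \<le> C * test_seminorm N (L \<phi>)"
      using CN L K \<phi> by simp
    also have "\<dots> \<le> \<bar>C\<bar> * test_seminorm N (L \<phi>)"
      using test_seminorm_nonneg L(1) \<phi>(1) by (intro mult_right_mono) auto
    also have "\<dots> \<le> \<bar>C\<bar> * (\<Sum>vs \<in> {vs \<in> lists (Basis::'a set). length vs \<le> N}. \<bar>D vs\<bar> * test_seminorm (m + N) \<phi>)"
    proof (intro mult_left_mono test_seminorm_le)
      fix vs :: "'a list" and x assume vs: "vs \<in> lists Basis" "length vs \<le> N"
      have "norm (iterated_deriv vs (L \<phi>) x) \<le> D vs * test_seminorm (m + length vs) \<phi>"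
        using D vs \<phi> by blast
      also have "\<dots> \<le> \<bar>D vs\<bar> * test_seminorm (m + N) \<phi>"
        using vs \<phi> by (intro mult_mono test_seminorm_mono test_seminorm_nonneg) auto
      finally show "norm (iterated_deriv vs (L \<phi>) x) \<le> \<bar>D vs\<bar> * test_seminorm (m + N) \<phi>" .
    qed auto
    finally show ?thesis
      by (simp add: E_def sum_distrib_right mult.assoc)
  qed
  then show "\<exists>C N. \<forall>\<phi>. test_function \<phi> \<longrightarrow> {x. \<phi> x \<noteq> 0} \<subseteq> K \<longrightarrow> norm (T (L \<phi>)) \<le> C * test_seminorm N \<phi>"
    by (intro exI[of _ E] exI[of _ "m + N"]) simp
next
  fix \<phi> \<psi> :: "'a \<Rightarrow> complex" and c assume \<phi>: "test_function \<phi>"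
  show "T (L (\<lambda>x. c * \<phi> x)) = c * T (L \<phi>)"
    using L(3)[OF \<phi>] distribution_cmultD[OF T L(1)[OF \<phi>]] by simp
  assume \<psi>: "test_function \<psi>"
  show "T (L (\<lambda>x. \<phi> x + \<psi> x)) = T (L \<phi>) + T (L \<psi>)"
    using L(2)[OF \<phi> \<psi>] distribution_addD[OF T L(1)[OF \<phi>] L(1)[OF \<psi>]] by simp
qed

lemma distribution_zero: "distribution (\<lambda>_. 0)"
  unfolding distribution_altdef by (auto intro!: exI[of _ 0])

lemma distribution_add:
  assumes "distribution S" "distribution T"
  shows "distribution (\<lambda>\<phi>. S \<phi> + T \<phi>)"
  unfolding distribution_altdef
proof (intro conjI allI impI)
  fix K :: "'a set" assume K: "compact K"
  obtain C M where C: "\<And>\<phi>. test_function \<phi> \<Longrightarrow> {x. \<phi> x \<noteq> 0} \<subseteq> K \<Longrightarrow> norm (S \<phi>) \<le> C * test_seminorm M \<phi>"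
    using assms(1) K unfolding distribution_altdef by meson
  obtain D N where D: "\<And>\<phi>. test_function \<phi> \<Longrightarrow> {x. \<phi> x \<noteq> 0} \<subseteq> K \<Longrightarrow> norm (T \<phi>) \<le> D * test_seminorm N \<phi>"
    using assms(2) K unfolding distribution_altdef by meson
  have "norm (S \<phi> + T \<phi>) \<le> (\<bar>C\<bar> + \<bar>D\<bar>) * test_seminorm (max M N) \<phi>"
    if \<phi>: "test_function \<phi>" "{x. \<phi> x \<noteq> 0} \<subseteq> K" for \<phi>
  proof -
    have "norm (S \<phi> + T \<phi>) \<le> C * test_seminorm M \<phi> + D * test_seminorm N \<phi>"
      using C D \<phi> by (meson add_mono norm_triangle_le)
    also have "\<dots> \<le> \<bar>C\<bar> * test_seminorm (max M N) \<phi> + \<bar>D\<bar> * test_seminorm (max M N) \<phi>"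
      using \<phi> by (intro add_mono mult_mono test_seminorm_mono test_seminorm_nonneg) auto
    finally show ?thesis by (simp add: algebra_simps)
  qed
  then show "\<exists>C N. \<forall>\<phi>. test_function \<phi> \<longrightarrow> {x. \<phi> x \<noteq> 0} \<subseteq> K \<longrightarrow> norm (S \<phi> + T \<phi>) \<le> C * test_seminorm N \<phi>"
    by blast
qed (simp_all add: assms[THEN distribution_addD] assms[THEN distribution_cmultD] algebra_simps)

lemma distribution_cmult:
  assumes "distribution T"
  shows "distribution (\<lambda>\<phi>. c * T \<phi>)"
  unfolding distribution_altdef
proof (intro conjI allI impI)
  fix K :: "'a set" assume K: "compact K"
  obtain C M where C: "\<And>\<phi>. test_function \<phi> \<Longrightarrow> {x. \<phi> x \<noteq> 0} \<subseteq> K \<Longrightarrow> norm (T \<phi>) \<le> C * test_seminorm M \<phi>"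
    using assms(1) K unfolding distribution_altdef by meson
  then have "norm (c * T \<phi>) \<le> (norm c * C) * test_seminorm M \<phi>"
    if "test_function \<phi>" "{x. \<phi> x \<noteq> 0} \<subseteq> K" for \<phi>
    using that by (simp add: norm_mult mult.assoc mult_left_mono)
  then show "\<exists>C N. \<forall>\<phi>. test_function \<phi> \<longrightarrow> {x. \<phi> x \<noteq> 0} \<subseteq> K \<longrightarrow> norm (c * T \<phi>) \<le> C * test_seminorm N \<phi>"
    by blast
qed (simp_all add: distribution_addD[OF assms] distribution_cmultD[OF assms] algebra_simps)

lemma distribution_sum:
  assumes "\<And>i. i \<in> I \<Longrightarrow> distribution (T i)"
  shows "distribution (\<lambda>\<phi>. \<Sum>i\<in>I. T i \<phi>)"
  using assms
  by (induction I rule: infinite_finite_induct) (auto simp: distribution_zero distribution_add)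

text \<open>Additivity of \<open>T\<close> is granted on test functions, so the induction carries
  along that the partial sums are test functions.\<close>

lemma distribution_linear_sum:
  assumes "distribution T" "\<And>i. i \<in> I \<Longrightarrow> test_function (f i)"
  shows "T (\<lambda>x. \<Sum>i\<in>I. c i * f i x) = (\<Sum>i\<in>I. c i * T (f i)) \<and> test_function (\<lambda>x. \<Sum>i\<in>I. c i * f i x)"
proof -
  have zero: "test_function (\<lambda>x::'a. 0)"
    unfolding test_function_altdef by (auto simp: smooth_const)
  then have "T (\<lambda>x. 0) = 0"
    using distribution_cmultD[OF assms(1) zero, of 0] by simp
  then show ?thesis
    using assms(2)
    by (induction I rule: infinite_finite_induct)
      (simp_all add: zero distribution_addD[OF assms(1)] distribution_cmultD[OF assms(1)]
        test_function_cmult test_function_add)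
qed

text \<open>The outermost derivative is absorbed into the distribution, so the induction over the
  list lets \<open>T\<close> vary. An arbitrary direction is a finite combination of coordinate
  directions.\<close>

lemma distribution_iterated_deriv:
  assumes "distribution T"
  shows "distribution (\<lambda>\<phi>. T (iterated_deriv vs \<phi>))"
proof -
  have Basis: "distribution (\<lambda>\<phi>. T (iterated_deriv [b] \<phi>))"
    if "distribution T" "b \<in> Basis" for T :: "('a \<Rightarrow> complex) \<Rightarrow> complex" and b
  proof (rule distribution_compose[OF that(1), where m = 1])
    show "\<exists>C. \<forall>\<phi>. test_function \<phi> \<longrightarrow> {x. \<phi> x \<noteq> 0} \<subseteq> K \<longrightarrow>
        (\<forall>x. norm (iterated_deriv vs (iterated_deriv [b] \<phi>) x) \<le> C * test_seminorm (1 + length vs) \<phi>)"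
      if "vs \<in> lists Basis" for K :: "'a set" and vs
      using that \<open>b \<in> Basis\<close> unfolding iterated_deriv_append[symmetric]
      by (intro exI[of _ 1]) (auto intro!: test_seminorm_ge)
    show "iterated_deriv [b] (\<lambda>x. c * \<phi> x) = (\<lambda>x. c * iterated_deriv [b] \<phi> x)"
      if "test_function \<phi>" for c and \<phi> :: "'a \<Rightarrow> complex"
    proof -
      have "iterated_deriv [b] (\<lambda>x::'a. c) = (\<lambda>x. 0)"
        by (simp add: frechet_derivative_eq[OF has_derivative_const])
      then show ?thesis
        using iterated_deriv_mult[of "\<lambda>_. c" \<phi> b, OF _ smooth_differentiable] that
        by (simp add: test_function_def del: iterated_deriv.simps)
    qed
    show "{x. iterated_deriv [b] \<phi> x \<noteq> 0} \<subseteq> K"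
      if "compact K" "{x. \<phi> x \<noteq> 0} \<subseteq> K" for K and \<phi> :: "'a \<Rightarrow> complex"
      using that by (intro iterated_deriv_support compact_imp_closed)
    show "iterated_deriv [b] (\<lambda>x. \<phi> x + \<psi> x) = (\<lambda>x. iterated_deriv [b] \<phi> x + iterated_deriv [b] \<psi> x)"
      if "test_function \<phi>" "test_function \<psi>" for \<phi> \<psi> :: "'a \<Rightarrow> complex"
      using that by (intro iterated_deriv_add smooth_differentiable) (auto simp: test_function_def)
  qed (intro test_function_iterated_deriv)
  have *: "distribution (\<lambda>\<phi>. T (iterated_deriv [v] \<phi>))" if T: "distribution T"
    for T :: "('a \<Rightarrow> complex) \<Rightarrow> complex" and v
  proof -
    have "T (iterated_deriv [v] \<phi>) = (\<Sum>b\<in>Basis. of_real (v \<bullet> b) * T (iterated_deriv [b] \<phi>))"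
      if "test_function \<phi>" for \<phi>
    proof -
      have eq: "iterated_deriv [v] \<phi> = (\<lambda>x. \<Sum>b\<in>Basis. of_real (v \<bullet> b) * iterated_deriv [b] \<phi> x)"
        using that by (intro iterated_deriv_direction smooth_differentiable) (simp add: test_function_def)
      show ?thesis
        unfolding eq
        by (rule conjunct1[OF distribution_linear_sum[OF T test_function_iterated_deriv[OF that]]])
    qed
    moreover have "distribution (\<lambda>\<phi>. \<Sum>b\<in>Basis. of_real (v \<bullet> b) * T (iterated_deriv [b] \<phi>))"
      by (intro distribution_sum distribution_cmult Basis T)
    ultimately show ?thesis
      unfolding distribution_altdef
      by (auto simp del: iterated_deriv.simps simp: test_function_add test_function_cmult)
  qed
  show ?thesis
    using assms
  proof (induction vs arbitrary: T)
    case (Cons v vs)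
    then show ?case
      using Cons.IH[OF *[OF Cons.prems, of v]] by simp
  qed simp
qed

text \<open>The innermost derivative is peeled off with the product rule. Both resulting terms have
  the original shape, one of them with \<open>h\<close> replaced by its derivative, which is why
  \<open>h\<close> varies in the induction.\<close>

lemma distribution_mult:
  assumes T: "distribution T" and h: "smooth h"
  shows "distribution (\<lambda>\<phi>. T (\<lambda>x. h x * \<phi> x))"
proof (rule distribution_compose[OF T, where m = 0])
  have "\<exists>C. \<forall>\<phi>. test_function \<phi> \<longrightarrow> {x. \<phi> x \<noteq> 0} \<subseteq> K \<longrightarrow>
      (\<forall>x. norm (iterated_deriv vs (\<lambda>x. h x * \<phi> x) x) \<le> C * test_seminorm (length vs) \<phi>)"
    if K: "compact K" and "vs \<in> lists Basis" "smooth h" for K vs and h :: "'a \<Rightarrow> complex"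
    using that(2,3)
  proof (induction vs arbitrary: h rule: rev_induct)
    case Nil
    have "bounded (h ` K)"
      using K Nil by (intro compact_imp_bounded compact_continuous_image smooth_continuous)
    then obtain C where C: "\<And>x. x \<in> K \<Longrightarrow> norm (h x) \<le> C"
      unfolding bounded_iff by auto
    have "norm (h x * \<phi> x) \<le> \<bar>C\<bar> * test_seminorm 0 \<phi>"
      if "test_function \<phi>" "{x. \<phi> x \<noteq> 0} \<subseteq> K" for \<phi> x
    proof (cases "x \<in> K")
      case True
      then show ?thesis
        using C[of x] test_seminorm_ge[OF that(1), of "[]" 0 x]
        by (auto simp: norm_mult intro!: mult_mono)
    next
      case False
      then have "\<phi> x = 0" using that by auto
      then show ?thesis using test_seminorm_nonneg[OF that(1)] by simp
    qed
    then show ?case by auto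
  next
    case (snoc v vs)
    have v: "v \<in> Basis" and vs: "vs \<in> lists Basis" using snoc.prems by auto
    obtain C where C: "\<And>\<phi> x. test_function \<phi> \<Longrightarrow> {x. \<phi> x \<noteq> 0} \<subseteq> K \<Longrightarrow>
        norm (iterated_deriv vs (\<lambda>x. h x * \<phi> x) x) \<le> C * test_seminorm (length vs) \<phi>"
      using snoc.IH[OF vs snoc.prems(2)] by auto
    obtain D where D: "\<And>\<phi> x. test_function \<phi> \<Longrightarrow> {x. \<phi> x \<noteq> 0} \<subseteq> K \<Longrightarrow>
        norm (iterated_deriv vs (\<lambda>x. iterated_deriv [v] h x * \<phi> x) x) \<le> D * test_seminorm (length vs) \<phi>"
      using snoc.IH[OF vs smooth_iterated_deriv[OF snoc.prems(2), of "[v]"]] by auto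
    \<comment> \<open>\<open>M\<close> counts words: each derivative of order at most
      \<open>length vs\<close> of \<open>iterated_deriv [v] \<phi>\<close> is a derivative of order
      at most \<open>Suc (length vs)\<close> of \<open>\<phi>\<close>.\<close>
    define M where "M = real (card {ws \<in> lists (Basis::'a set). length ws \<le> length vs})"
    have add: "iterated_deriv ws (\<lambda>x. f x + g x) = (\<lambda>x. iterated_deriv ws f x + iterated_deriv ws g x)"
      if "smooth f" "smooth g" for f g :: "'a \<Rightarrow> complex" and ws
    proof (induction ws)
      case (Cons w ws)
      have "iterated_deriv (w # ws) (\<lambda>x. f x + g x) = iterated_deriv [w] (iterated_deriv ws (\<lambda>x. f x + g x))"
        by simp
      also have "\<dots> = (\<lambda>x. iterated_deriv [w] (iterated_deriv ws f) x + iterated_deriv [w] (iterated_deriv ws g) x)"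
        unfolding Cons.IH
        by (intro iterated_deriv_add smooth_differentiable smooth_iterated_deriv that)
      finally show ?case by simp
    qed simp
    have "norm (iterated_deriv (vs @ [v]) (\<lambda>x. h x * \<phi> x) x)
        \<le> (\<bar>C\<bar> * M + \<bar>D\<bar>) * test_seminorm (Suc (length vs)) \<phi>"
      if \<phi>: "test_function \<phi>" "{x. \<phi> x \<noteq> 0} \<subseteq> K" for \<phi> x
    proof -
      have sm: "smooth \<phi>" using \<phi>(1) by (simp add: test_function_def)
      have \<phi>': "test_function (iterated_deriv [v] \<phi>)" "{x. iterated_deriv [v] \<phi> x \<noteq> 0} \<subseteq> K"
        using \<phi> K by (intro test_function_iterated_deriv iterated_deriv_support compact_imp_closed; simp)+
      have "test_seminorm (length vs) (iterated_deriv [v] \<phi>) \<le>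
          (\<Sum>ws \<in> {ws \<in> lists (Basis::'a set). length ws \<le> length vs}. test_seminorm (Suc (length vs)) \<phi>)"
        using v \<phi>(1)
        by (intro test_seminorm_le) (auto simp del: iterated_deriv.simps
            simp: iterated_deriv_append[symmetric] intro!: test_seminorm_ge)
      then have le: "test_seminorm (length vs) (iterated_deriv [v] \<phi>) \<le> M * test_seminorm (Suc (length vs)) \<phi>"
        by (simp add: M_def)
      have "iterated_deriv (vs @ [v]) (\<lambda>x. h x * \<phi> x) x =
          iterated_deriv vs (\<lambda>x. h x * iterated_deriv [v] \<phi> x + iterated_deriv [v] h x * \<phi> x) x"
        using snoc.prems(2) sm
        by (simp add: iterated_deriv_append iterated_deriv_mult smooth_differentiable del: iterated_deriv.simps)
      also have "\<dots> = iterated_deriv vs (\<lambda>x. h x * iterated_deriv [v] \<phi> x) x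
          + iterated_deriv vs (\<lambda>x. iterated_deriv [v] h x * \<phi> x) x"
        using snoc.prems(2) sm by (subst add) (auto intro!: smooth_mult smooth_iterated_deriv simp del: iterated_deriv.simps)
      finally have "norm (iterated_deriv (vs @ [v]) (\<lambda>x. h x * \<phi> x) x) \<le>
          C * test_seminorm (length vs) (iterated_deriv [v] \<phi>) + D * test_seminorm (length vs) \<phi>"
        using C[OF \<phi>', of x] D[OF \<phi>, of x] by (simp only:) (rule order_trans[OF norm_triangle_ineq add_mono])
      also have "\<dots> \<le> \<bar>C\<bar> * (M * test_seminorm (Suc (length vs)) \<phi>) + \<bar>D\<bar> * test_seminorm (Suc (length vs)) \<phi>"
        using \<phi> \<phi>' le by (intro add_mono mult_mono test_seminorm_mono test_seminorm_nonneg) auto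
      finally show ?thesis by (simp add: algebra_simps)
    qed
    then show ?case by auto
  qed
  then show "\<exists>C. \<forall>\<phi>. test_function \<phi> \<longrightarrow> {x. \<phi> x \<noteq> 0} \<subseteq> K \<longrightarrow>
      (\<forall>x. norm (iterated_deriv vs (\<lambda>x. h x * \<phi> x) x) \<le> C * test_seminorm (0 + length vs) \<phi>)"
    if "compact K" "vs \<in> lists Basis" for K vs
    using that h by simp
qed (auto intro: test_function_mult[OF h] simp: distrib_left mult.left_commute)

section \<open>Decomposing polyhedra into simplicial cones\<close>

text \<open>The scale \<open>k\<close> is a variable of the form, so affine inequalities become
  homogeneous and a single list of forms describes all dilates.\<close>

definition form_val :: "'b set \<Rightarrow> ('b \<Rightarrow> int) \<times> int \<Rightarrow> ('b \<Rightarrow> int) \<Rightarrow> int \<Rightarrow> int" where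
  "form_val B f n k = (\<Sum>b\<in>B. fst f b * n b) + snd f * k"

definition forms_indicator :: "'b set \<Rightarrow> (('b \<Rightarrow> int) \<times> int) list \<Rightarrow> ('b \<Rightarrow> int) \<Rightarrow> int \<Rightarrow> complex" where
  "forms_indicator B fs n k = of_bool (\<forall>f\<in>set fs. form_val B f n k \<ge> 0)"

text \<open>The parametrization runs from the new coordinates \<open>\<mu>\<close> to the old ones.
  In the cones that arise below, the \<open>\<mu> j\<close> are values of integral forms, and
  inverting this change of coordinates is what makes \<open>g\<close> rational. Coordinates outside
  \<open>J\<close> run over all integers, and the translation part grows linearly with
  \<open>k\<close>.\<close>

definition cone_region ::
    "'b set \<Rightarrow> 'b set \<Rightarrow> ('b \<Rightarrow> 'b \<Rightarrow> real) \<Rightarrow> ('b \<Rightarrow> real) \<Rightarrow> ('b \<Rightarrow> int) \<Rightarrow> int \<Rightarrow> bool" where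
  "cone_region B J g g0 n k \<longleftrightarrow> (\<exists>\<mu>::'b \<Rightarrow> int. (\<forall>j\<in>J. \<mu> j \<ge> 0) \<and>
     (\<forall>b\<in>B. real_of_int (n b) = (\<Sum>j\<in>B. g b j * real_of_int (\<mu> j)) + g0 b * real_of_int k))"

text \<open>The last premise of \<open>cone\<close> is injectivity of \<open>g\<close> on real
  vectors, so distinct parameters give distinct points. Rule \<open>cong\<close> compares functions
  at positive scales, where \<open>snd f * k\<close> has the sign of \<open>snd f\<close>.\<close>

inductive conic :: "'b set \<Rightarrow> (('b \<Rightarrow> int) \<Rightarrow> int \<Rightarrow> complex) \<Rightarrow> bool" for B where
  cone: "J \<subseteq> B \<Longrightarrow> (\<And>b j. b \<in> B \<Longrightarrow> j \<in> B \<Longrightarrow> g b j \<in> \<rat>) \<Longrightarrow> (\<And>b. b \<in> B \<Longrightarrow> g0 b \<in> \<rat>) \<Longrightarrow>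
    (\<And>y j. (\<And>b. b \<in> B \<Longrightarrow> (\<Sum>j\<in>B. g b j * y j) = 0) \<Longrightarrow> j \<in> B \<Longrightarrow> y j = 0) \<Longrightarrow>
    conic B (\<lambda>n k. of_bool (cone_region B J g g0 n k))"
| add: "conic B s \<Longrightarrow> conic B t \<Longrightarrow> conic B (\<lambda>n k. s n k + t n k)"
| cmult: "conic B s \<Longrightarrow> conic B (\<lambda>n k. c * s n k)"
| cong: "conic B s \<Longrightarrow> (\<And>n k. k > 0 \<Longrightarrow> t n k = s n k) \<Longrightarrow> conic B t"

text \<open>A form with nonzero coefficient at \<open>b\<close> can replace \<open>n b\<close> as a
  coordinate. With \<open>flag\<close> the new coordinate has to be nonnegative and \<open>b\<close>
  joins \<open>J\<close>; otherwise \<open>n b\<close> stays unconstrained.\<close>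

lemma conic_insert:
  assumes "finite B" "b \<notin> B" "conic B s" "fst f b \<noteq> 0"
  shows "conic (insert b B) (\<lambda>n k. s n k * of_bool (flag \<longrightarrow> form_val (insert b B) f n k \<ge> 0))"
  using assms(3)
proof induction
  case (cone J g g0)
  define p where "p = real_of_int (fst f b)"
  define w where "w = (\<lambda>c. real_of_int (fst f c))"
  define w0 where "w0 = real_of_int (snd f)"
  \<comment> \<open>Row \<open>b\<close> solves \<open>\<mu> b = form_val (insert b B) f n k\<close>
    for \<open>n b\<close>, after the other coordinates have been expressed through \<open>g\<close>
    and \<open>g0\<close>; the division is by the coefficient \<open>p\<close>.\<close>
  define h where "h = (\<lambda>c j. if c = b then (if j = b then 1 else - (\<Sum>c\<in>B. w c * g c j)) / p
    else if j = b then 0 else g c j)"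
  define h0 where "h0 = (\<lambda>c. if c = b then - ((\<Sum>c\<in>B. w c * g0 c) + w0) / p else g0 c)"
  define J' where "J' = (if flag then insert b J else J)"
  have p: "p \<noteq> 0" using assms(4) by (simp add: p_def)
  have ne: "c \<noteq> b" if "c \<in> B" for c using that assms(2) by auto
  have sumB: "(\<Sum>j\<in>insert b B. h c j * y j) = (\<Sum>j\<in>B. g c j * y j)" if "c \<in> B" for c and y :: "'a \<Rightarrow> real"
    using assms(1,2) ne that by (simp add: h_def ne)
  have sumb: "p * (\<Sum>j\<in>insert b B. h b j * y j) = y b - (\<Sum>c\<in>B. w c * (\<Sum>j\<in>B. g c j * y j))"
    for y :: "'a \<Rightarrow> real"
  proof -
    have "p * (\<Sum>j\<in>insert b B. h b j * y j) = y b + (\<Sum>j\<in>B. - (\<Sum>c\<in>B. w c * g c j) * y j)"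
      using assms(1,2) p ne by (simp add: h_def distrib_left sum_distrib_left)
    also have "(\<Sum>j\<in>B. - (\<Sum>c\<in>B. w c * g c j) * y j) = - (\<Sum>j\<in>B. \<Sum>c\<in>B. w c * g c j * y j)"
      by (simp add: sum_distrib_right sum_negf)
    also have "(\<Sum>j\<in>B. \<Sum>c\<in>B. w c * g c j * y j) = (\<Sum>c\<in>B. \<Sum>j\<in>B. w c * g c j * y j)"
      by (rule sum.swap)
    finally show ?thesis by (simp add: sum_distrib_left mult.assoc)
  qed
  have form: "real_of_int (form_val (insert b B) f n k) = p * n b + (\<Sum>c\<in>B. w c * n c) + w0 * k" for n k
    using assms(1,2) by (simp add: form_val_def p_def w_def w0_def)
  have eq_iff: "real_of_int (n b) = (\<Sum>j\<in>insert b B. h b j * real_of_int (\<mu> j)) + h0 b * real_of_int k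
      \<longleftrightarrow> \<mu> b = form_val (insert b B) f n k"
    if "\<forall>c\<in>B. real_of_int (n c) = (\<Sum>j\<in>B. g c j * real_of_int (\<mu> j)) + g0 c * real_of_int k"
    for \<mu> n and k :: int
  proof -
    have "(\<Sum>c\<in>B. w c * n c) = (\<Sum>c\<in>B. w c * (\<Sum>j\<in>B. g c j * real_of_int (\<mu> j))) + (\<Sum>c\<in>B. w c * g0 c) * k"
      using that by (simp add: distrib_left sum.distrib sum_distrib_right mult.assoc)
    moreover have "p * (h0 b * real_of_int k) = - ((\<Sum>c\<in>B. w c * g0 c) + w0) * k"
      using p by (simp add: h0_def)
    moreover have "real_of_int (n b) = (\<Sum>j\<in>insert b B. h b j * real_of_int (\<mu> j)) + h0 b * real_of_int k
        \<longleftrightarrow> p * n b = p * (\<Sum>j\<in>insert b B. h b j * real_of_int (\<mu> j)) + p * (h0 b * real_of_int k)"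
      using p by (simp only: distrib_left[symmetric] mult_cancel_left) simp
    moreover have "\<mu> b = form_val (insert b B) f n k \<longleftrightarrow> real_of_int (\<mu> b) = p * n b + (\<Sum>c\<in>B. w c * n c) + w0 * k"
      unfolding form[symmetric] by simp
    ultimately show ?thesis
      unfolding sumb by (auto simp: algebra_simps)
  qed
  have h0B: "h0 c = g0 c" if "c \<in> B" for c using ne that by (simp add: h0_def)
  have region: "cone_region (insert b B) J' h h0 n k \<longleftrightarrow>
      cone_region B J g g0 n k \<and> (flag \<longrightarrow> form_val (insert b B) f n k \<ge> 0)" for n k
  proof
    assume "cone_region (insert b B) J' h h0 n k"
    then obtain \<mu> where \<mu>: "\<forall>j\<in>J'. \<mu> j \<ge> 0" and eq: "\<forall>c\<in>insert b B. real_of_int (n c) =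
        (\<Sum>j\<in>insert b B. h c j * real_of_int (\<mu> j)) + h0 c * real_of_int k"
      unfolding cone_region_def by blast
    have *: "\<forall>c\<in>B. real_of_int (n c) = (\<Sum>j\<in>B. g c j * real_of_int (\<mu> j)) + g0 c * real_of_int k"
      using eq sumB h0B by auto
    then have "\<mu> b = form_val (insert b B) f n k"
      using eq eq_iff by blast
    then show "cone_region B J g g0 n k \<and> (flag \<longrightarrow> form_val (insert b B) f n k \<ge> 0)"
      using \<mu> * unfolding cone_region_def J'_def by (metis insert_iff)
  next
    assume asm: "cone_region B J g g0 n k \<and> (flag \<longrightarrow> form_val (insert b B) f n k \<ge> 0)"
    then obtain \<nu> where \<nu>: "\<forall>j\<in>J. \<nu> j \<ge> 0" and eq: "\<forall>c\<in>B. real_of_int (n c) =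
        (\<Sum>j\<in>B. g c j * real_of_int (\<nu> j)) + g0 c * real_of_int k"
      unfolding cone_region_def by blast
    define \<mu> where "\<mu> = \<nu>(b := form_val (insert b B) f n k)"
    have "(\<Sum>j\<in>B. g c j * real_of_int (\<mu> j)) = (\<Sum>j\<in>B. g c j * real_of_int (\<nu> j))" for c
      by (intro sum.cong) (auto simp: \<mu>_def ne)
    with eq have *: "\<forall>c\<in>B. real_of_int (n c) = (\<Sum>j\<in>B. g c j * real_of_int (\<mu> j)) + g0 c * real_of_int k"
      by simp
    then have "real_of_int (n b) = (\<Sum>j\<in>insert b B. h b j * real_of_int (\<mu> j)) + h0 b * real_of_int k"
      by (simp only: eq_iff) (simp add: \<mu>_def)
    moreover have "\<forall>c\<in>B. real_of_int (n c) = (\<Sum>j\<in>insert b B. h c j * real_of_int (\<mu> j)) + h0 c * real_of_int k"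
      using * sumB h0B by auto
    moreover have "\<forall>j\<in>J'. \<mu> j \<ge> 0"
      using \<nu> asm cone(1) ne by (auto simp: J'_def \<mu>_def split: if_splits)
    ultimately show "cone_region (insert b B) J' h h0 n k"
      unfolding cone_region_def by (intro exI[of _ \<mu>]) blast
  qed
  have "conic (insert b B) (\<lambda>n k. of_bool (cone_region (insert b B) J' h h0 n k))"
  proof (rule conic.cone)
    show "J' \<subseteq> insert b B" using cone by (auto simp: J'_def)
    show "h c j \<in> \<rat>" if "c \<in> insert b B" "j \<in> insert b B" for c j
      using that cone(2)
      by (auto simp: h_def p_def w_def intro!: Rats_divide Rats_minus_iff[THEN iffD2] Rats_sum Rats_mult)
    show "h0 c \<in> \<rat>" if "c \<in> insert b B" for c
      using that cone(3)
      by (auto simp: h0_def p_def w_def w0_def intro!: Rats_divide Rats_minus_iff[THEN iffD2] Rats_add Rats_diff Rats_sum Rats_mult)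
    show "y j = 0" if y: "\<And>c. c \<in> insert b B \<Longrightarrow> (\<Sum>j\<in>insert b B. h c j * y j) = 0" and j: "j \<in> insert b B" for y j
    proof -
      have B: "(\<Sum>j\<in>B. g c j * y j) = 0" if "c \<in> B" for c
        using y[of c] sumB that by simp
      then have "y j = 0" if "j \<in> B" for j
        using cone(4) that by blast
      moreover have "y b = 0"
        using sumb[of y] y[of b] B by simp
      ultimately show ?thesis using j by auto
    qed
  qed
  then show ?case by (simp add: region of_bool_conj)
next
  case (add s t)
  then show ?case using conic.add[OF add.IH] by (simp add: distrib_right)
next
  case (cmult s c)
  then show ?case using conic.cmult[OF cmult.IH, of c] by (simp add: mult.assoc)
next
  case (cong s t)
  then show ?case by (intro conic.cong[OF cong.IH]) simp
qed

lemma forms_indicator_Cons: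
  "forms_indicator B (f # fs) n k = of_bool (form_val B f n k \<ge> 0) * forms_indicator B fs n k"
  by (simp add: forms_indicator_def of_bool_conj)

text \<open>The inner induction counts the forms that involve \<open>b\<close>. If there is none,
  \<open>b\<close> is free; a single one becomes the coordinate of \<open>conic_insert\<close>. Two
  of them admit a combination \<open>h\<close> without \<open>b\<close>, and distinguishing the sign
  of \<open>h\<close> expresses the indicator through lists in which one form involving
  \<open>b\<close> has disappeared.\<close>

theorem conic_forms_indicator:
  assumes "finite B"
  shows "conic B (forms_indicator B fs)"
  using assms
proof (induction B arbitrary: fs rule: finite_induct)
  case empty
  \<comment> \<open>Without coordinates the forms are constants times \<open>k\<close>, and the cone
    condition always holds.\<close>
  have "conic {} (\<lambda>n k. of_bool (\<forall>f\<in>set fs. snd f \<ge> 0) * of_bool (cone_region {} {} undefined undefined n k))"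
    by (intro conic.cmult conic.cone) auto
  then show ?case
    by (rule conic.cong) (auto simp: forms_indicator_def form_val_def cone_region_def zero_le_mult_iff)
next
  case (insert b B)
  show ?case
  proof (induction "length (filter (\<lambda>f. fst f b \<noteq> 0) fs)" arbitrary: fs rule: less_induct)
    case less
    have ext: "form_val (insert b B) f n k = form_val B f n k" if "fst f b = 0" for f n k
      using that insert.hyps by (simp add: form_val_def)
    have ext_list: "forms_indicator (insert b B) gs = forms_indicator B gs"
      if "filter (\<lambda>f. fst f b \<noteq> 0) gs = []" for gs
      using that by (auto simp: forms_indicator_def ext fun_eq_iff filter_empty_conv)
    define N where "N = filter (\<lambda>f. fst f b = 0) fs"
    consider "filter (\<lambda>f. fst f b \<noteq> 0) fs = []"
      | f where "filter (\<lambda>f. fst f b \<noteq> 0) fs = [f]"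
      | f g gs where "filter (\<lambda>f. fst f b \<noteq> 0) fs = f # g # gs"
      by (metis list.exhaust)
    then show ?case
    proof cases
      case 1
      \<comment> \<open>With the flag off, any form with nonzero coefficient at \<open>b\<close>
        serves as the coordinate.\<close>
      have "conic (insert b B) (\<lambda>n k. forms_indicator B fs n k *
          of_bool (False \<longrightarrow> form_val (insert b B) (\<lambda>_. 1, 0) n k \<ge> 0))"
        using insert by (intro conic_insert) auto
      then show ?thesis using ext_list[OF 1] by simp
    next
      case (2 f)
      have mem: "set fs = set N \<union> {f}"
      proof -
        have "set fs = set (filter (\<lambda>f. fst f b \<noteq> 0) fs) \<union> set N" by (auto simp: N_def)
        then show ?thesis unfolding 2 by auto
      qed
      have f: "fst f b \<noteq> 0"
        using 2 by (metis (mono_tags, lifting) list.set_intros(1) mem_Collect_eq set_filter)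
      have conic: "conic (insert b B) (\<lambda>n k. forms_indicator B N n k *
          of_bool (True \<longrightarrow> form_val (insert b B) f n k \<ge> 0))"
        using insert f by (intro conic_insert) auto
      have "forms_indicator B N n k = forms_indicator (insert b B) N n k" for n k
        by (subst ext_list) (simp_all add: N_def filter_empty_conv)
      then show ?thesis
        by (intro conic.cong[OF conic]) (auto simp: forms_indicator_def mem)
    next
      case (3 f g gs)
      have mem: "set fs = set (f # g # gs @ N)"
      proof -
        have "set fs = set (filter (\<lambda>f. fst f b \<noteq> 0) fs) \<union> set N" by (auto simp: N_def)
        then show ?thesis unfolding 3 by auto
      qed
      have "h \<in> set (f # g # gs) \<Longrightarrow> fst h b \<noteq> 0" for h
        unfolding 3[symmetric] by simp
      then have nz: "fst f b \<noteq> 0" "fst g b \<noteq> 0" "\<And>h. h \<in> set gs \<Longrightarrow> fst h b \<noteq> 0" by auto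
      define comb :: "int \<Rightarrow> int \<Rightarrow> ('a \<Rightarrow> int) \<times> int" where
        "comb x y = (\<lambda>c. x * fst f c + y * fst g c, x * snd f + y * snd g)" for x y
      have comb: "form_val C (comb x y) n k = x * form_val C f n k + y * form_val C g n k" for C x y n k
        by (simp add: form_val_def comb_def sum.distrib sum_distrib_left algebra_simps)
      define rest where "rest = gs @ N"
      have len: "length (filter (\<lambda>f. fst f b \<noteq> 0) rest) = length gs"
        using nz(3) by (simp add: rest_def N_def)
      have IH: "conic (insert b B) (forms_indicator (insert b B) hs)"
        if "length (filter (\<lambda>f. fst f b \<noteq> 0) hs) < Suc (Suc (length gs))" for hs
        using less[of hs] that 3 by simp
      let ?i = "forms_indicator (insert b B)"
      have fs: "?i fs n k = of_bool (form_val (insert b B) f n k \<ge> 0) * of_bool (form_val (insert b B) g n k \<ge> 0) * ?i rest n k" for n k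
        by (auto simp: forms_indicator_def mem rest_def)
      show ?thesis
      proof (cases "fst f b * fst g b > 0")
        case True
        \<comment> \<open>Same signs: \<open>h\<close> compares two bounds on \<open>n b\<close>
          from the same side. Where \<open>h\<close> is nonnegative \<open>f\<close> is the stronger
          condition, elsewhere \<open>g\<close> is, whence
          \<open>[f] [g] = [h] [f] + [g] - [h] [g]\<close>.\<close>
        define h where "h = comb (- \<bar>fst g b\<bar>) \<bar>fst f b\<bar>"
        have h0: "fst h b = 0"
          using True by (auto simp: h_def comb_def zero_less_mult_iff)
        have conic: "conic (insert b B) (\<lambda>n k. (?i (h # f # rest) n k + ?i (g # rest) n k) + (- 1) * ?i (h # g # rest) n k)"
          using nz h0 by (intro conic.add conic.cmult IH) (simp_all add: len)
        have "?i fs n k = (?i (h # f # rest) n k + ?i (g # rest) n k) + (- 1) * ?i (h # g # rest) n k" for n k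
        proof -
          let ?f = "form_val (insert b B) f n k" and ?g = "form_val (insert b B) g n k"
          have h: "form_val (insert b B) h n k = \<bar>fst f b\<bar> * ?g - \<bar>fst g b\<bar> * ?f"
            by (simp add: h_def comb)
          have pos: "\<bar>fst f b\<bar> > 0" "\<bar>fst g b\<bar> > 0" using nz by auto
          have 1: "\<bar>fst f b\<bar> * ?g \<ge> \<bar>fst g b\<bar> * ?f" if "?f < 0" "?g \<ge> 0"
          proof -
            have "\<bar>fst f b\<bar> * ?g \<ge> 0" "\<bar>fst g b\<bar> * ?f \<le> 0"
              using that pos by (auto intro: mult_nonneg_nonpos)
            then show ?thesis by linarith
          qed
          have 2: "\<not> \<bar>fst f b\<bar> * ?g \<ge> \<bar>fst g b\<bar> * ?f" if "?f \<ge> 0" "?g < 0"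
          proof -
            have "\<bar>fst f b\<bar> * ?g < 0" "\<bar>fst g b\<bar> * ?f \<ge> 0"
              using that pos by (auto intro: mult_pos_neg)
            then show ?thesis by linarith
          qed
          show ?thesis
            unfolding fs forms_indicator_Cons h
            using 1 2 by (cases "?f \<ge> 0"; cases "?g \<ge> 0") auto
        qed
        then show ?thesis by (intro conic.cong[OF conic])
      next
        case False
        \<comment> \<open>Opposite signs: the positive combination \<open>h\<close> is nonnegative
          where both forms are and negative where both are, whence
          \<open>[f] [g] = [h] ([f] + [g] - 1)\<close>.\<close>
        define h where "h = comb \<bar>fst g b\<bar> \<bar>fst f b\<bar>"
        have h0: "fst h b = 0"
          using False nz by (auto simp: h_def comb_def zero_less_mult_iff abs_if not_less)
        have conic: "conic (insert b B) (\<lambda>n k. (?i (h # f # rest) n k + ?i (h # g # rest) n k) + (- 1) * ?i (h # rest) n k)"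
          using nz h0 by (intro conic.add conic.cmult IH) (simp_all add: len)
        have "?i fs n k = (?i (h # f # rest) n k + ?i (h # g # rest) n k) + (- 1) * ?i (h # rest) n k" for n k
        proof -
          let ?f = "form_val (insert b B) f n k" and ?g = "form_val (insert b B) g n k"
          have h: "form_val (insert b B) h n k = \<bar>fst g b\<bar> * ?f + \<bar>fst f b\<bar> * ?g"
            by (simp add: h_def comb)
          have pos: "\<bar>fst f b\<bar> > 0" "\<bar>fst g b\<bar> > 0" using nz by auto
          have 1: "\<not> \<bar>fst g b\<bar> * ?f + \<bar>fst f b\<bar> * ?g \<ge> 0" if "?f < 0" "?g < 0"
          proof -
            have "\<bar>fst f b\<bar> * ?g < 0" "\<bar>fst g b\<bar> * ?f < 0"
              using that pos by (auto intro: mult_pos_neg)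
            then show ?thesis by linarith
          qed
          have 2: "\<bar>fst g b\<bar> * ?f + \<bar>fst f b\<bar> * ?g \<ge> 0" if "?f \<ge> 0" "?g \<ge> 0"
            using that by simp
          show ?thesis
            unfolding fs forms_indicator_Cons h
            using 1 2 by (cases "?f \<ge> 0"; cases "?g \<ge> 0") auto
        qed
        then show ?thesis by (intro conic.cong[OF conic])
      qed
    qed
  qed
qed

section \<open>Product Lebesgue measure\<close>

abbreviation lborel_PiM :: "'b set \<Rightarrow> ('b \<Rightarrow> real) measure" where
  "lborel_PiM B \<equiv> Pi\<^sub>M B (\<lambda>_. lborel)"

interpretation lborel_prod: product_sigma_finite "\<lambda>_. lborel :: real measure"
  by standard

text \<open>A measure on a finite product is determined by boxes, where the one-dimensional change
  of variables applies factor by factor and each factor contributes \<open>c\<close>.\<close>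

lemma lborel_PiM_affine:
  assumes "finite B" "c > 0"
  shows "lborel_PiM B =
    density (distr (lborel_PiM B) (lborel_PiM B) (\<lambda>x. \<lambda>b\<in>B. a b + c * x b)) (\<lambda>_. ennreal (c ^ card B))"
    (is "_ = density (distr ?M ?M ?f) _")
proof (rule lborel_prod.PiM_eqI[OF assms(1), symmetric])
  have meas: "?f \<in> measurable ?M ?M"
    by (rule measurable_restrict) auto
  fix A :: "'a \<Rightarrow> real set" assume A: "\<And>b. b \<in> B \<Longrightarrow> A b \<in> sets lborel"
  have affine: "emeasure lborel S = ennreal c * emeasure lborel ((\<lambda>x. a b + c * x) -` S)" if "S \<in> sets borel" for S b
  proof -
    have "emeasure lborel S = emeasure (density (distr lborel borel (\<lambda>x. a b + c * x)) (\<lambda>_. ennreal \<bar>c\<bar>)) S"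
      using lborel_real_affine[of c "a b"] assms(2) by simp
    also have "\<dots> = ennreal c * emeasure (distr lborel borel (\<lambda>x. a b + c * x)) S"
      using that assms(2) by (subst emeasure_density_const) auto
    also have "\<dots> = ennreal c * emeasure lborel ((\<lambda>x. a b + c * x) -` S)"
      using that by (subst emeasure_distr) auto
    finally show ?thesis .
  qed
  have box: "?f -` Pi\<^sub>E B A \<inter> space ?M = Pi\<^sub>E B (\<lambda>b. (\<lambda>x. a b + c * x) -` A b)"
    by (auto simp: space_PiM PiE_iff)
  have vim: "(\<lambda>x. a b + c * x) -` A b \<in> sets lborel" if "b \<in> B" for b
  proof -
    have "(\<lambda>x. a b + c * x) \<in> borel_measurable borel" by measurable
    from measurable_sets[OF this, of "A b"] show ?thesis using A[OF that] by simp
  qed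
  have "emeasure (density (distr ?M ?M ?f) (\<lambda>_. ennreal (c ^ card B))) (Pi\<^sub>E B A)
      = ennreal (c ^ card B) * emeasure (distr ?M ?M ?f) (Pi\<^sub>E B A)"
    using A assms(1) by (subst emeasure_density_const) (auto intro!: sets_PiM_I_finite)
  also have "emeasure (distr ?M ?M ?f) (Pi\<^sub>E B A) = emeasure ?M (Pi\<^sub>E B (\<lambda>b. (\<lambda>x. a b + c * x) -` A b))"
    using A assms(1) meas by (subst emeasure_distr) (auto intro!: sets_PiM_I_finite simp: box)
  also have "\<dots> = (\<Prod>b\<in>B. emeasure lborel ((\<lambda>x. a b + c * x) -` A b))"
    using vim assms(1) by (intro lborel_prod.emeasure_PiM) auto
  also have "ennreal (c ^ card B) * \<dots> = (\<Prod>b\<in>B. ennreal c * emeasure lborel ((\<lambda>x. a b + c * x) -` A b))"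
    using assms by (simp add: prod.distrib ennreal_power)
  also have "\<dots> = (\<Prod>b\<in>B. emeasure lborel (A b))"
    using A affine by (intro prod.cong) auto
  finally show "emeasure (density (distr ?M ?M ?f) (\<lambda>_. ennreal (c ^ card B))) (Pi\<^sub>E B A) =
      (\<Prod>b\<in>B. emeasure lborel (A b))" .
qed auto

lemma integral_lborel_PiM_affine:
  fixes f :: "('b \<Rightarrow> real) \<Rightarrow> complex"
  assumes "finite B" "c > 0" "f \<in> borel_measurable (lborel_PiM B)"
  shows "integral\<^sup>L (lborel_PiM B) f = of_real (c ^ card B) * (\<integral>x. f (\<lambda>b\<in>B. a b + c * x b) \<partial>lborel_PiM B)"
proof -
  have meas: "(\<lambda>x. \<lambda>b\<in>B. a b + c * x b) \<in> measurable (lborel_PiM B) (lborel_PiM B)"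
    by (rule measurable_restrict) auto
  have "integral\<^sup>L (lborel_PiM B) f =
      (\<integral>x. (c ^ card B) *\<^sub>R f x \<partial>distr (lborel_PiM B) (lborel_PiM B) (\<lambda>x. \<lambda>b\<in>B. a b + c * x b))"
    using assms by (subst lborel_PiM_affine[OF assms(1,2), of a]) (subst integral_density, auto)
  also have "\<dots> = (\<integral>x. (c ^ card B) *\<^sub>R f (\<lambda>b\<in>B. a b + c * x b) \<partial>lborel_PiM B)"
    using assms meas by (subst integral_distr) auto
  finally show ?thesis by (simp add: scaleR_conv_of_real)
qed

lemma emeasure_lborel_PiM_box:
  assumes "finite B" "R \<ge> 0"
  shows "emeasure (lborel_PiM B) (Pi\<^sub>E B (\<lambda>_. {-R..R})) = ennreal ((2 * R) ^ card B)"
  using assms by (subst lborel_prod.emeasure_PiM) (simp_all add: ennreal_power)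

text \<open>Domination by \<open>C\<close> times the indicator of a cube gives integrability and,
  through the volume of the cube, the explicit bound behind the remainder estimates and the
  continuity of the integral functionals.\<close>

lemma integrable_lborel_PiM:
  fixes f :: "('b \<Rightarrow> real) \<Rightarrow> complex"
  assumes "finite B" "R \<ge> 0" "f \<in> borel_measurable (lborel_PiM B)"
    and "\<And>t. t \<in> extensional B \<Longrightarrow> norm (f t) \<le> C"
    and "\<And>t b. t \<in> extensional B \<Longrightarrow> f t \<noteq> 0 \<Longrightarrow> b \<in> B \<Longrightarrow> \<bar>t b\<bar> \<le> R"
  shows "integrable (lborel_PiM B) f"
    and "norm (integral\<^sup>L (lborel_PiM B) f) \<le> C * (2 * R) ^ card B"
proof -
  let ?box = "Pi\<^sub>E B (\<lambda>_. {-R..R})"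
  have box: "?box \<in> sets (lborel_PiM B)" using assms(1) by (intro sets_PiM_I_finite) auto
  have int: "integrable (lborel_PiM B) (\<lambda>t. C * indicator ?box t)"
    using box emeasure_lborel_PiM_box[OF assms(1,2)] by (intro integrable_mult_right integrable_real_indicator) auto
  have le: "norm (f t) \<le> C * indicator ?box t" if "t \<in> space (lborel_PiM B)" for t
  proof (cases "f t = 0")
    case True
    have "0 \<le> C" using order_trans[OF norm_ge_zero assms(4)] that by (auto simp: space_PiM PiE_def)
    then show ?thesis using True by (simp add: indicator_def)
  next
    case False
    then have "t \<in> ?box" using assms(5)[of t] that by (force simp: space_PiM PiE_iff abs_le_iff)
    then show ?thesis using assms(4)[of t] that by (simp add: space_PiM PiE_def)
  qed
  show "integrable (lborel_PiM B) f"
    using int assms(3) by (rule Bochner_Integration.integrable_bound)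
      (use le in \<open>auto intro!: AE_I2 order_trans[OF le abs_ge_self]\<close>)
  have "norm (integral\<^sup>L (lborel_PiM B) f) \<le> (\<integral>t. C * indicator ?box t \<partial>lborel_PiM B)"
    using int le \<open>integrable (lborel_PiM B) f\<close>
    by (intro order_trans[OF integral_norm_bound] integral_mono) auto
  also have "\<dots> = C * (2 * R) ^ card B"
    using box emeasure_lborel_PiM_box[OF assms(1,2)] assms(2) by (simp add: measure_def)
  finally show "norm (integral\<^sup>L (lborel_PiM B) f) \<le> C * (2 * R) ^ card B" .
qed

definition unit_cube :: "'b set \<Rightarrow> ('b \<Rightarrow> real) set" where
  "unit_cube B = Pi\<^sub>E B (\<lambda>_. {0..<1})"

lemma integral_unit_cube:
  assumes "finite B"
  shows "(\<integral>s. indicator (unit_cube B) s \<partial>lborel_PiM B) = (1::complex)"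
proof -
  have "emeasure (lborel_PiM B) (unit_cube B) = 1"
    using assms by (simp add: unit_cube_def lborel_prod.emeasure_PiM)
  moreover have "unit_cube B \<in> sets (lborel_PiM B)"
    using assms by (auto simp: unit_cube_def intro!: sets_PiM_I_finite)
  moreover have "indicator (unit_cube B) = (\<lambda>s. complex_of_real (indicat_real (unit_cube B) s))"
    by (auto simp: indicator_def)
  ultimately show ?thesis by (simp add: measure_def)
qed

text \<open>In every cell of side \<open>h\<close> the rescaled fractional parts run once through
  the unit cube, in the same way for all cells. Hence the two factors of the integrand
  decouple.\<close>

lemma integral_floor_frac:
  fixes G :: "('b \<Rightarrow> int) \<Rightarrow> complex" and H :: "('b \<Rightarrow> real) \<Rightarrow> complex"
  assumes "finite B" "h > 0" "finite S" "S \<subseteq> Pi\<^sub>E B (\<lambda>_. UNIV)"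
    and G: "\<And>\<nu>. \<nu> \<in> Pi\<^sub>E B (\<lambda>_. UNIV) - S \<Longrightarrow> G \<nu> = 0"
    and H: "H \<in> borel_measurable (lborel_PiM B)" "\<And>s. s \<in> unit_cube B \<Longrightarrow> norm (H s) \<le> C"
  shows "(\<integral>t. G (\<lambda>b\<in>B. \<lfloor>t b / h\<rfloor>) * H (\<lambda>b\<in>B. frac (t b / h)) \<partial>lborel_PiM B) =
    of_real (h ^ card B) * sum G S * (\<integral>s. indicator (unit_cube B) s * H s \<partial>lborel_PiM B)"
proof -
  \<comment> \<open>\<open>K \<nu>\<close> is the factor \<open>H\<close> cut off to the cell with
    index \<open>\<nu>\<close>. The integrand is a finite combination of these pieces, and they all
    have the same integral.\<close>
  define K where "K = (\<lambda>\<nu> t. of_bool (\<forall>b\<in>B. \<lfloor>t b / h\<rfloor> = \<nu> b) * H (\<lambda>b\<in>B. frac (t b / h)))"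
  have cube: "(\<lambda>b\<in>B. frac (t b / h)) \<in> unit_cube B" for t :: "'b \<Rightarrow> real"
    by (auto simp: unit_cube_def frac_lt_1)
  have frac_meas: "(\<lambda>t. \<lambda>b\<in>B. frac (t b / h)) \<in> measurable (lborel_PiM B) (lborel_PiM B)"
    by (rule measurable_restrict) (auto simp: frac_def)
  have K_meas: "K \<nu> \<in> borel_measurable (lborel_PiM B)" for \<nu>
  proof -
    have "(\<lambda>t. \<forall>b\<in>B. \<lfloor>t b / h\<rfloor> = \<nu> b) \<in> measurable (lborel_PiM B) (count_space UNIV)"
      using assms(1) by (intro pred_intros_finite) auto
    then show ?thesis
      unfolding K_def using measurable_compose[OF frac_meas H(1)] by (auto simp: of_bool_def)
  qed
  have K_int: "integrable (lborel_PiM B) (K \<nu>)" for \<nu>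
  proof (rule integrable_lborel_PiM)
    let ?R = "\<Sum>b\<in>B. h * (\<bar>real_of_int (\<nu> b)\<bar> + 1)"
    show "?R \<ge> 0" using assms(2) by (intro sum_nonneg) auto
    show "norm (K \<nu> t) \<le> max C 0" for t
      using H(2)[OF cube, of t] by (auto simp: K_def)
    show "\<bar>t b\<bar> \<le> ?R" if "K \<nu> t \<noteq> 0" "b \<in> B" for t b
    proof -
      have "\<lfloor>t b / h\<rfloor> = \<nu> b" using that by (auto simp: K_def)
      then have "\<bar>t b / h\<bar> \<le> \<bar>real_of_int (\<nu> b)\<bar> + 1" by linarith
      then have "\<bar>t b\<bar> \<le> h * (\<bar>real_of_int (\<nu> b)\<bar> + 1)"
        using assms(2) by (simp add: abs_divide pos_divide_le_eq mult.commute)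
      also have "\<dots> \<le> ?R" using assms(1,2) that by (intro member_le_sum) auto
      finally show ?thesis .
    qed
  qed (use assms(1) K_meas in auto)
  have K_val: "integral\<^sup>L (lborel_PiM B) (K \<nu>) =
      of_real (h ^ card B) * (\<integral>s. indicator (unit_cube B) s * H s \<partial>lborel_PiM B)" for \<nu>
  proof -
    have "integral\<^sup>L (lborel_PiM B) (K \<nu>) = of_real (h ^ card B) *
        (\<integral>x. K \<nu> (\<lambda>b\<in>B. h * \<nu> b + h * x b) \<partial>lborel_PiM B)"
      by (rule integral_lborel_PiM_affine[OF assms(1,2) K_meas])
    also have "(\<integral>x. K \<nu> (\<lambda>b\<in>B. h * \<nu> b + h * x b) \<partial>lborel_PiM B) =
        (\<integral>s. indicator (unit_cube B) s * H s \<partial>lborel_PiM B)"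
    proof (rule Bochner_Integration.integral_cong[OF refl])
      fix x assume "x \<in> space (lborel_PiM B)"
      then have x: "x \<in> extensional B" by (auto simp: space_PiM PiE_def)
      have eq: "(h * \<nu> b + h * x b) / h = of_int (\<nu> b) + x b" for b
        using assms(2) by (simp add: add_divide_distrib)
      have fl: "\<lfloor>of_int (\<nu> b) + x b\<rfloor> = \<nu> b \<longleftrightarrow> x b \<in> {0..<1}" for b
        by (simp add: floor_eq_iff)
      show "K \<nu> (\<lambda>b\<in>B. h * \<nu> b + h * x b) = indicator (unit_cube B) x * H x"
      proof (cases "x \<in> unit_cube B")
        case True
        then have "\<And>b. b \<in> B \<Longrightarrow> x b \<in> {0..<1}" by (auto simp: unit_cube_def)
        moreover from this have "(\<lambda>b\<in>B. frac (of_int (\<nu> b) + x b)) = x"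
          using x by (intro extensionalityI[of _ B]) (auto simp: frac_def floor_eq_iff)
        ultimately show ?thesis
          using True unfolding K_def by (simp add: eq fl floor_eq_iff cong: restrict_cong)
      next
        case False
        then obtain b where "b \<in> B" "x b \<notin> {0..<1}"
          using x by (auto simp: unit_cube_def PiE_def Pi_def)
        then show ?thesis
          using False fl[of b] unfolding K_def by (auto simp: eq)
      qed
    qed
    finally show ?thesis .
  qed
  have "(\<integral>t. G (\<lambda>b\<in>B. \<lfloor>t b / h\<rfloor>) * H (\<lambda>b\<in>B. frac (t b / h)) \<partial>lborel_PiM B) =
      (\<integral>t. (\<Sum>\<nu>\<in>S. G \<nu> * K \<nu> t) \<partial>lborel_PiM B)"
  proof (rule Bochner_Integration.integral_cong[OF refl])
    fix t :: "'b \<Rightarrow> real"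
    define \<nu> where "\<nu> = (\<lambda>b\<in>B. \<lfloor>t b / h\<rfloor>)"
    have \<nu>: "\<nu> \<in> Pi\<^sub>E B (\<lambda>_. UNIV)" by (auto simp: \<nu>_def)
    have "(\<Sum>\<mu>\<in>S. G \<mu> * K \<mu> t) = (\<Sum>\<mu>\<in>S. if \<mu> = \<nu> then G \<nu> * H (\<lambda>b\<in>B. frac (t b / h)) else 0)"
    proof (rule sum.cong[OF refl])
      fix \<mu> assume "\<mu> \<in> S"
      then have "(\<forall>b\<in>B. \<lfloor>t b / h\<rfloor> = \<mu> b) \<longleftrightarrow> \<mu> = \<nu>"
        using assms(4) by (auto simp: \<nu>_def fun_eq_iff PiE_def extensional_def subset_iff)
      then show "G \<mu> * K \<mu> t = (if \<mu> = \<nu> then G \<nu> * H (\<lambda>b\<in>B. frac (t b / h)) else 0)"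
        by (auto simp: K_def)
    qed
    also have "\<dots> = G \<nu> * H (\<lambda>b\<in>B. frac (t b / h))"
      using assms(3) G[of \<nu>] \<nu> by (simp add: sum.delta)
    finally show "G (\<lambda>b\<in>B. \<lfloor>t b / h\<rfloor>) * H (\<lambda>b\<in>B. frac (t b / h)) = (\<Sum>\<nu>\<in>S. G \<nu> * K \<nu> t)"
      by (simp add: \<nu>_def)
  qed
  also have "\<dots> = (\<Sum>\<nu>\<in>S. G \<nu> * integral\<^sup>L (lborel_PiM B) (K \<nu>))"
    using K_int by simp
  finally show ?thesis
    by (simp add: K_val sum_distrib_right[symmetric] mult_ac)
qed

section \<open>Affine coordinates\<close>

definition affine_map :: "'b set \<Rightarrow> 'a::real_vector \<Rightarrow> ('b \<Rightarrow> 'a) \<Rightarrow> ('b \<Rightarrow> real) \<Rightarrow> 'a" where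
  "affine_map B \<alpha> v t = \<alpha> + (\<Sum>b\<in>B. t b *\<^sub>R v b)"

text \<open>A family and not a set: the same index set \<open>B\<close> later carries several
  systems of directions, such as multiples of \<open>v\<close> and the columns of a change of
  coordinates.\<close>

definition independent_family :: "'b set \<Rightarrow> ('b \<Rightarrow> 'a::real_vector) \<Rightarrow> bool" where
  "independent_family B v \<longleftrightarrow> (\<forall>t. (\<Sum>b\<in>B. t b *\<^sub>R v b) = 0 \<longrightarrow> (\<forall>b\<in>B. t b = 0))"

text \<open>Independence provides linear functionals dual to the family, and linear functionals on a
  finite-dimensional space are bounded.\<close>

lemma independent_family_bound:
  fixes v :: "'b \<Rightarrow> 'a::euclidean_space"
  assumes "finite B" "independent_family B v"
  obtains K where "K \<ge> 0" "\<And>t b. b \<in> B \<Longrightarrow> \<bar>t b\<bar> \<le> K * norm (\<Sum>b\<in>B. t b *\<^sub>R v b)"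
proof -
  have inj: "inj_on v B"
  proof (rule inj_onI, rule ccontr)
    fix b c assume bc: "b \<in> B" "c \<in> B" "v b = v c" "b \<noteq> c"
    have "(\<Sum>x\<in>B. (if x = b then 1 else if x = c then -1 else 0) *\<^sub>R v x) =
        (\<Sum>x\<in>B. (if x = b then v b else 0) - (if x = c then v c else 0))"
      using bc by (intro sum.cong) auto
    also have "\<dots> = 0" using assms(1) bc by (simp add: sum_subtractf)
    finally show False
      using assms(2)[unfolded independent_family_def, rule_format, of _ b] bc(1) by fastforce
  qed
  have indep: "independent (v ` B)"
  proof
    assume "dependent (v ` B)"
    then obtain u where u: "\<exists>w\<in>v ` B. u w \<noteq> 0" "(\<Sum>w\<in>v ` B. u w *\<^sub>R w) = 0"
      using assms(1) by (auto simp: dependent_finite)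
    then have "(\<Sum>b\<in>B. u (v b) *\<^sub>R v b) = 0" by (simp add: sum.reindex[OF inj])
    then have "\<forall>b\<in>B. u (v b) = 0"
      using assms(2)[unfolded independent_family_def, rule_format, of "\<lambda>b. u (v b)"] by blast
    then show False using u(1) by auto
  qed
  have "\<exists>g. linear g \<and> (\<forall>w\<in>v ` B. g w = (of_bool (w = v b) :: real))" for b
    by (rule linear_independent_extend[OF indep])
  then obtain g where g: "\<And>b. linear (g b)" "\<And>b w. w \<in> v ` B \<Longrightarrow> g b w = (of_bool (w = v b) :: real)"
    by metis
  have bd: "\<exists>K. \<forall>x. norm (g b x) \<le> norm x * K" for b
    using g(1) bounded_linear.bounded linear_conv_bounded_linear by blast
  then obtain K where K: "\<And>b x. norm (g b x) \<le> norm x * K b" by metis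
  define L where "L = (\<Sum>b\<in>B. \<bar>K b\<bar>)"
  show ?thesis
  proof (rule that)
    show "L \<ge> 0" by (simp add: L_def sum_nonneg)
    fix t b assume b: "b \<in> B"
    have "g b (\<Sum>c\<in>B. t c *\<^sub>R v c) = (\<Sum>c\<in>B. t c * g b (v c))"
      using g(1) by (simp add: linear_sum linear_cmul)
    also have "\<dots> = (\<Sum>c\<in>B. if c = b then t b else 0)"
      using g(2)[of _ b] inj b by (intro sum.cong) (auto simp: inj_on_def)
    also have "\<dots> = t b" using assms(1) b by simp
    finally have "\<bar>t b\<bar> \<le> norm (\<Sum>c\<in>B. t c *\<^sub>R v c) * K b"
      using K[of b "\<Sum>c\<in>B. t c *\<^sub>R v c"] by simp
    also have "\<dots> \<le> norm (\<Sum>c\<in>B. t c *\<^sub>R v c) * \<bar>K b\<bar>" by (intro mult_left_mono) auto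
    also have "\<dots> \<le> norm (\<Sum>c\<in>B. t c *\<^sub>R v c) * L"
      unfolding L_def using assms(1) b by (intro mult_left_mono member_le_sum) auto
    finally show "\<bar>t b\<bar> \<le> L * norm (\<Sum>b\<in>B. t b *\<^sub>R v b)" by (simp add: mult.commute)
  qed
qed

text \<open>It confines the parameters of points in a compact support to a cube, which makes the
  lattice sums finite and bounds the integrals.\<close>

lemma affine_map_bounded:
  fixes v :: "'b \<Rightarrow> 'a::euclidean_space"
  assumes "finite B" "independent_family B v" "bounded K"
  obtains R where "R \<ge> 0" "\<And>t b. affine_map B \<alpha> v t \<in> K \<Longrightarrow> b \<in> B \<Longrightarrow> \<bar>t b\<bar> \<le> R"
proof -
  obtain L where L: "L \<ge> 0" "\<And>t b. b \<in> B \<Longrightarrow> \<bar>t b\<bar> \<le> L * norm (\<Sum>b\<in>B. t b *\<^sub>R v b)"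
    using independent_family_bound[OF assms(1,2)] by blast
  obtain M where M: "\<And>x. x \<in> K \<Longrightarrow> norm x \<le> M" "M \<ge> 0"
    using assms(3) by (meson bounded_pos less_imp_le)
  show ?thesis
  proof (rule that[of "L * (M + norm \<alpha>)"])
    fix t b assume *: "affine_map B \<alpha> v t \<in> K" "b \<in> B"
    have "norm (\<Sum>b\<in>B. t b *\<^sub>R v b) = norm (affine_map B \<alpha> v t - \<alpha>)" by (simp add: affine_map_def)
    also have "\<dots> \<le> M + norm \<alpha>" using M(1)[OF *(1)] norm_triangle_ineq4[of "affine_map B \<alpha> v t" \<alpha>] by linarith
    finally show "\<bar>t b\<bar> \<le> L * (M + norm \<alpha>)"
      using L(2)[OF *(2), of t] L(1) by (meson mult_left_mono order_trans)
  qed (use L M in auto)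
qed

lemma affine_map_measurable:
  fixes v :: "'b \<Rightarrow> 'a::euclidean_space"
  shows "affine_map B \<alpha> v \<in> borel_measurable (lborel_PiM B)"
  unfolding affine_map_def by measurable

lemma integrable_test_function:
  fixes v :: "'b \<Rightarrow> 'a::euclidean_space"
  assumes B: "finite B" "independent_family B v" and \<phi>: "test_function \<phi>"
    and R: "R \<in> measurable (lborel_PiM B) (count_space UNIV)"
  shows "integrable (lborel_PiM B) (\<lambda>t. of_bool (R t) * \<phi> (affine_map B \<alpha> v t))"
proof -
  obtain K where K: "compact K" "{x. \<phi> x \<noteq> 0} \<subseteq> K" and sm: "smooth \<phi>"
    using \<phi> unfolding test_function_altdef by auto
  obtain r where r: "r \<ge> 0" "\<And>t b. affine_map B \<alpha> v t \<in> K \<Longrightarrow> b \<in> B \<Longrightarrow> \<bar>t b\<bar> \<le> r"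
    using affine_map_bounded[OF B compact_imp_bounded[OF K(1)]] by metis
  obtain C where C: "\<And>x. norm (\<phi> x) \<le> C" "C \<ge> 0" using test_function_bounded[OF \<phi>] by blast
  show ?thesis
  proof (rule integrable_lborel_PiM[OF B(1) r(1), of _ C])
    have "(\<lambda>t. \<phi> (affine_map B \<alpha> v t)) \<in> borel_measurable (lborel_PiM B)"
      using affine_map_measurable borel_measurable_continuous_onI[OF smooth_continuous[OF sm]]
      by (rule measurable_compose)
    then show "(\<lambda>t. of_bool (R t) * \<phi> (affine_map B \<alpha> v t)) \<in> borel_measurable (lborel_PiM B)"
      using R by (intro borel_measurable_times) (auto simp: of_bool_def)
    show "norm (of_bool (R t) * \<phi> (affine_map B \<alpha> v t)) \<le> C" for t
      using C by (auto simp: norm_mult)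
    show "\<bar>t b\<bar> \<le> r" if "of_bool (R t) * \<phi> (affine_map B \<alpha> v t) \<noteq> 0" "b \<in> B" for t b
      using that K(2) by (intro r(2)) auto
  qed
qed

section \<open>Lattice sums over orthants\<close>

text \<open>Words play the role of multi-indices. Summing over all words of length \<open>l\<close>
  with the factor \<open>1 / fact l\<close> gives Taylor's formula directly from repeated
  differentiation along a segment, with no appeal to the symmetry of mixed derivatives.\<close>

definition words :: "'b set \<Rightarrow> nat \<Rightarrow> 'b list set" where
  "words B l = {ws. set ws \<subseteq> B \<and> length ws = l}"

lemma finite_words: "finite B \<Longrightarrow> finite (words B l)"
  unfolding words_def by (rule finite_lists_length_eq)

lemma words_0: "words B 0 = {[]}"
  by (auto simp: words_def)

lemma sum_words_Suc:
  assumes "finite B"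
  shows "(\<Sum>ws\<in>words B (Suc l). f ws) = (\<Sum>b\<in>B. \<Sum>ws\<in>words B l. f (b # ws))"
proof -
  have "words B (Suc l) = (\<lambda>(b, ws). b # ws) ` (B \<times> words B l)"
    by (auto simp: words_def image_iff length_Suc_conv)
  moreover have "inj_on (\<lambda>(b, ws). b # ws) (B \<times> words B l)"
    by (auto simp: inj_on_def)
  ultimately have "(\<Sum>ws\<in>words B (Suc l). f ws) = (\<Sum>p\<in>B \<times> words B l. f (fst p # snd p))"
    by (simp add: sum.reindex case_prod_unfold)
  then show ?thesis
    by (simp add: sum.cartesian_product case_prod_unfold)
qed

text \<open>Lagrange's remainder concerns real functions. It is applied to the real and the
  imaginary part, with two unrelated intermediate points, hence the factor 2.\<close>

lemma Taylor_complex: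
  fixes g :: "nat \<Rightarrow> real \<Rightarrow> complex"
  assumes "\<And>m t. (g m has_vector_derivative g (Suc m) t) (at t)" and "\<And>t. norm (g N t) \<le> M"
  shows "norm (g 0 1 - (\<Sum>m<N. g m 0 / fact m)) \<le> 2 * M"
proof -
  have Re: "DERIV (\<lambda>t. Re (g m t)) t :> Re (g (Suc m) t)"
    and Im: "DERIV (\<lambda>t. Im (g m t)) t :> Im (g (Suc m) t)" for m t
    using assms(1)[of m t]
    by (auto simp: has_real_derivative_iff_has_vector_derivative
        intro: bounded_linear.has_vector_derivative[OF bounded_linear_Re]
          bounded_linear.has_vector_derivative[OF bounded_linear_Im])
  obtain s where s: "Re (g 0 1) = (\<Sum>m<N. Re (g m 0) / fact m * 1 ^ m) + Re (g N s) / fact N * 1 ^ N"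
    using Maclaurin_all_le[of "\<lambda>m t. Re (g m t)" "\<lambda>t. Re (g 0 t)" 1 N] Re by auto
  obtain t where t: "Im (g 0 1) = (\<Sum>m<N. Im (g m 0) / fact m * 1 ^ m) + Im (g N t) / fact N * 1 ^ N"
    using Maclaurin_all_le[of "\<lambda>m t. Im (g m t)" "\<lambda>t. Im (g 0 t)" 1 N] Im by auto
  have Refact: "Re (z / fact m) = Re z / fact m" and Imfact: "Im (z / fact m) = Im z / fact m" for z m
    by (metis Re_divide_of_real of_real_fact, metis Im_divide_of_real of_real_fact)
  let ?z = "g 0 1 - (\<Sum>m<N. g m 0 / fact m)"
  have "\<bar>Re (g N s)\<bar> / fact N \<le> M" "\<bar>Im (g N t)\<bar> / fact N \<le> M"
  proof -
    have le: "x / fact N \<le> M" if "x \<ge> 0" "x \<le> M" for x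
      using that mult_right_mono[of 1 "fact N" M]
      by (simp add: pos_divide_le_eq) (smt (verit) fact_ge_1 mult_less_cancel_left2)
    show "\<bar>Re (g N s)\<bar> / fact N \<le> M"
      by (rule le) (use abs_Re_le_cmod[of "g N s"] assms(2)[of s] in auto)
    show "\<bar>Im (g N t)\<bar> / fact N \<le> M"
      by (rule le) (use abs_Im_le_cmod[of "g N t"] assms(2)[of t] in auto)
  qed
  moreover have "Re ?z = Re (g N s) / fact N" "Im ?z = Im (g N t) / fact N"
    using s t by (simp_all add: Refact Imfact)
  ultimately have "\<bar>Re ?z\<bar> \<le> M" "\<bar>Im ?z\<bar> \<le> M" by (simp_all add: abs_divide)
  then show ?thesis using cmod_le[of ?z] by linarith
qed

definition word_deriv :: "('b \<Rightarrow> 'a) \<Rightarrow> 'b list \<Rightarrow> ('a::euclidean_space \<Rightarrow> complex) \<Rightarrow> 'a \<Rightarrow> complex" where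
  "word_deriv v ws \<phi> = iterated_deriv (map v ws) \<phi>"

lemma test_function_word_deriv: "test_function \<phi> \<Longrightarrow> test_function (word_deriv v ws \<phi>)"
  unfolding word_deriv_def by (rule test_function_iterated_deriv)

text \<open>Along the segment from \<open>x\<close>, each differentiation prepends one letter and
  one factor \<open>\<delta> b\<close>; so the sum over words of length \<open>l\<close> is the
  derivative of order \<open>l\<close> in the segment parameter.\<close>

lemma Taylor_words:
  fixes v :: "'b \<Rightarrow> 'a::euclidean_space"
  assumes "finite B" "test_function \<phi>" and M: "\<And>ws y. ws \<in> words B N \<Longrightarrow> norm (word_deriv v ws \<phi> y) \<le> M"
    and e: "\<And>b. b \<in> B \<Longrightarrow> \<bar>\<delta> b\<bar> \<le> e"
  shows "norm (\<phi> (x + (\<Sum>b\<in>B. \<delta> b *\<^sub>R v b)) -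
      (\<Sum>l<N. (\<Sum>ws\<in>words B l. of_real (\<Prod>b\<leftarrow>ws. \<delta> b) * word_deriv v ws \<phi> x) / fact l))
    \<le> 2 * (real (card (words B N)) * (e ^ N * M))"
proof -
  define y where "y = (\<Sum>b\<in>B. \<delta> b *\<^sub>R v b)"
  define g where "g = (\<lambda>l t. \<Sum>ws\<in>words B l. of_real (\<Prod>b\<leftarrow>ws. \<delta> b) * word_deriv v ws \<phi> (x + t *\<^sub>R y))"
  have "norm (g 0 1 - (\<Sum>m<N. g m 0 / fact m)) \<le> 2 * (real (card (words B N)) * (e ^ N * M))"
  proof (rule Taylor_complex)
    show "(g l has_vector_derivative g (Suc l) t) (at t)" for l t
    proof -
      have D: "((\<lambda>t. word_deriv v ws \<phi> (x + t *\<^sub>R y)) has_vector_derivative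
          (\<Sum>b\<in>B. of_real (\<delta> b) * word_deriv v (b # ws) \<phi> (x + t *\<^sub>R y))) (at t)" for ws
      proof -
        let ?f = "word_deriv v ws \<phi>"
        let ?D = "frechet_derivative ?f (at (x + t *\<^sub>R y))"
        have "?f differentiable (at (x + t *\<^sub>R y))"
          using test_function_word_deriv[OF assms(2)] smooth_differentiable by (auto simp: test_function_def)
        then have F: "(?f has_derivative ?D) (at (x + t *\<^sub>R y))"
          by (rule has_frechet_derivative)
        have "((\<lambda>t. x + t *\<^sub>R y) has_vector_derivative y) (at t)"
          by (auto intro!: derivative_eq_intros)
        then have "(?f \<circ> (\<lambda>t. x + t *\<^sub>R y) has_vector_derivative ?D y) (at t)"
          by (rule vector_derivative_diff_chain_within) (rule has_derivative_at_withinI[OF F])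
        moreover have "?D y = (\<Sum>b\<in>B. of_real (\<delta> b) * ?D (v b))"
          using has_derivative_linear[OF F] by (simp add: y_def linear_sum linear_cmul scaleR_conv_of_real)
        ultimately show ?thesis by (simp add: word_deriv_def o_def)
      qed
      have "(g l has_vector_derivative (\<Sum>ws\<in>words B l. of_real (\<Prod>b\<leftarrow>ws. \<delta> b) *
          (\<Sum>b\<in>B. of_real (\<delta> b) * word_deriv v (b # ws) \<phi> (x + t *\<^sub>R y)))) (at t)"
        unfolding g_def by (intro has_vector_derivative_sum has_vector_derivative_mult_right D)
      also have "(\<Sum>ws\<in>words B l. of_real (\<Prod>b\<leftarrow>ws. \<delta> b) *
          (\<Sum>b\<in>B. of_real (\<delta> b) * word_deriv v (b # ws) \<phi> (x + t *\<^sub>R y))) = g (Suc l) t"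
        unfolding g_def sum_words_Suc[OF assms(1)] sum_distrib_left
        by (subst sum.swap) (simp add: mult_ac)
      finally show ?thesis .
    qed
    show "norm (g N t) \<le> real (card (words B N)) * (e ^ N * M)" for t
    proof -
      have "norm (g N t) \<le> (\<Sum>ws\<in>words B N. norm (of_real (\<Prod>b\<leftarrow>ws. \<delta> b) * word_deriv v ws \<phi> (x + t *\<^sub>R y)))"
        unfolding g_def by (rule norm_sum)
      also have "\<dots> \<le> (\<Sum>ws\<in>words B N. e ^ N * M)"
      proof (intro sum_mono)
        fix ws assume ws: "ws \<in> words B N"
        have "\<bar>\<Prod>b\<leftarrow>ws. \<delta> b\<bar> \<le> e ^ length ws" if "set ws \<subseteq> B" for ws
          using that
        proof (induction ws)
          case (Cons b ws)
          have "0 \<le> e" using e[of b] Cons.prems by force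
          then show ?case using Cons e[of b] by (auto simp: abs_mult intro!: mult_mono)
        qed simp
        then have "\<bar>\<Prod>b\<leftarrow>ws. \<delta> b\<bar> \<le> e ^ N" using ws by (auto simp: words_def)
        then show "norm (of_real (\<Prod>b\<leftarrow>ws. \<delta> b) * word_deriv v ws \<phi> (x + t *\<^sub>R y)) \<le> e ^ N * M"
          using M[OF ws] by (auto simp: norm_mult intro!: mult_mono elim: order_trans[OF abs_ge_zero])
      qed
      finally show ?thesis by simp
    qed
  qed
  then show ?thesis by (simp add: g_def y_def words_0 word_deriv_def)
qed

text \<open>The cell with index \<open>\<nu>\<close> is sampled at the point with relative position
  \<open>\<rho>\<close>, position 0 being a corner. The sample point lies in the closed cell, hence
  within \<open>1 / k\<close> of each of its points in every coordinate. Coordinates outside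
  \<open>J\<close> run over the whole line, so \<open>J = {}\<close> covers the full
  lattice.\<close>

locale orthant_sum =
  fixes B J :: "'b set" and \<alpha> :: "'a::euclidean_space" and v :: "'b \<Rightarrow> 'a" and \<rho> :: "'b \<Rightarrow> real"
  assumes finite_B: "finite B" and J: "J \<subseteq> B" and indep: "independent_family B v"
    and \<rho>: "\<And>b. b \<in> B \<Longrightarrow> \<rho> b \<in> {0..1}"
begin

definition orthant_integral :: "('a \<Rightarrow> complex) \<Rightarrow> complex" where
  "orthant_integral \<phi> = (\<integral>t. of_bool (\<forall>j\<in>J. t j \<ge> 0) * \<phi> (affine_map B \<alpha> v t) \<partial>lborel_PiM B)"

definition node :: "nat \<Rightarrow> ('b \<Rightarrow> int) \<Rightarrow> 'a" where
  "node k \<nu> = affine_map B \<alpha> v (\<lambda>b. (of_int (\<nu> b) + \<rho> b) / real k)"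

text \<open>The normalization makes this a Riemann sum for \<open>orthant_integral\<close>.\<close>

definition lattice_mean :: "nat \<Rightarrow> ('a \<Rightarrow> complex) \<Rightarrow> complex" where
  "lattice_mean k \<phi> =
    (\<Sum>\<^sub>\<infinity>\<nu> \<in> {\<nu> \<in> Pi\<^sub>E B (\<lambda>_. UNIV). \<forall>j\<in>J. \<nu> j \<ge> 0}. \<phi> (node k \<nu>)) / of_nat k ^ card B"

text \<open>Moments of the position relative to the sample point: integrating Taylor's formula over
  a rescaled cell produces these coefficients.\<close>

definition word_coeff :: "'b list \<Rightarrow> complex" where
  "word_coeff ws = (\<integral>s. indicator (unit_cube B) s * of_real (\<Prod>b\<leftarrow>ws. s b - \<rho> b) \<partial>lborel_PiM B) / fact (length ws)"

text \<open>All derivatives of a test function live in one compact set, so one \<open>R\<close>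
  serves every word.\<close>

lemma support_box:
  assumes "test_function \<phi>"
  obtains R where "R \<ge> 0" "\<And>ws t b. word_deriv v ws \<phi> (affine_map B \<alpha> v t) \<noteq> 0 \<Longrightarrow> b \<in> B \<Longrightarrow> \<bar>t b\<bar> \<le> R"
proof -
  obtain K where K: "compact K" "{x. \<phi> x \<noteq> 0} \<subseteq> K"
    using assms unfolding test_function_altdef by auto
  obtain R where "R \<ge> 0" "\<And>t b. affine_map B \<alpha> v t \<in> K \<Longrightarrow> b \<in> B \<Longrightarrow> \<bar>t b\<bar> \<le> R"
    using affine_map_bounded[OF finite_B indep compact_imp_bounded[OF K(1)]] by metis
  moreover have "{x. word_deriv v ws \<phi> x \<noteq> 0} \<subseteq> K" for ws
    unfolding word_deriv_def by (rule iterated_deriv_support[OF compact_imp_closed[OF K(1)] K(2)])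
  ultimately show ?thesis using that by blast
qed

lemma test_function_measurable:
  assumes "test_function \<phi>" "f \<in> borel_measurable M"
  shows "(\<lambda>t. \<phi> (f t)) \<in> borel_measurable M"
  using assms smooth_continuous[of \<phi> UNIV]
  by (auto simp: test_function_def intro: measurable_compose borel_measurable_continuous_onI)

lemma finite_nodes:
  assumes "test_function \<phi>" "k > 0"
  shows "finite {\<nu> \<in> Pi\<^sub>E B (\<lambda>_. UNIV). \<phi> (node k \<nu>) \<noteq> 0}"
proof -
  obtain R where R: "R \<ge> 0" "\<And>ws t b. word_deriv v ws \<phi> (affine_map B \<alpha> v t) \<noteq> 0 \<Longrightarrow> b \<in> B \<Longrightarrow> \<bar>t b\<bar> \<le> R"
    using support_box[OF assms(1)] by metis
  \<comment> \<open>The summand 1 absorbs the shift \<open>\<rho>\<close>.\<close>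
  define L where "L = \<lceil>R * k + 1\<rceil>"
  have "{\<nu> \<in> Pi\<^sub>E B (\<lambda>_. UNIV). \<phi> (node k \<nu>) \<noteq> 0} \<subseteq> Pi\<^sub>E B (\<lambda>_. {-L..L})"
  proof
    fix \<nu> assume "\<nu> \<in> {\<nu> \<in> Pi\<^sub>E B (\<lambda>_. UNIV). \<phi> (node k \<nu>) \<noteq> 0}"
    then have \<nu>: "\<nu> \<in> extensional B" "word_deriv v [] \<phi> (node k \<nu>) \<noteq> 0"
      by (auto simp: PiE_def word_deriv_def)
    have "\<nu> b \<in> {-L..L}" if "b \<in> B" for b
    proof -
      have "\<bar>(of_int (\<nu> b) + \<rho> b) / real k\<bar> \<le> R"
        using R(2)[OF \<nu>(2)[unfolded node_def] that] .
      then have "\<bar>of_int (\<nu> b) + \<rho> b\<bar> \<le> R * k"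
        using assms(2) by (simp add: abs_divide pos_divide_le_eq)
      then have "\<bar>real_of_int (\<nu> b)\<bar> \<le> R * k + 1" using \<rho>[OF that] by auto
      then have "real_of_int (\<nu> b) \<le> L" "- real_of_int (\<nu> b) \<le> L" unfolding L_def by linarith+
      then show ?thesis by auto
    qed
    then show "\<nu> \<in> Pi\<^sub>E B (\<lambda>_. {-L..L})" using \<nu>(1) by (auto simp: PiE_def)
  qed
  then show ?thesis
    by (rule finite_subset) (use finite_B in \<open>auto intro: finite_PiE\<close>)
qed

text \<open>\<open>integral_floor_frac\<close> with cells of side \<open>1 / k\<close>: sign
  conditions and sample point depend on the cell index alone, the product over the word on the
  fractional parts alone.\<close>

lemma lattice_mean_integral:
  assumes "test_function \<phi>" "k > 0" "ws \<in> words B l"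
  shows "(\<integral>t. (of_bool (\<forall>j\<in>J. \<lfloor>t j * real k\<rfloor> \<ge> 0) * \<phi> (node k (\<lambda>b\<in>B. \<lfloor>t b * real k\<rfloor>))) *
      of_real (\<Prod>b\<leftarrow>ws. frac (t b * real k) - \<rho> b) \<partial>lborel_PiM B) = lattice_mean k \<phi> * (fact l * word_coeff ws)"
proof -
  define G where "G = (\<lambda>\<nu>. of_bool (\<forall>j\<in>J. \<nu> j \<ge> 0) * \<phi> (node k \<nu>))"
  define H where "H = (\<lambda>s. complex_of_real (\<Prod>b\<leftarrow>ws. s b - \<rho> b))"
  define S where "S = {\<nu> \<in> Pi\<^sub>E B (\<lambda>_. UNIV). \<phi> (node k \<nu>) \<noteq> 0}"
  have ws: "set ws \<subseteq> B" "length ws = l" using assms(3) by (auto simp: words_def)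
  have fin: "finite S" unfolding S_def using finite_nodes[OF assms(1,2)] .
  have meas: "H \<in> borel_measurable (lborel_PiM B)"
  proof -
    have "(\<lambda>s. \<Prod>b\<leftarrow>us. s b - \<rho> b) \<in> borel_measurable (lborel_PiM B)" if "set us \<subseteq> B" for us
      using that by (induction us) auto
    then show ?thesis unfolding H_def using ws by auto
  qed
  have bd: "norm (H s) \<le> 1" if "s \<in> unit_cube B" for s
  proof -
    have "\<bar>\<Prod>b\<leftarrow>us. s b - \<rho> b\<bar> \<le> 1" if "set us \<subseteq> B" for us
      using that
    proof (induction us)
      case (Cons b us)
      have "s b \<in> {0..<1}" "\<rho> b \<in> {0..1}" using Cons.prems \<open>s \<in> unit_cube B\<close> \<rho>[of b] by (auto simp: unit_cube_def)
      then have "\<bar>s b - \<rho> b\<bar> \<le> 1" by auto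
      then show ?case using Cons by (auto simp: abs_mult intro!: mult_le_one)
    qed simp
    then show ?thesis using ws by (simp add: H_def)
  qed
  have "(\<integral>t. G (\<lambda>b\<in>B. \<lfloor>t b / (1 / real k)\<rfloor>) * H (\<lambda>b\<in>B. frac (t b / (1 / real k))) \<partial>lborel_PiM B) =
    of_real ((1 / real k) ^ card B) * sum G S * (\<integral>s. indicator (unit_cube B) s * H s \<partial>lborel_PiM B)"
    using assms(2) by (intro integral_floor_frac[OF finite_B _ fin _ _ meas bd]) (auto simp: S_def G_def)
  also have "sum G S = (\<Sum>\<^sub>\<infinity>\<nu> \<in> {\<nu> \<in> Pi\<^sub>E B (\<lambda>_. UNIV). \<forall>j\<in>J. \<nu> j \<ge> 0}. \<phi> (node k \<nu>))"
    unfolding infsum_finite[OF fin, symmetric]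
    by (intro infsum_cong_neutral) (auto simp: S_def G_def)
  also have "of_real ((1 / real k) ^ card B) * \<dots> = lattice_mean k \<phi>"
    by (simp add: lattice_mean_def power_one_over divide_inverse power_inverse mult.commute)
  also have "(\<integral>s. indicator (unit_cube B) s * H s \<partial>lborel_PiM B) = fact l * word_coeff ws"
    by (simp add: word_coeff_def H_def ws)
  also have "(\<lambda>t. G (\<lambda>b\<in>B. \<lfloor>t b / (1 / real k)\<rfloor>) * H (\<lambda>b\<in>B. frac (t b / (1 / real k)))) =
      (\<lambda>t. (of_bool (\<forall>j\<in>J. \<lfloor>t j * real k\<rfloor> \<ge> 0) * \<phi> (node k (\<lambda>b\<in>B. \<lfloor>t b * real k\<rfloor>))) *
      of_real (\<Prod>b\<leftarrow>ws. frac (t b * real k) - \<rho> b))"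
  proof
    fix t :: "'b \<Rightarrow> real"
    have "(\<Prod>b\<leftarrow>us. (\<lambda>b\<in>B. frac (t b * real k)) b - \<rho> b) = (\<Prod>b\<leftarrow>us. frac (t b * real k) - \<rho> b)"
      if "set us \<subseteq> B" for us
      using that by (induction us) auto
    then show "G (\<lambda>b\<in>B. \<lfloor>t b / (1 / real k)\<rfloor>) * H (\<lambda>b\<in>B. frac (t b / (1 / real k))) =
      (of_bool (\<forall>j\<in>J. \<lfloor>t j * real k\<rfloor> \<ge> 0) * \<phi> (node k (\<lambda>b\<in>B. \<lfloor>t b * real k\<rfloor>))) *
      of_real (\<Prod>b\<leftarrow>ws. frac (t b * real k) - \<rho> b)"
      using J ws(1) by (auto simp: G_def H_def)
  qed
  finally show ?thesis .
qed

lemma node_floor: "node k (\<lambda>b\<in>B. \<lfloor>t b * real k\<rfloor>) = \<alpha> + (\<Sum>b\<in>B. ((of_int \<lfloor>t b * real k\<rfloor> + \<rho> b) / k) *\<^sub>R v b)"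
  by (simp add: node_def affine_map_def cong: sum.cong)

lemma affine_map_node:
  assumes "k > 0"
  shows "affine_map B \<alpha> v t = node k (\<lambda>b\<in>B. \<lfloor>t b * real k\<rfloor>) + (\<Sum>b\<in>B. ((frac (t b * real k) - \<rho> b) / k) *\<^sub>R v b)"
proof -
  have "t b *\<^sub>R v b = ((of_int \<lfloor>t b * real k\<rfloor> + \<rho> b) / k) *\<^sub>R v b + ((frac (t b * real k) - \<rho> b) / k) *\<^sub>R v b" for b
    using assms by (simp add: scaleR_add_left[symmetric] frac_def add_divide_distrib[symmetric])
  then show ?thesis unfolding node_floor affine_map_def by (simp add: sum.distrib)
qed

lemma prod_frac_bound:
  assumes "set ws \<subseteq> B"
  shows "\<bar>\<Prod>b\<leftarrow>ws. frac (t b * real k) - \<rho> b\<bar> \<le> 1"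
  using assms
proof (induction ws)
  case (Cons b ws)
  have "0 \<le> \<rho> b" "\<rho> b \<le> 1" using Cons.prems \<rho>[of b] by auto
  then have "\<bar>frac (t b * real k) - \<rho> b\<bar> \<le> 1"
    using frac_lt_1[of "t b * real k"] frac_ge_0[of "t b * real k"] by linarith
  then show ?case using Cons by (auto simp: abs_mult intro!: mult_le_one)
qed simp

text \<open>In each coordinate a point differs from the sample point of its cell by at most
  \<open>1 / k\<close>, hence by at most 1.\<close>

lemma node_floor_support:
  assumes "k > 0" "word_deriv v ws \<phi> (node k (\<lambda>b\<in>B. \<lfloor>t b * real k\<rfloor>)) \<noteq> 0" "b \<in> B"
    and R: "\<forall>ws t. word_deriv v ws \<phi> (affine_map B \<alpha> v t) \<noteq> 0 \<longrightarrow> (\<forall>b\<in>B. \<bar>t b\<bar> \<le> R)"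
  shows "\<bar>t b\<bar> \<le> R + 1"
proof -
  have "\<bar>(of_int \<lfloor>t b * real k\<rfloor> + \<rho> b) / k\<bar> \<le> R"
    using R[rule_format, OF assms(2)[unfolded node_def] assms(3)] assms(3) by simp
  moreover have "t b = (of_int \<lfloor>t b * real k\<rfloor> + \<rho> b) / k + (frac (t b * real k) - \<rho> b) / k"
    using assms(1) by (simp add: frac_def add_divide_distrib[symmetric])
  moreover have "\<bar>(frac (t b * real k) - \<rho> b) / k\<bar> \<le> 1"
    using prod_frac_bound[of "[b]" t k] assms(1,3) by (simp add: abs_divide pos_divide_le_eq)
  ultimately show ?thesis by linarith
qed

lemma orthant_integrand_integrable:
  assumes "test_function \<phi>"
  shows "integrable (lborel_PiM B) (\<lambda>t. of_bool (\<forall>j\<in>J. t j \<ge> 0) * \<phi> (affine_map B \<alpha> v t))"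
proof -
  have "finite J" "\<And>j. j \<in> J \<Longrightarrow> (\<lambda>t. t j) \<in> borel_measurable (lborel_PiM B)"
    using J finite_B finite_subset by auto
  then show ?thesis
    by (intro integrable_test_function finite_B indep assms pred_intros_finite) auto
qed

lemma lattice_integrand_integrable:
  assumes "test_function \<phi>" "k > 0" "ws \<in> words B l"
  shows "integrable (lborel_PiM B) (\<lambda>t. (of_bool (\<forall>j\<in>J. \<lfloor>t j * real k\<rfloor> \<ge> 0) * \<phi> (node k (\<lambda>b\<in>B. \<lfloor>t b * real k\<rfloor>))) *
      of_real (\<Prod>b\<leftarrow>ws. frac (t b * real k) - \<rho> b))"
proof -
  have ws: "set ws \<subseteq> B" using assms(3) by (auto simp: words_def)
  obtain R where R: "R \<ge> 0" "\<And>ws t b. word_deriv v ws \<phi> (affine_map B \<alpha> v t) \<noteq> 0 \<Longrightarrow> b \<in> B \<Longrightarrow> \<bar>t b\<bar> \<le> R"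
    using support_box[OF assms(1)] by metis
  then have R': "\<forall>ws t. word_deriv v ws \<phi> (affine_map B \<alpha> v t) \<noteq> 0 \<longrightarrow> (\<forall>b\<in>B. \<bar>t b\<bar> \<le> R)"
    by blast
  obtain C where C: "\<And>x. norm (\<phi> x) \<le> C" "C \<ge> 0" using test_function_bounded[OF assms(1)] by blast
  show ?thesis
  proof (rule integrable_lborel_PiM[OF finite_B, of "R + 1" _ C])
    have "finite J" "\<And>j. j \<in> J \<Longrightarrow> (\<lambda>t. t j) \<in> borel_measurable (lborel_PiM B)"
      using J finite_B finite_subset by auto
    then have 1: "(\<lambda>t. \<forall>j\<in>J. \<lfloor>t j * real k\<rfloor> \<ge> 0) \<in> measurable (lborel_PiM B) (count_space UNIV)"
      by (intro pred_intros_finite) auto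
    have 2: "(\<lambda>t. \<phi> (node k (\<lambda>b\<in>B. \<lfloor>t b * real k\<rfloor>))) \<in> borel_measurable (lborel_PiM B)"
      unfolding node_floor by (intro test_function_measurable[OF assms(1)]) measurable
    have 3: "(\<lambda>t. \<Prod>b\<leftarrow>ws. frac (t b * real k) - \<rho> b) \<in> borel_measurable (lborel_PiM B)"
      using ws by (induction ws) (auto simp: frac_def)
    show "(\<lambda>t. (of_bool (\<forall>j\<in>J. \<lfloor>t j * real k\<rfloor> \<ge> 0) * \<phi> (node k (\<lambda>b\<in>B. \<lfloor>t b * real k\<rfloor>))) *
        of_real (\<Prod>b\<leftarrow>ws. frac (t b * real k) - \<rho> b)) \<in> borel_measurable (lborel_PiM B)"
      using 1 2 3 by (intro borel_measurable_times) (auto simp: of_bool_def)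
    show "norm ((of_bool (\<forall>j\<in>J. \<lfloor>t j * real k\<rfloor> \<ge> 0) * \<phi> (node k (\<lambda>b\<in>B. \<lfloor>t b * real k\<rfloor>))) *
        of_real (\<Prod>b\<leftarrow>ws. frac (t b * real k) - \<rho> b)) \<le> C" for t
    proof -
      have "norm (of_bool (\<forall>j\<in>J. \<lfloor>t j * real k\<rfloor> \<ge> 0) * \<phi> (node k (\<lambda>b\<in>B. \<lfloor>t b * real k\<rfloor>))) *
          \<bar>\<Prod>b\<leftarrow>ws. frac (t b * real k) - \<rho> b\<bar> \<le> C * 1"
        using C prod_frac_bound[OF ws, of t k] by (intro mult_mono) (auto simp: norm_mult)
      then show ?thesis by (simp add: norm_mult)
    qed
    show "\<bar>t b\<bar> \<le> R + 1" if "(of_bool (\<forall>j\<in>J. \<lfloor>t j * real k\<rfloor> \<ge> 0) * \<phi> (node k (\<lambda>b\<in>B. \<lfloor>t b * real k\<rfloor>))) *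
        of_real (\<Prod>b\<leftarrow>ws. frac (t b * real k) - \<rho> b) \<noteq> 0" "b \<in> B" for t b
      using node_floor_support[OF assms(2) _ that(2) R', of "[]" t] that(1) by (auto simp: word_deriv_def)
  qed (use R in auto)
qed

text \<open>Taylor's formula is applied at every point of the orthant around the sample point of its
  cell and then integrated. Displacements are at most \<open>1 / k\<close>, which gives the order of
  the remainder, and \<open>lattice_mean_integral\<close> evaluates the Taylor terms.\<close>

lemma integral_lattice_expansion:
  assumes "test_function \<phi>"
  shows "\<exists>C. \<forall>k>0. norm (orthant_integral \<phi> -
    (\<Sum>l<N. (\<Sum>ws\<in>words B l. word_coeff ws * lattice_mean k (word_deriv v ws \<phi>)) / of_nat k ^ l)) \<le> C / real k ^ N"
proof -
  obtain R where R: "R \<ge> 0" "\<And>ws t b. word_deriv v ws \<phi> (affine_map B \<alpha> v t) \<noteq> 0 \<Longrightarrow> b \<in> B \<Longrightarrow> \<bar>t b\<bar> \<le> R"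
    using support_box[OF assms] by metis
  then have R': "\<forall>ws t. word_deriv v ws \<phi> (affine_map B \<alpha> v t) \<noteq> 0 \<longrightarrow> (\<forall>b\<in>B. \<bar>t b\<bar> \<le> R)"
    by blast
  have "\<exists>C. \<forall>x. norm (word_deriv v ws \<phi> x) \<le> C" for ws
    using test_function_bounded[OF test_function_word_deriv[OF assms]] by metis
  then obtain c where c: "\<And>ws x. norm (word_deriv v ws \<phi> x) \<le> c ws" by metis
  define M where "M = (\<Sum>ws\<in>words B N. c ws)"
  have c0: "c ws \<ge> 0" for ws using order_trans[OF norm_ge_zero c] .
  have M: "norm (word_deriv v ws \<phi> x) \<le> M" if "ws \<in> words B N" for ws x
    using order_trans[OF c member_le_sum[OF that]] c0 finite_words[OF finite_B] by (auto simp: M_def)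
  \<comment> \<open>The factor 2 comes from \<open>Taylor_words\<close>. The last factor is the
    volume of a cube containing the supports, enlarged by 1 to hold points whose sample point lies
    in a support.\<close>
  define C where "C = 2 * (real (card (words B N)) * M) * (2 * (R + 1)) ^ card B"
  show ?thesis
  proof (intro exI[of _ C] allI impI)
    fix k :: nat assume k: "k > 0"
    define f where "f = (\<lambda>t. of_bool (\<forall>j\<in>J. t j \<ge> 0) * \<phi> (affine_map B \<alpha> v t))"
    define g where "g = (\<lambda>ws t. (of_bool (\<forall>j\<in>J. \<lfloor>t j * real k\<rfloor> \<ge> 0) *
      word_deriv v ws \<phi> (node k (\<lambda>b\<in>B. \<lfloor>t b * real k\<rfloor>))) * of_real (\<Prod>b\<leftarrow>ws. frac (t b * real k) - \<rho> b))"
    define e where "e = (\<lambda>t. f t - (\<Sum>l<N. (\<Sum>ws\<in>words B l. g ws t) / (fact l * of_nat k ^ l)))"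
    have f: "integrable (lborel_PiM B) f"
      unfolding f_def by (rule orthant_integrand_integrable[OF assms])
    have g: "integrable (lborel_PiM B) (g ws)" if "ws \<in> words B l" for ws l
      unfolding g_def by (rule lattice_integrand_integrable[OF test_function_word_deriv[OF assms] k that])
    have int_g: "integral\<^sup>L (lborel_PiM B) (g ws) = lattice_mean k (word_deriv v ws \<phi>) * (fact l * word_coeff ws)"
      if "ws \<in> words B l" for ws l
      unfolding g_def by (rule lattice_mean_integral[OF test_function_word_deriv[OF assms] k that])
    have "integral\<^sup>L (lborel_PiM B) e = orthant_integral \<phi> -
        (\<Sum>l<N. (\<Sum>ws\<in>words B l. integral\<^sup>L (lborel_PiM B) (g ws)) / (fact l * of_nat k ^ l))"
      unfolding e_def using f g
      by (subst Bochner_Integration.integral_diff)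
        (auto simp: orthant_integral_def f_def intro!: Bochner_Integration.integrable_sum)
    also have "(\<Sum>l<N. (\<Sum>ws\<in>words B l. integral\<^sup>L (lborel_PiM B) (g ws)) / (fact l * of_nat k ^ l)) =
        (\<Sum>l<N. (\<Sum>ws\<in>words B l. word_coeff ws * lattice_mean k (word_deriv v ws \<phi>)) / of_nat k ^ l)"
    proof (rule sum.cong[OF refl])
      fix l
      have "(\<Sum>ws\<in>words B l. integral\<^sup>L (lborel_PiM B) (g ws)) =
          fact l * (\<Sum>ws\<in>words B l. word_coeff ws * lattice_mean k (word_deriv v ws \<phi>))"
        by (simp add: int_g sum_distrib_left mult_ac cong: sum.cong)
      then show "(\<Sum>ws\<in>words B l. integral\<^sup>L (lborel_PiM B) (g ws)) / (fact l * of_nat k ^ l) =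
          (\<Sum>ws\<in>words B l. word_coeff ws * lattice_mean k (word_deriv v ws \<phi>)) / of_nat k ^ l"
        by simp
    qed
    finally have eq: "orthant_integral \<phi> -
        (\<Sum>l<N. (\<Sum>ws\<in>words B l. word_coeff ws * lattice_mean k (word_deriv v ws \<phi>)) / of_nat k ^ l) =
        integral\<^sup>L (lborel_PiM B) e" by simp
    have "norm (integral\<^sup>L (lborel_PiM B) e) \<le>
        (2 * (real (card (words B N)) * ((1 / k) ^ N * M))) * (2 * (R + 1)) ^ card B"
    proof (rule integrable_lborel_PiM(2)[OF finite_B])
      show "R + 1 \<ge> 0" using R by simp
      show "e \<in> borel_measurable (lborel_PiM B)"
        unfolding e_def using f g
        by (intro borel_measurable_diff borel_measurable_sum borel_measurable_divide)
          (auto intro!: borel_measurable_sum)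
      show "norm (e t) \<le> 2 * (real (card (words B N)) * ((1 / k) ^ N * M))" for t
      proof -
        define x where "x = node k (\<lambda>b\<in>B. \<lfloor>t b * real k\<rfloor>)"
        define \<delta> where "\<delta> = (\<lambda>b. (frac (t b * real k) - \<rho> b) / k)"
        \<comment> \<open>Taking floors preserves the sign condition: the orthant is a union of
          cells, and no boundary error arises.\<close>
        have pos: "\<lfloor>t j * real k\<rfloor> \<ge> 0 \<longleftrightarrow> t j \<ge> 0" for j
          using k by (simp add: zero_le_mult_iff)
        \<comment> \<open>Passing from \<open>\<delta>\<close> to fractional parts costs one factor
          \<open>k\<close> per letter; these are the powers of \<open>k\<close> in the
          expansion.\<close>
        have prod: "complex_of_real (\<Prod>b\<leftarrow>ws. frac (t b * real k) - \<rho> b) = of_real (\<Prod>b\<leftarrow>ws. \<delta> b) * of_nat k ^ length ws" for ws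
          using k by (induction ws) (auto simp: \<delta>_def)
        have "(\<Sum>ws\<in>words B l. g ws t) / (fact l * of_nat k ^ l) = of_bool (\<forall>j\<in>J. t j \<ge> 0) *
            ((\<Sum>ws\<in>words B l. of_real (\<Prod>b\<leftarrow>ws. \<delta> b) * word_deriv v ws \<phi> x) / fact l)" for l
        proof -
          have "(\<Sum>ws\<in>words B l. g ws t) = (\<Sum>ws\<in>words B l. of_nat k ^ l *
              (of_bool (\<forall>j\<in>J. t j \<ge> 0) * (of_real (\<Prod>b\<leftarrow>ws. \<delta> b) * word_deriv v ws \<phi> x)))"
          proof (intro sum.cong refl)
            fix ws assume "ws \<in> words B l"
            then have "complex_of_real (\<Prod>b\<leftarrow>ws. frac (t b * real k) - \<rho> b) = of_real (\<Prod>b\<leftarrow>ws. \<delta> b) * of_nat k ^ l"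
              using prod[of ws] by (simp add: words_def)
            then show "g ws t = of_nat k ^ l *
                (of_bool (\<forall>j\<in>J. t j \<ge> 0) * (of_real (\<Prod>b\<leftarrow>ws. \<delta> b) * word_deriv v ws \<phi> x))"
              unfolding g_def pos x_def by simp
          qed
          then show ?thesis
            using k by (simp add: sum_distrib_left[symmetric])
        qed
        then have "e t = of_bool (\<forall>j\<in>J. t j \<ge> 0) * (\<phi> (x + (\<Sum>b\<in>B. \<delta> b *\<^sub>R v b)) -
            (\<Sum>l<N. (\<Sum>ws\<in>words B l. of_real (\<Prod>b\<leftarrow>ws. \<delta> b) * word_deriv v ws \<phi> x) / fact l))"
          unfolding e_def f_def affine_map_node[OF k] x_def \<delta>_def
          by (simp only: sum_distrib_left[symmetric] right_diff_distrib)
        then have "norm (e t) \<le> norm (\<phi> (x + (\<Sum>b\<in>B. \<delta> b *\<^sub>R v b)) -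
            (\<Sum>l<N. (\<Sum>ws\<in>words B l. of_real (\<Prod>b\<leftarrow>ws. \<delta> b) * word_deriv v ws \<phi> x) / fact l))"
          by (auto simp: norm_mult)
        also have "\<dots> \<le> 2 * (real (card (words B N)) * ((1 / k) ^ N * M))"
        proof (rule Taylor_words[OF finite_B assms M])
          show "\<bar>\<delta> b\<bar> \<le> 1 / k" if "b \<in> B" for b
            using prod_frac_bound[of "[b]" t k] that k by (simp add: \<delta>_def abs_divide divide_right_mono)
        qed
        finally show ?thesis .
      qed
      show "\<bar>t b\<bar> \<le> R + 1" if "e t \<noteq> 0" "b \<in> B" for t b
      proof (rule ccontr)
        assume "\<not> ?thesis"
        then have "word_deriv v ws \<phi> (affine_map B \<alpha> v t) = 0"
          "word_deriv v ws \<phi> (node k (\<lambda>b\<in>B. \<lfloor>t b * real k\<rfloor>)) = 0" for ws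
          using R(2)[of ws t b] node_floor_support[OF k _ \<open>b \<in> B\<close> R', of ws t] \<open>b \<in> B\<close> by (force, blast)
        from this(1)[of "[]"] this(2) have "e t = 0"
          by (simp add: e_def f_def g_def word_deriv_def)
        then show False using that by simp
      qed
    qed
    also have "\<dots> = C / k ^ N" by (simp add: C_def power_one_over)
    finally show "norm (orthant_integral \<phi> - (\<Sum>l<N. (\<Sum>ws\<in>words B l. word_coeff ws *
        lattice_mean k (word_deriv v ws \<phi>)) / of_nat k ^ l)) \<le> C / real k ^ N"
      using eq by simp
  qed
qed

end

section \<open>Inverting the expansion of the integral\<close>

context orthant_sum
begin

text \<open>The moment of order zero is the volume of the unit cube. Integral and lattice mean thus
  agree up to lower powers of \<open>k\<close>, which makes the system triangular.\<close>

lemma word_coeff_Nil: "word_coeff [] = 1"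
  using integral_unit_cube[OF finite_B] by (simp add: word_coeff_def)

text \<open>The recursion inverts a power series in \<open>1 / k\<close>. With a single direction
  the series of moments is \<open>exp (- \<rho> x) (exp x - 1) / x\<close>, whose reciprocal
  generates the Bernoulli polynomials at \<open>\<rho>\<close> divided by factorials: these are the
  terms of the Euler-Maclaurin formula.\<close>

fun orthant_term :: "nat \<Rightarrow> ('a \<Rightarrow> complex) \<Rightarrow> complex" where
  "orthant_term 0 \<phi> = orthant_integral \<phi>"
| "orthant_term (Suc m) \<phi> =
    (\<Sum>l\<le>m. \<Sum>ws\<in>words B (Suc l). - word_coeff ws * orthant_term (m - l) (word_deriv v ws \<phi>))"

lemma distribution_orthant_integral: "distribution orthant_integral"
  unfolding distribution_altdef
proof (intro conjI allI impI)
  fix \<phi> \<psi> :: "'a \<Rightarrow> complex" and c assume \<phi>: "test_function \<phi>"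
  show "orthant_integral (\<lambda>x. c * \<phi> x) = c * orthant_integral \<phi>"
    unfolding orthant_integral_def by (subst mult.left_commute) simp
  assume \<psi>: "test_function \<psi>"
  show "orthant_integral (\<lambda>x. \<phi> x + \<psi> x) = orthant_integral \<phi> + orthant_integral \<psi>"
    unfolding orthant_integral_def distrib_left
    by (intro Bochner_Integration.integral_add orthant_integrand_integrable \<phi> \<psi>)
next
  fix K :: "'a set" assume K: "compact K"
  obtain R where R: "R \<ge> 0" "\<And>t b. affine_map B \<alpha> v t \<in> K \<Longrightarrow> b \<in> B \<Longrightarrow> \<bar>t b\<bar> \<le> R"
    using affine_map_bounded[OF finite_B indep compact_imp_bounded[OF K]] by metis
  have "norm (orthant_integral \<phi>) \<le> (2 * R) ^ card B * test_seminorm 0 \<phi>"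
    if \<phi>: "test_function \<phi>" "{x. \<phi> x \<noteq> 0} \<subseteq> K" for \<phi>
  proof -
    have "norm (orthant_integral \<phi>) \<le> test_seminorm 0 \<phi> * (2 * R) ^ card B"
      unfolding orthant_integral_def
    proof (rule integrable_lborel_PiM(2)[OF finite_B R(1)])
      show "norm (of_bool (\<forall>j\<in>J. t j \<ge> 0) * \<phi> (affine_map B \<alpha> v t)) \<le> test_seminorm 0 \<phi>" for t
        using test_seminorm_ge[OF \<phi>(1), of "[]" 0] test_seminorm_nonneg[OF \<phi>(1)] by (auto simp: norm_mult)
      show "\<bar>t b\<bar> \<le> R" if "of_bool (\<forall>j\<in>J. t j \<ge> 0) * \<phi> (affine_map B \<alpha> v t) \<noteq> 0" "b \<in> B" for t b
        using that \<phi>(2) by (intro R(2)) auto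
    qed (use orthant_integrand_integrable[OF \<phi>(1)] in auto)
    then show ?thesis by (simp add: mult.commute)
  qed
  then show "\<exists>C N. \<forall>\<phi>. test_function \<phi> \<longrightarrow> {x. \<phi> x \<noteq> 0} \<subseteq> K \<longrightarrow>
      norm (orthant_integral \<phi>) \<le> C * test_seminorm N \<phi>"
    by (intro exI[of _ "(2 * R) ^ card B"] exI[of _ 0]) auto
qed

lemma distribution_orthant_term: "distribution (orthant_term m)"
proof (induction m rule: less_induct)
  case (less m)
  show ?case
  proof (cases m)
    case 0
    then have "orthant_term m = orthant_integral" by (auto simp: fun_eq_iff)
    then show ?thesis using distribution_orthant_integral by simp
  next
    case (Suc n)
    have "distribution (\<lambda>\<phi>. \<Sum>l\<le>n. \<Sum>ws\<in>words B (Suc l). - word_coeff ws * orthant_term (n - l) (word_deriv v ws \<phi>))"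
      unfolding word_deriv_def
      by (intro distribution_sum distribution_cmult distribution_iterated_deriv less) (simp add: Suc)
    then show ?thesis unfolding Suc orthant_term.simps .
  qed
qed

text \<open>The lattice means of derivatives along words of length \<open>Suc l\<close> carry a
  factor \<open>1 / k ^ Suc l\<close>, so it suffices to expand them to order
  \<open>N - Suc l\<close>. This is why the induction is strong and lets \<open>\<phi>\<close>
  vary.\<close>

lemma lattice_mean_expansion:
  assumes "test_function \<phi>"
  shows "\<exists>C. \<forall>k>0. norm (lattice_mean k \<phi> - (\<Sum>m<N. orthant_term m \<phi> / of_nat k ^ m)) \<le> C / real k ^ N"
  using assms
proof (induction N arbitrary: \<phi> rule: less_induct)
  case (less N)
  show ?case
  proof (cases N)
    case 0
    \<comment> \<open>Order zero asks for boundedness of the lattice means, which the first-order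
      comparison with the integral provides.\<close>
    obtain C where C: "\<And>k. k > 0 \<Longrightarrow> norm (orthant_integral \<phi> -
        (\<Sum>l<1. (\<Sum>ws\<in>words B l. word_coeff ws * lattice_mean k (word_deriv v ws \<phi>)) / of_nat k ^ l)) \<le> C / real k ^ 1"
      using integral_lattice_expansion[OF less.prems, of 1] by blast
    have "norm (lattice_mean k \<phi>) \<le> norm (orthant_integral \<phi>) + \<bar>C\<bar>" if "k > 0" for k
    proof -
      have "norm (orthant_integral \<phi> - lattice_mean k \<phi>) \<le> C / real k"
        using C[OF that] by (simp add: words_0 word_coeff_Nil word_deriv_def)
      also have "\<dots> \<le> \<bar>C\<bar>"
        using that mult_left_mono[of 1 "real k" "\<bar>C\<bar>"] by (simp add: pos_divide_le_eq)
      finally show ?thesis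
        using norm_triangle_ineq4[of "orthant_integral \<phi>" "orthant_integral \<phi> - lattice_mean k \<phi>"] by simp
    qed
    then show ?thesis using 0 by (intro exI[of _ "norm (orthant_integral \<phi>) + \<bar>C\<bar>"]) auto
  next
    case (Suc n)
    obtain C where C: "\<And>k. k > 0 \<Longrightarrow> norm (orthant_integral \<phi> -
        (\<Sum>l<N. (\<Sum>ws\<in>words B l. word_coeff ws * lattice_mean k (word_deriv v ws \<phi>)) / of_nat k ^ l)) \<le> C / real k ^ N"
      using integral_lattice_expansion[OF less.prems, of N] by blast
    have "\<exists>C. \<forall>k>0. norm (lattice_mean k (word_deriv v ws \<phi>) -
        (\<Sum>m<n - l. orthant_term m (word_deriv v ws \<phi>) / of_nat k ^ m)) \<le> C / real k ^ (n - l)" for ws l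
      by (rule less.IH) (simp_all add: Suc test_function_word_deriv less.prems)
    then obtain c where c: "\<And>ws l k. k > 0 \<Longrightarrow> norm (lattice_mean k (word_deriv v ws \<phi>) -
        (\<Sum>m<n - l. orthant_term m (word_deriv v ws \<phi>) / of_nat k ^ m)) \<le> c ws l / real k ^ (n - l)"
      by metis
    define E where "E = C + (\<Sum>l<n. \<Sum>ws\<in>words B (Suc l). norm (word_coeff ws) * c ws l)"
    have "norm (lattice_mean k \<phi> - (\<Sum>m<N. orthant_term m \<phi> / of_nat k ^ m)) \<le> E / real k ^ N" if k: "k > 0" for k
    proof -
      let ?A = "\<lambda>ws. lattice_mean k (word_deriv v ws \<phi>)"
      let ?T = "\<lambda>ws l. (\<Sum>m<n - l. orthant_term m (word_deriv v ws \<phi>) / of_nat k ^ m)"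
      define e where "e = orthant_integral \<phi> -
        (\<Sum>l<N. (\<Sum>ws\<in>words B l. word_coeff ws * ?A ws) / of_nat k ^ l)"
      have e: "norm e \<le> C / real k ^ N" unfolding e_def by (rule C[OF k])
      have e': "e = orthant_integral \<phi> - lattice_mean k \<phi> -
          (\<Sum>l<n. (\<Sum>ws\<in>words B (Suc l). word_coeff ws * ?A ws) / of_nat k ^ Suc l)"
        unfolding e_def Suc sum.lessThan_Suc_shift
        by (simp add: words_0 word_coeff_Nil word_deriv_def)
      have T: "(\<Sum>m<N. orthant_term m \<phi> / of_nat k ^ m) = orthant_integral \<phi> -
          (\<Sum>l<n. (\<Sum>ws\<in>words B (Suc l). word_coeff ws * ?T ws l) / of_nat k ^ Suc l)"
      proof -
        define F where "F = (\<lambda>l m. (\<Sum>ws\<in>words B (Suc l). word_coeff ws * orthant_term m (word_deriv v ws \<phi>)) / of_nat k ^ (Suc l + m))"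
        have "(\<Sum>l<n. (\<Sum>ws\<in>words B (Suc l). word_coeff ws * ?T ws l) / of_nat k ^ Suc l) = (\<Sum>l<n. \<Sum>m<n - l. F l m)"
        proof (rule sum.cong[OF refl])
          fix l
          have "(\<Sum>ws\<in>words B (Suc l). word_coeff ws * ?T ws l) / of_nat k ^ Suc l =
              (\<Sum>ws\<in>words B (Suc l). \<Sum>m<n - l. word_coeff ws * orthant_term m (word_deriv v ws \<phi>) / of_nat k ^ (Suc l + m))"
            by (simp add: sum_distrib_left sum_divide_distrib power_add mult_ac)
          then show "(\<Sum>ws\<in>words B (Suc l). word_coeff ws * ?T ws l) / of_nat k ^ Suc l = (\<Sum>m<n - l. F l m)"
            by (subst (asm) sum.swap) (simp add: F_def sum_divide_distrib)
        qed
        also have "\<dots> = (\<Sum>(l, m)\<in>{(l, m). l + m < n}. F l m)"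
          by (subst sum.Sigma) (auto intro!: sum.cong)
        \<comment> \<open>Collecting by the total order \<open>p = l + m\<close> reproduces the
          recursion that defines \<open>orthant_term\<close>.\<close>
        also have "\<dots> = (\<Sum>p<n. \<Sum>l\<le>p. F l (p - l))"
          by (rule sum.triangle_reindex)
        also have "\<dots> = - (\<Sum>p<n. orthant_term (Suc p) \<phi> / of_nat k ^ Suc p)"
          unfolding sum_negf[symmetric]
          by (intro sum.cong refl) (simp add: F_def sum_divide_distrib sum_negf)
        finally show ?thesis
          unfolding Suc sum.lessThan_Suc_shift by simp
      qed
      have "lattice_mean k \<phi> - (\<Sum>m<N. orthant_term m \<phi> / of_nat k ^ m) =
          - e - (\<Sum>l<n. (\<Sum>ws\<in>words B (Suc l). word_coeff ws * (?A ws - ?T ws l)) / of_nat k ^ Suc l)"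
        unfolding T e' by (simp add: sum_subtractf diff_divide_distrib right_diff_distrib)
      also have "norm \<dots> \<le> norm e + (\<Sum>l<n. \<Sum>ws\<in>words B (Suc l). norm (word_coeff ws) * c ws l / real k ^ N)"
      proof -
        have "norm ((\<Sum>ws\<in>words B (Suc l). word_coeff ws * (?A ws - ?T ws l)) / of_nat k ^ Suc l) \<le>
            (\<Sum>ws\<in>words B (Suc l). norm (word_coeff ws) * c ws l / real k ^ N)" if "l < n" for l
        proof -
          have pw: "real k ^ (n - l) * real k ^ Suc l = real k ^ N"
            using that Suc by (simp flip: power_add)
          have "norm (\<Sum>ws\<in>words B (Suc l). word_coeff ws * (?A ws - ?T ws l)) \<le>
              (\<Sum>ws\<in>words B (Suc l). norm (word_coeff ws) * (c ws l / real k ^ (n - l)))"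
            using c[OF k, of _ l]
            by (intro sum_norm_le) (simp only: norm_mult, intro mult_left_mono norm_ge_zero)
          then have "norm (\<Sum>ws\<in>words B (Suc l). word_coeff ws * (?A ws - ?T ws l)) / real k ^ Suc l \<le>
              (\<Sum>ws\<in>words B (Suc l). norm (word_coeff ws) * (c ws l / real k ^ (n - l))) / real k ^ Suc l"
            by (intro divide_right_mono) auto
          also have "\<dots> = (\<Sum>ws\<in>words B (Suc l). norm (word_coeff ws) * c ws l / real k ^ N)"
            by (simp add: sum_divide_distrib pw[symmetric] mult_ac)
          finally show ?thesis by (simp add: norm_divide norm_mult norm_power)
        qed
        then have "norm (\<Sum>l<n. (\<Sum>ws\<in>words B (Suc l). word_coeff ws * (?A ws - ?T ws l)) / of_nat k ^ Suc l)
            \<le> (\<Sum>l<n. \<Sum>ws\<in>words B (Suc l). norm (word_coeff ws) * c ws l / real k ^ N)"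
          by (intro sum_norm_le) auto
        then show ?thesis
          by (intro order_trans[OF norm_triangle_ineq4]) simp
      qed
      also have "\<dots> \<le> E / real k ^ N"
        using e by (simp add: E_def sum_divide_distrib add_divide_distrib)
      finally show ?thesis .
    qed
    then show ?thesis by blast
  qed
qed

end

section \<open>Expansions of lattice sums with periodic coefficients\<close>

text \<open>Coordinates in \<open>B\<close> are the ones compared, so values of \<open>n\<close>
  elsewhere do not affect \<open>c n k\<close> and \<open>n\<close> may be restricted to
  \<open>B\<close> freely.\<close>

definition periodic_coeff :: "'b set \<Rightarrow> int \<Rightarrow> (('b \<Rightarrow> int) \<Rightarrow> int \<Rightarrow> complex) \<Rightarrow> bool" where
  "periodic_coeff B D c \<longleftrightarrow> D > 0 \<and> (\<forall>n n' k k'. (\<forall>b\<in>B. n b mod D = n' b mod D) \<longrightarrow>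
     k mod D = k' mod D \<longrightarrow> c n k = c n' k')"

definition weighted_sum :: "'b set \<Rightarrow> 'a::euclidean_space \<Rightarrow> ('b \<Rightarrow> 'a) \<Rightarrow> (('b \<Rightarrow> int) \<Rightarrow> int \<Rightarrow> complex) \<Rightarrow>
    nat \<Rightarrow> ('a \<Rightarrow> complex) \<Rightarrow> complex" where
  "weighted_sum B \<alpha> v w k \<phi> =
    (\<Sum>\<^sub>\<infinity>n\<in>Pi\<^sub>E B (\<lambda>_. UNIV). w n (int k) * \<phi> (affine_map B \<alpha> v (\<lambda>b. of_int (n b) / real k)))"

text \<open>Powers of \<open>k\<close> are divided out beforehand. The explicit error bound and the
  single period for all terms make this stronger than \<open>has_asymptotic_expansion\<close>, and
  it is stable under sums and under factors that depend on a residue of \<open>k\<close>.\<close>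

definition expands :: "(nat \<Rightarrow> ('a::euclidean_space \<Rightarrow> complex) \<Rightarrow> complex) \<Rightarrow>
    (nat \<Rightarrow> int \<Rightarrow> ('a \<Rightarrow> complex) \<Rightarrow> complex) \<Rightarrow> bool" where
  "expands S \<theta> \<longleftrightarrow> (\<forall>n k. distribution (\<theta> n k)) \<and>
    (\<exists>D::int. D > 0 \<and> (\<forall>n k k'. k mod D = k' mod D \<longrightarrow> \<theta> n k = \<theta> n k')) \<and>
    (\<forall>\<phi> N. test_function \<phi> \<longrightarrow>
      (\<exists>C. \<forall>k>0. norm (S k \<phi> - (\<Sum>n<N. \<theta> n (int k) \<phi> / of_nat k ^ n)) \<le> C / real k ^ N))"

lemma expands_add:
  assumes "expands S \<theta>" "expands T \<eta>"
  shows "expands (\<lambda>k \<phi>. S k \<phi> + T k \<phi>) (\<lambda>n k \<phi>. \<theta> n k \<phi> + \<eta> n k \<phi>)"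
  unfolding expands_def
proof (intro conjI allI impI)
  show "distribution (\<lambda>\<phi>. \<theta> n k \<phi> + \<eta> n k \<phi>)" for n k
    using assms by (intro distribution_add) (auto simp: expands_def)
  obtain D E where D: "D > 0" "\<And>n k k'. k mod D = k' mod D \<Longrightarrow> \<theta> n k = \<theta> n k'"
    and E: "E > 0" "\<And>n k k'. k mod E = k' mod E \<Longrightarrow> \<eta> n k = \<eta> n k'"
    using assms unfolding expands_def by metis
  show "\<exists>D>0. \<forall>n k k'. k mod D = k' mod D \<longrightarrow> (\<lambda>\<phi>. \<theta> n k \<phi> + \<eta> n k \<phi>) = (\<lambda>\<phi>. \<theta> n k' \<phi> + \<eta> n k' \<phi>)"
  proof (intro exI[of _ "D * E"] conjI allI impI)
    fix n k k' assume "k mod (D * E) = k' mod (D * E)"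
    then have "k mod D = k' mod D" "k mod E = k' mod E"
      by (metis mod_mod_cancel dvd_triv_left, metis mod_mod_cancel dvd_triv_right)
    then show "(\<lambda>\<phi>. \<theta> n k \<phi> + \<eta> n k \<phi>) = (\<lambda>\<phi>. \<theta> n k' \<phi> + \<eta> n k' \<phi>)"
      using D(2)[of k k'] E(2)[of k k'] by simp
  qed (use D E in auto)
  fix \<phi> :: "'a \<Rightarrow> complex" and N assume \<phi>: "test_function \<phi>"
  obtain C where C: "\<And>k. k > 0 \<Longrightarrow> norm (S k \<phi> - (\<Sum>n<N. \<theta> n (int k) \<phi> / of_nat k ^ n)) \<le> C / real k ^ N"
    using assms(1) \<phi> unfolding expands_def by blast
  obtain C' where C': "\<And>k. k > 0 \<Longrightarrow> norm (T k \<phi> - (\<Sum>n<N. \<eta> n (int k) \<phi> / of_nat k ^ n)) \<le> C' / real k ^ N"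
    using assms(2) \<phi> unfolding expands_def by blast
  show "\<exists>C. \<forall>k>0. norm (S k \<phi> + T k \<phi> - (\<Sum>n<N. (\<theta> n (int k) \<phi> + \<eta> n (int k) \<phi>) / of_nat k ^ n)) \<le> C / real k ^ N"
  proof (intro exI[of _ "C + C'"] allI impI)
    fix k :: nat assume "k > 0"
    then have "norm ((S k \<phi> - (\<Sum>n<N. \<theta> n (int k) \<phi> / of_nat k ^ n)) + (T k \<phi> - (\<Sum>n<N. \<eta> n (int k) \<phi> / of_nat k ^ n)))
        \<le> C / real k ^ N + C' / real k ^ N"
      using C[of k] C'[of k] by (intro order_trans[OF norm_triangle_ineq add_mono]) auto
    then show "norm (S k \<phi> + T k \<phi> - (\<Sum>n<N. (\<theta> n (int k) \<phi> + \<eta> n (int k) \<phi>) / of_nat k ^ n)) \<le> (C + C') / real k ^ N"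
      by (simp add: add_divide_distrib sum.distrib algebra_simps)
  qed
qed

lemma expands_mult_mod:
  assumes "expands S \<theta>" "D > 0" and c: "\<And>k k'. k mod D = k' mod D \<Longrightarrow> c k = c (k' :: int)"
  shows "expands (\<lambda>k \<phi>. c (int k) * S k \<phi>) (\<lambda>n k \<phi>. c k * \<theta> n k \<phi>)"
  unfolding expands_def
proof (intro conjI allI impI)
  show "distribution (\<lambda>\<phi>. c k * \<theta> n k \<phi>)" for n k
    using assms by (intro distribution_cmult) (auto simp: expands_def)
  obtain E where E: "E > 0" "\<And>n k k'. k mod E = k' mod E \<Longrightarrow> \<theta> n k = \<theta> n k'"
    using assms(1) unfolding expands_def by metis
  show "\<exists>D>0. \<forall>n k k'. k mod D = k' mod D \<longrightarrow> (\<lambda>\<phi>. c k * \<theta> n k \<phi>) = (\<lambda>\<phi>. c k' * \<theta> n k' \<phi>)"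
  proof (intro exI[of _ "D * E"] conjI allI impI)
    fix n k k' assume "k mod (D * E) = k' mod (D * E)"
    then have "k mod D = k' mod D" "k mod E = k' mod E"
      by (metis mod_mod_cancel dvd_triv_left, metis mod_mod_cancel dvd_triv_right)
    then show "(\<lambda>\<phi>. c k * \<theta> n k \<phi>) = (\<lambda>\<phi>. c k' * \<theta> n k' \<phi>)"
      using c[of k k'] E(2)[of k k'] by simp
  qed (use assms(2) E in auto)
  fix \<phi> :: "'a \<Rightarrow> complex" and N assume \<phi>: "test_function \<phi>"
  obtain C where C: "\<And>k. k > 0 \<Longrightarrow> norm (S k \<phi> - (\<Sum>n<N. \<theta> n (int k) \<phi> / of_nat k ^ n)) \<le> C / real k ^ N"
    using assms(1) \<phi> unfolding expands_def by blast
  \<comment> \<open>A function of residues takes finitely many values; the sum of their norms bounds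
    it.\<close>
  define M where "M = (\<Sum>r\<in>{0..<D}. norm (c r))"
  have M: "norm (c k) \<le> M" for k
  proof -
    have "norm (c k) = norm (c (k mod D))" using c[of k "k mod D"] by simp
    also have "\<dots> \<le> M" unfolding M_def using assms(2) by (intro member_le_sum) auto
    finally show ?thesis .
  qed
  show "\<exists>C. \<forall>k>0. norm (c (int k) * S k \<phi> - (\<Sum>n<N. c (int k) * \<theta> n (int k) \<phi> / of_nat k ^ n)) \<le> C / real k ^ N"
  proof (intro exI[of _ "M * C"] allI impI)
    fix k :: nat assume k: "k > 0"
    have "norm (c (int k) * (S k \<phi> - (\<Sum>n<N. \<theta> n (int k) \<phi> / of_nat k ^ n))) \<le> M * (C / real k ^ N)"
      unfolding norm_mult using C[OF k] M[of "int k"] by (intro mult_mono) (auto elim: order_trans[rotated])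
    then show "norm (c (int k) * S k \<phi> - (\<Sum>n<N. c (int k) * \<theta> n (int k) \<phi> / of_nat k ^ n)) \<le> M * C / real k ^ N"
      by (simp add: right_diff_distrib sum_distrib_left)
  qed
qed

lemma expands_zero: "expands (\<lambda>k \<phi>. 0) (\<lambda>n k \<phi>. 0)"
  unfolding expands_def by (auto simp: distribution_zero intro: exI[of _ 0] exI[of _ 1])

lemma expands_sum:
  assumes "finite I" "\<And>i. i \<in> I \<Longrightarrow> expands (S i) (\<theta> i)"
  shows "expands (\<lambda>k \<phi>. \<Sum>i\<in>I. S i k \<phi>) (\<lambda>n k \<phi>. \<Sum>i\<in>I. \<theta> i n k \<phi>)"
  using assms by (induction I rule: finite_induct) (simp_all add: expands_zero expands_add)

lemma expands_cong:
  assumes "expands S \<theta>" "\<And>k \<phi>. k > 0 \<Longrightarrow> test_function \<phi> \<Longrightarrow> T k \<phi> = S k \<phi>"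
  shows "expands T \<theta>"
  using assms unfolding expands_def by simp

lemma finite_lattice_support:
  fixes v :: "'b \<Rightarrow> 'a::euclidean_space"
  assumes "finite B" "independent_family B v" "test_function \<phi>" "k > 0"
  shows "finite {n \<in> Pi\<^sub>E B (\<lambda>_. UNIV). \<phi> (affine_map B \<alpha> v (\<lambda>b. of_int (n b) / real k)) \<noteq> 0}"
proof -
  \<comment> \<open>The whole lattice is an orthant without sign conditions, sampled at
    corners.\<close>
  interpret orthant_sum B "{}" \<alpha> v "\<lambda>_. 0"
    by standard (use assms in auto)
  show ?thesis using finite_nodes[OF assms(3,4)] by (simp add: node_def)
qed

lemma weighted_sum_summable:
  fixes v :: "'b \<Rightarrow> 'a::euclidean_space"
  assumes "finite B" "independent_family B v" "test_function \<phi>" "k > 0"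
  shows "(\<lambda>n. w n (int k) * \<phi> (affine_map B \<alpha> v (\<lambda>b. of_int (n b) / real k))) summable_on Pi\<^sub>E B (\<lambda>_. UNIV)"
  by (rule finite_nonzero_values_imp_summable_on, rule finite_subset[OF _ finite_lattice_support[OF assms]]) auto

lemma residue_bij:
  assumes "D > 0"
  shows "bij_betw (\<lambda>(r, \<nu>). \<lambda>b\<in>B. r b + D * \<nu> b)
    (Pi\<^sub>E B (\<lambda>_. {0..<D}) \<times> Pi\<^sub>E B (\<lambda>_. UNIV :: int set)) (Pi\<^sub>E B (\<lambda>_. UNIV))"
proof (rule bij_betw_byWitness[where f' = "\<lambda>\<mu>. (\<lambda>b\<in>B. \<mu> b mod D, \<lambda>b\<in>B. \<mu> b div D)"])
  show "\<forall>a\<in>Pi\<^sub>E B (\<lambda>_. {0..<D}) \<times> Pi\<^sub>E B (\<lambda>_. UNIV).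
      (\<lambda>\<mu>. (\<lambda>b\<in>B. \<mu> b mod D, \<lambda>b\<in>B. \<mu> b div D)) (case a of (r, \<nu>) \<Rightarrow> \<lambda>b\<in>B. r b + D * \<nu> b) = a"
    using assms by (auto simp: PiE_iff fun_eq_iff extensional_def)
qed (use assms in \<open>auto simp: PiE_iff fun_eq_iff extensional_def\<close>)

lemma weighted_sum_residues:
  fixes v :: "'b \<Rightarrow> 'a::euclidean_space"
  assumes "finite B" "independent_family B v" "test_function \<phi>" "k > 0" "D > 0"
  shows "weighted_sum B \<alpha> v w k \<phi> = (\<Sum>r\<in>Pi\<^sub>E B (\<lambda>_. {0..<D}). \<Sum>\<^sub>\<infinity>\<nu>\<in>Pi\<^sub>E B (\<lambda>_. UNIV).
    w (\<lambda>b\<in>B. r b + D * \<nu> b) (int k) * \<phi> (affine_map B \<alpha> v (\<lambda>b. (of_int (r b) + of_int D * of_int (\<nu> b)) / real k)))"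
proof -
  define f where "f = (\<lambda>n. w n (int k) * \<phi> (affine_map B \<alpha> v (\<lambda>b. of_int (n b) / real k)))"
  let ?R = "Pi\<^sub>E B (\<lambda>_. {0..<D})" and ?A = "Pi\<^sub>E B (\<lambda>_. UNIV :: int set)"
  have fin: "finite ?R" using assms(1) by (auto intro: finite_PiE)
  have sum: "(f \<circ> (\<lambda>(r, \<nu>). \<lambda>b\<in>B. r b + D * \<nu> b)) summable_on ?R \<times> ?A"
    using weighted_sum_summable[OF assms(1-4), of w \<alpha>] summable_on_reindex_bij_betw[OF residue_bij[OF assms(5), of B], of f]
    by (simp add: f_def o_def)
  have "weighted_sum B \<alpha> v w k \<phi> = infsum f ?A"
    by (simp add: weighted_sum_def f_def)
  also have "\<dots> = infsum (\<lambda>p. f ((\<lambda>(r, \<nu>). \<lambda>b\<in>B. r b + D * \<nu> b) p)) (?R \<times> ?A)"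
    by (rule infsum_reindex_bij_betw[OF residue_bij[OF assms(5)], symmetric])
  also have "\<dots> = infsum (\<lambda>r. infsum (\<lambda>\<nu>. f (\<lambda>b\<in>B. r b + D * \<nu> b)) ?A) ?R"
    using infsum_Sigma'_banach[of "\<lambda>r \<nu>. f (\<lambda>b\<in>B. r b + D * \<nu> b)" ?R "\<lambda>_. ?A"] sum
    by (simp add: o_def case_prod_unfold)
  also have "\<dots> = (\<Sum>r\<in>?R. infsum (\<lambda>\<nu>. f (\<lambda>b\<in>B. r b + D * \<nu> b)) ?A)"
    by (rule infsum_finite[OF fin])
  finally show ?thesis
    by (simp add: f_def affine_map_def cong: sum.cong infsum_cong)
qed

text \<open>Parametrizing by \<open>\<mu>\<close> turns the cone into an orthant. Parameters with a
  non-integral image must contribute nothing; this condition moves into the coefficient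
  \<open>c'\<close>, and \<open>expands_conic\<close> shows that \<open>c'\<close> is periodic when
  \<open>g\<close> and \<open>g0\<close> are rational.\<close>

lemma weighted_sum_cone:
  fixes v :: "'b \<Rightarrow> 'a::euclidean_space" and g0 :: "'b \<Rightarrow> real"
  assumes inj: "\<And>y j. (\<And>b. b \<in> B \<Longrightarrow> (\<Sum>j\<in>B. g b j * y j) = 0) \<Longrightarrow> j \<in> B \<Longrightarrow> y j = 0"
    and J: "J \<subseteq> B" and fin: "finite B" and k: "k > 0"
    and c: "periodic_coeff B D c"
  defines "\<Phi> \<equiv> \<lambda>\<mu> l b. (\<Sum>j\<in>B. g b j * real_of_int (\<mu> j)) + g0 b * real_of_int l"
  defines "c' \<equiv> \<lambda>\<mu> l. if \<forall>b\<in>B. \<Phi> \<mu> l b \<in> \<int> then c (\<lambda>b. \<lfloor>\<Phi> \<mu> l b\<rfloor>) l else 0"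
  shows "weighted_sum B \<alpha> v (\<lambda>n l. of_bool (cone_region B J g g0 n l) * c n l) k \<phi> =
    weighted_sum B (\<alpha> + (\<Sum>b\<in>B. g0 b *\<^sub>R v b)) (\<lambda>j. \<Sum>b\<in>B. g b j *\<^sub>R v b)
      (\<lambda>\<mu> l. of_bool (\<forall>j\<in>J. \<mu> j \<ge> 0) * c' \<mu> l) k \<phi>"
proof -
  let ?A = "Pi\<^sub>E B (\<lambda>_. UNIV :: int set)"
  define M where "M = {\<mu> \<in> ?A. (\<forall>j\<in>J. \<mu> j \<ge> 0) \<and> (\<forall>b\<in>B. \<Phi> \<mu> (int k) b \<in> \<int>)}"
  define h where "h = (\<lambda>\<mu>. \<lambda>b\<in>B. \<lfloor>\<Phi> \<mu> (int k) b\<rfloor>)"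
  have h: "real_of_int (h \<mu> b) = \<Phi> \<mu> (int k) b" if "\<mu> \<in> M" "b \<in> B" for \<mu> b
    using that by (auto simp: M_def h_def)
  have "inj_on h M"
  proof (rule inj_onI)
    fix \<mu> \<nu> assume \<mu>: "\<mu> \<in> M" "\<nu> \<in> M" "h \<mu> = h \<nu>"
    have "(\<Sum>j\<in>B. g b j * (real_of_int (\<mu> j) - real_of_int (\<nu> j))) = 0" if "b \<in> B" for b
      using h[OF \<mu>(1) that] h[OF \<mu>(2) that] \<mu>(3) by (simp add: \<Phi>_def right_diff_distrib sum_subtractf)
    then have "real_of_int (\<mu> j) - real_of_int (\<nu> j) = 0" if "j \<in> B" for j
      by (rule inj[where y = "\<lambda>j. real_of_int (\<mu> j) - real_of_int (\<nu> j)"]) (use that in auto)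
    then show "\<mu> = \<nu>"
      using \<mu>(1,2) by (intro extensionalityI[of _ B]) (auto simp: M_def PiE_def)
  qed
  moreover have "h ` M = {n \<in> ?A. cone_region B J g g0 n (int k)}"
  proof (intro equalityI subsetI)
    fix n assume "n \<in> h ` M"
    then obtain \<mu> where "\<mu> \<in> M" "n = h \<mu>" by auto
    then show "n \<in> {n \<in> ?A. cone_region B J g g0 n (int k)}"
      using h[of \<mu>] unfolding cone_region_def by (auto simp: M_def h_def \<Phi>_def intro!: exI[of _ \<mu>])
  next
    fix n assume "n \<in> {n \<in> ?A. cone_region B J g g0 n (int k)}"
    then obtain \<mu> where \<mu>: "\<forall>j\<in>J. \<mu> j \<ge> 0" "\<And>b. b \<in> B \<Longrightarrow> real_of_int (n b) = \<Phi> \<mu> (int k) b" and n: "n \<in> ?A"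
      unfolding cone_region_def \<Phi>_def by auto
    have eq: "\<Phi> (restrict \<mu> B) (int k) b = \<Phi> \<mu> (int k) b" for b
      unfolding \<Phi>_def by (simp cong: sum.cong)
    have "restrict \<mu> B \<in> M"
      using \<mu> J by (auto simp: M_def eq \<mu>(2)[symmetric])
    moreover have "h (restrict \<mu> B) = n"
      using n by (intro extensionalityI[of _ B]) (auto simp: h_def eq \<mu>(2)[symmetric] PiE_def)
    ultimately show "n \<in> h ` M" by auto
  qed
  ultimately have bij: "bij_betw h M {n \<in> ?A. cone_region B J g g0 n (int k)}"
    by (simp add: bij_betw_def)
  have pt: "affine_map B \<alpha> v (\<lambda>b. of_int (h \<mu> b) / real k) = affine_map B (\<alpha> + (\<Sum>b\<in>B. g0 b *\<^sub>R v b))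
      (\<lambda>j. \<Sum>b\<in>B. g b j *\<^sub>R v b) (\<lambda>b. of_int (\<mu> b) / real k)" if "\<mu> \<in> M" for \<mu>
  proof -
    have "(\<Sum>b\<in>B. (of_int (h \<mu> b) / real k) *\<^sub>R v b) =
        (\<Sum>b\<in>B. ((\<Sum>j\<in>B. g b j * (real_of_int (\<mu> j) / k)) + g0 b) *\<^sub>R v b)"
      using k by (intro sum.cong refl) (simp add: h[OF that] \<Phi>_def add_divide_distrib sum_divide_distrib)
    also have "\<dots> = (\<Sum>b\<in>B. g0 b *\<^sub>R v b) + (\<Sum>b\<in>B. \<Sum>j\<in>B. (real_of_int (\<mu> j) / k) *\<^sub>R g b j *\<^sub>R v b)"
      by (simp add: scaleR_add_left sum.distrib scaleR_left.sum mult_ac add.commute)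
    also have "(\<Sum>b\<in>B. \<Sum>j\<in>B. (real_of_int (\<mu> j) / k) *\<^sub>R g b j *\<^sub>R v b) =
        (\<Sum>j\<in>B. (real_of_int (\<mu> j) / k) *\<^sub>R (\<Sum>b\<in>B. g b j *\<^sub>R v b))"
      by (subst sum.swap) (simp add: scaleR_sum_right)
    finally show ?thesis by (simp add: affine_map_def)
  qed
  have "weighted_sum B \<alpha> v (\<lambda>n l. of_bool (cone_region B J g g0 n l) * c n l) k \<phi> =
      infsum (\<lambda>n. c n (int k) * \<phi> (affine_map B \<alpha> v (\<lambda>b. of_int (n b) / real k))) {n \<in> ?A. cone_region B J g g0 n (int k)}"
    unfolding weighted_sum_def by (intro infsum_cong_neutral) auto
  also have "\<dots> = infsum (\<lambda>\<mu>. c (h \<mu>) (int k) * \<phi> (affine_map B \<alpha> v (\<lambda>b. of_int (h \<mu> b) / real k))) M"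
    by (rule infsum_reindex_bij_betw[OF bij, symmetric])
  also have "\<dots> = weighted_sum B (\<alpha> + (\<Sum>b\<in>B. g0 b *\<^sub>R v b)) (\<lambda>j. \<Sum>b\<in>B. g b j *\<^sub>R v b)
      (\<lambda>\<mu> l. of_bool (\<forall>j\<in>J. \<mu> j \<ge> 0) * c' \<mu> l) k \<phi>"
    unfolding weighted_sum_def
  proof (rule infsum_cong_neutral)
    fix \<mu> assume "\<mu> \<in> M \<inter> ?A"
    then have \<mu>: "\<mu> \<in> M" by simp
    have "c (h \<mu>) (int k) = c (\<lambda>b. \<lfloor>\<Phi> \<mu> (int k) b\<rfloor>) (int k)"
      using c unfolding periodic_coeff_def by (auto simp: h_def)
    then show "c (h \<mu>) (int k) * \<phi> (affine_map B \<alpha> v (\<lambda>b. of_int (h \<mu> b) / real k)) =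
        of_bool (\<forall>j\<in>J. \<mu> j \<ge> 0) * c' \<mu> (int k) * \<phi> (affine_map B (\<alpha> + (\<Sum>b\<in>B. g0 b *\<^sub>R v b))
          (\<lambda>j. \<Sum>b\<in>B. g b j *\<^sub>R v b) (\<lambda>b. of_int (\<mu> b) / real k))"
      using \<mu> by (simp add: pt[OF \<mu>] c'_def M_def)
  qed (auto simp: M_def c'_def)
  finally show ?thesis .
qed

lemma (in orthant_sum) expands_lattice_mean: "expands lattice_mean (\<lambda>n k. orthant_term n)"
  unfolding expands_def
  using lattice_mean_expansion distribution_orthant_term by (auto intro: exI[of _ 1])

lemma periodic_coeffD:
  assumes "periodic_coeff B D c" "\<And>b. b \<in> B \<Longrightarrow> n b mod D = n' b mod D" "k mod D = k' mod D"
  shows "c n k = c n' k'"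
  using assms unfolding periodic_coeff_def by blast

lemma common_denominator:
  assumes "finite A" "A \<subseteq> (\<rat> :: real set)"
  shows "\<exists>E::int. E > 0 \<and> (\<forall>x\<in>A. of_int E * x \<in> \<int>)"
  using assms
proof (induction A rule: finite_induct)
  case empty
  show ?case by (intro exI[of _ 1]) auto
next
  case (insert x A)
  then obtain E :: int where E: "E > 0" "\<And>x. x \<in> A \<Longrightarrow> of_int E * x \<in> \<int>" by auto
  from insert.prems have "x \<in> \<rat>" by simp
  then obtain a b where ab: "b > 0" "x = of_int a / of_int b"
    by (rule Rats_cases') auto
  have "of_int (b * E) * y \<in> \<int>" if "y \<in> insert x A" for y
  proof (cases "y = x")
    case True
    then have "of_int (b * E) * y = of_int (E * a)" using ab by simp
    then show ?thesis by (metis Ints_of_int)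
  next
    case False
    then have "of_int b * (of_int E * y) \<in> \<int>"
      using that False by (intro Ints_mult[OF Ints_of_int] E(2)) auto
    moreover have "of_int (b * E) * y = of_int b * (of_int E * y)" by simp
    ultimately show ?thesis by (simp only:)
  qed
  then show ?case using ab(1) E(1) by (intro exI[of _ "b * E"]) simp
qed

text \<open>On the class \<open>\<mu> = r + D * \<nu>\<close> the coefficient does not depend on
  \<open>\<nu>\<close>, and the sum over \<open>\<nu>\<close> is an orthant sum with directions
  \<open>D v\<close> and relative position \<open>r / D\<close>.\<close>

lemma expands_orthant:
  fixes v :: "'b \<Rightarrow> 'a::euclidean_space"
  assumes B: "finite B" "independent_family B v" and J: "J \<subseteq> B" and c: "periodic_coeff B D c"
  shows "\<exists>\<theta>. expands (\<lambda>k \<phi>. weighted_sum B \<alpha> v (\<lambda>\<mu> l. of_bool (\<forall>j\<in>J. \<mu> j \<ge> 0) * c \<mu> l) k \<phi> / of_nat k ^ card B) \<theta>"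
proof -
  have D: "D > 0" using c by (simp add: periodic_coeff_def)
  define R where "R = Pi\<^sub>E B (\<lambda>_. {0..<D})"
  define u where "u = (\<lambda>b. real_of_int D *\<^sub>R v b)"
  define \<rho> where "\<rho> = (\<lambda>r (b::'b). real_of_int (r b) / real_of_int D)"
  have fin: "finite R" using B(1) by (auto simp: R_def intro: finite_PiE)
  have os: "orthant_sum B J u (\<rho> r)" if "r \<in> R" for r
  proof
    show "independent_family B u"
      unfolding independent_family_def
    proof (intro allI impI)
      fix t assume "(\<Sum>b\<in>B. t b *\<^sub>R u b) = 0"
      then have "(\<Sum>b\<in>B. (t b * D) *\<^sub>R v b) = 0" by (simp add: u_def)
      then have "\<forall>b\<in>B. t b * D = 0"
        using B(2)[unfolded independent_family_def, rule_format, of "\<lambda>b. t b * D"] by blast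
      then show "\<forall>b\<in>B. t b = 0" using D by auto
    qed
    show "\<rho> r b \<in> {0..1}" if "b \<in> B" for b
    proof -
      have "0 \<le> r b" "r b \<le> D" using \<open>r \<in> R\<close> that by (auto simp: R_def PiE_iff intro: less_imp_le)
      then show ?thesis using D by (auto simp: \<rho>_def)
    qed
  qed (use B J in auto)
  define lm where "lm = (\<lambda>r. orthant_sum.lattice_mean B J \<alpha> u (\<rho> r))"
  have "expands (\<lambda>k \<phi>. \<Sum>r\<in>R. c r (int k) * lm r k \<phi>)
      (\<lambda>n k \<phi>. \<Sum>r\<in>R. c r k * orthant_sum.orthant_term B J \<alpha> u (\<rho> r) n \<phi>)"
    unfolding lm_def
    using c by (intro expands_sum fin expands_mult_mod[OF _ D] orthant_sum.expands_lattice_mean os)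
      (auto simp: periodic_coeff_def)
  moreover have "weighted_sum B \<alpha> v (\<lambda>\<mu> l. of_bool (\<forall>j\<in>J. \<mu> j \<ge> 0) * c \<mu> l) k \<phi> / of_nat k ^ card B =
      (\<Sum>r\<in>R. c r (int k) * lm r k \<phi>)" if k: "k > 0" and \<phi>: "test_function \<phi>" for k \<phi>
  proof -
    have "(\<Sum>\<^sub>\<infinity>\<nu>\<in>Pi\<^sub>E B (\<lambda>_. UNIV). of_bool (\<forall>j\<in>J. (\<lambda>b\<in>B. r b + D * \<nu> b) j \<ge> 0) * c (\<lambda>b\<in>B. r b + D * \<nu> b) (int k) *
        \<phi> (affine_map B \<alpha> v (\<lambda>b. (of_int (r b) + of_int D * of_int (\<nu> b)) / real k))) =
        of_nat k ^ card B * (c r (int k) * lm r k \<phi>)" if r: "r \<in> R" for r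
    proof -
      interpret orthant_sum B J \<alpha> u "\<rho> r" by (rule os[OF r])
      \<comment> \<open>Because \<open>0 <= r j < D\<close>, nonnegativity of
        \<open>r j + D * \<nu> j\<close> is nonnegativity of \<open>\<nu> j\<close>: every residue
        class sees the same orthant.\<close>
      have sgn: "(\<lambda>b\<in>B. r b + D * \<nu> b) j \<ge> 0 \<longleftrightarrow> \<nu> j \<ge> 0" if "j \<in> J" for \<nu> :: "'b \<Rightarrow> int" and j
      proof -
        have *: "0 \<le> r j" "r j < D" "j \<in> B" using r that J by (auto simp: R_def PiE_iff)
        have "r j + D * \<nu> j < 0" if "\<nu> j < 0"
        proof -
          have "D * \<nu> j \<le> D * (-1)" using that D by (intro mult_left_mono) auto
          then show ?thesis using * by linarith
        qed
        moreover have "r j + D * \<nu> j \<ge> 0" if "\<nu> j \<ge> 0" using that * D by simp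
        ultimately show ?thesis using * by force
      qed
      have sgn_all: "(\<forall>j\<in>J. (\<lambda>b\<in>B. r b + D * \<nu> b) j \<ge> 0) \<longleftrightarrow> (\<forall>j\<in>J. \<nu> j \<ge> 0)" for \<nu> :: "'b \<Rightarrow> int"
        using sgn by blast
      have cr: "c (\<lambda>b\<in>B. r b + D * \<nu> b) (int k) = c r (int k)" for \<nu>
        by (rule periodic_coeffD[OF c]) auto
      have node: "affine_map B \<alpha> v (\<lambda>b. (of_int (r b) + of_int D * of_int (\<nu> b)) / real k) = node k \<nu>" for \<nu>
        unfolding node_def unfolding affine_map_def u_def \<rho>_def
        using D k by (intro arg_cong2[of _ _ _ _ "(+)"] sum.cong refl) (simp add: field_simps)
      have "(\<Sum>\<^sub>\<infinity>\<nu>\<in>Pi\<^sub>E B (\<lambda>_. UNIV). of_bool (\<forall>j\<in>J. (\<lambda>b\<in>B. r b + D * \<nu> b) j \<ge> 0) * c (\<lambda>b\<in>B. r b + D * \<nu> b) (int k) *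
          \<phi> (affine_map B \<alpha> v (\<lambda>b. (of_int (r b) + of_int D * of_int (\<nu> b)) / real k))) =
          (\<Sum>\<^sub>\<infinity>\<nu>\<in>{\<nu> \<in> Pi\<^sub>E B (\<lambda>_. UNIV). \<forall>j\<in>J. \<nu> j \<ge> 0}. c r (int k) * \<phi> (node k \<nu>))"
        unfolding cr node sgn_all by (intro infsum_cong_neutral) auto
      also have "\<dots> = c r (int k) * (\<Sum>\<^sub>\<infinity>\<nu>\<in>{\<nu> \<in> Pi\<^sub>E B (\<lambda>_. UNIV). \<forall>j\<in>J. \<nu> j \<ge> 0}. \<phi> (node k \<nu>))"
        by (rule infsum_cmult_right')
      also have "(\<Sum>\<^sub>\<infinity>\<nu>\<in>{\<nu> \<in> Pi\<^sub>E B (\<lambda>_. UNIV). \<forall>j\<in>J. \<nu> j \<ge> 0}. \<phi> (node k \<nu>)) = of_nat k ^ card B * lm r k \<phi>"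
        using k by (simp add: lm_def lattice_mean_def)
      finally show ?thesis by (simp only: mult.left_commute)
    qed
    then have "weighted_sum B \<alpha> v (\<lambda>\<mu> l. of_bool (\<forall>j\<in>J. \<mu> j \<ge> 0) * c \<mu> l) k \<phi> =
        (\<Sum>r\<in>R. of_nat k ^ card B * (c r (int k) * lm r k \<phi>))"
      unfolding weighted_sum_residues[OF B \<phi> k D] R_def[symmetric] by (intro sum.cong) auto
    then show ?thesis using k by (simp add: sum_distrib_left[symmetric])
  qed
  ultimately show ?thesis by (blast intro: expands_cong)
qed

theorem expands_conic:
  fixes v :: "'b \<Rightarrow> 'a::euclidean_space"
  assumes "conic B s" and B: "finite B" "independent_family B v" and c: "periodic_coeff B D c"
  shows "\<exists>\<theta>. expands (\<lambda>k \<phi>. weighted_sum B \<alpha> v (\<lambda>n l. s n l * c n l) k \<phi> / of_nat k ^ card B) \<theta>"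
  using assms(1)
proof induction
  case (cone J g g0)
  define u where "u = (\<lambda>j. \<Sum>b\<in>B. g b j *\<^sub>R v b)"
  define \<beta> where "\<beta> = \<alpha> + (\<Sum>b\<in>B. g0 b *\<^sub>R v b)"
  define \<Phi> where "\<Phi> = (\<lambda>\<mu> l b. (\<Sum>j\<in>B. g b j * real_of_int (\<mu> j)) + g0 b * real_of_int l)"
  define c' where "c' = (\<lambda>\<mu> l. if \<forall>b\<in>B. \<Phi> \<mu> l b \<in> \<int> then c (\<lambda>b. \<lfloor>\<Phi> \<mu> l b\<rfloor>) l else 0)"
  have u: "independent_family B u"
    unfolding independent_family_def
  proof (intro allI impI)
    fix t assume "(\<Sum>j\<in>B. t j *\<^sub>R u j) = 0"
    then have "(\<Sum>b\<in>B. (\<Sum>j\<in>B. g b j * t j) *\<^sub>R v b) = 0"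
      unfolding u_def scaleR_sum_right
      by (subst (asm) sum.swap) (simp add: scaleR_left.sum mult.commute)
    then have "\<forall>b\<in>B. (\<Sum>j\<in>B. g b j * t j) = 0"
      using B(2)[unfolded independent_family_def, rule_format, of "\<lambda>b. \<Sum>j\<in>B. g b j * t j"] by blast
    then show "\<forall>j\<in>B. t j = 0" using cone(4) by blast
  qed
  let ?A = "(\<lambda>(b, j). g b j) ` (B \<times> B) \<union> g0 ` B"
  have A: "finite ?A" "?A \<subseteq> \<rat>" using B(1) cone by auto
  \<comment> \<open>\<open>E\<close> clears the denominators of \<open>g\<close> and
    \<open>g0\<close>. Moving \<open>\<mu>\<close> and \<open>k\<close> by multiples of
    \<open>E * D\<close> then moves the image by multiples of \<open>D\<close>, which changes
    neither integrality nor the residues seen by \<open>c\<close>.\<close>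
  obtain E :: int where E: "E > 0" "\<And>x. x \<in> ?A \<Longrightarrow> of_int E * x \<in> \<int>"
    using common_denominator[OF A] by blast
  have Eg: "of_int E * g b j \<in> \<int>" if "b \<in> B" "j \<in> B" for b j
    using that by (intro E(2)) auto
  have Eg0: "of_int E * g0 b \<in> \<int>" if "b \<in> B" for b
    using that by (intro E(2)) auto
  have D: "D > 0" using c by (simp add: periodic_coeff_def)
  have c': "periodic_coeff B (E * D) c'"
    unfolding periodic_coeff_def
  proof (intro conjI allI impI)
    fix \<mu> \<nu> :: "'b \<Rightarrow> int" and k l :: int
    assume \<mu>\<nu>: "\<forall>b\<in>B. \<mu> b mod (E * D) = \<nu> b mod (E * D)" and kl: "k mod (E * D) = l mod (E * D)"
    have diff: "\<exists>m::int. \<Phi> \<mu> k b = \<Phi> \<nu> l b + of_int (D * m)" if b: "b \<in> B" for b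
    proof -
      define x where "x = (\<lambda>j. (\<mu> j - \<nu> j) div (E * D))"
      define y where "y = (k - l) div (E * D)"
      have x: "\<mu> j - \<nu> j = E * D * x j" if "j \<in> B" for j
        using \<mu>\<nu> that unfolding x_def by (simp add: mod_eq_dvd_iff)
      have y: "k - l = E * D * y"
        using kl unfolding y_def by (simp add: mod_eq_dvd_iff)
      have "(\<Sum>j\<in>B. (of_int E * g b j) * of_int (x j)) + (of_int E * g0 b) * of_int y \<in> \<int>"
        by (intro Ints_add Ints_sum Ints_mult[OF Eg[OF b]] Ints_mult[OF Eg0[OF b]] Ints_of_int)
      then obtain m :: int where m: "(\<Sum>j\<in>B. (of_int E * g b j) * of_int (x j)) + (of_int E * g0 b) * of_int y = of_int m"
        by (rule Ints_cases)
      have "\<Phi> \<mu> k b - \<Phi> \<nu> l b = (\<Sum>j\<in>B. g b j * of_int (\<mu> j - \<nu> j)) + g0 b * of_int (k - l)"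
        by (simp add: \<Phi>_def right_diff_distrib sum_subtractf)
      also have "\<dots> = of_int D * ((\<Sum>j\<in>B. (of_int E * g b j) * of_int (x j)) + (of_int E * g0 b) * of_int y)"
        by (simp add: x y distrib_left sum_distrib_left mult_ac cong: sum.cong)
      finally show ?thesis unfolding m by (intro exI[of _ m]) simp
    qed
    then obtain m where m: "\<And>b. b \<in> B \<Longrightarrow> \<Phi> \<mu> k b = \<Phi> \<nu> l b + of_int (D * m b)" by metis
    have int: "(\<Phi> \<mu> k b \<in> \<int>) = (\<Phi> \<nu> l b \<in> \<int>)" if "b \<in> B" for b
      unfolding m[OF that] by simp
    have "k mod D = l mod D"
      using kl by (metis mod_mod_cancel dvd_triv_right)
    moreover have "\<lfloor>\<Phi> \<mu> k b\<rfloor> mod D = \<lfloor>\<Phi> \<nu> l b\<rfloor> mod D" if "b \<in> B" for b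
      unfolding m[OF that] by (simp del: of_int_mult)
    ultimately have "c (\<lambda>b. \<lfloor>\<Phi> \<mu> k b\<rfloor>) k = c (\<lambda>b. \<lfloor>\<Phi> \<nu> l b\<rfloor>) l"
      by (intro periodic_coeffD[OF c])
    then show "c' \<mu> k = c' \<nu> l"
      using int by (auto simp: c'_def)
  qed (use E D in auto)
  obtain \<theta> where \<theta>: "expands (\<lambda>k \<phi>. weighted_sum B \<beta> u (\<lambda>\<mu> l. of_bool (\<forall>j\<in>J. \<mu> j \<ge> 0) * c' \<mu> l) k \<phi> / of_nat k ^ card B) \<theta>"
    using expands_orthant[OF B(1) u cone(1) c'] by blast
  have "weighted_sum B \<alpha> v (\<lambda>n l. of_bool (cone_region B J g g0 n l) * c n l) k \<phi> =
      weighted_sum B \<beta> u (\<lambda>\<mu> l. of_bool (\<forall>j\<in>J. \<mu> j \<ge> 0) * c' \<mu> l) k \<phi>" if "k > 0" for k \<phi>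
    unfolding \<beta>_def u_def c'_def \<Phi>_def
  proof (rule weighted_sum_cone[OF _ cone(1) B(1) that c])
    show "y j = 0" if "\<And>b. b \<in> B \<Longrightarrow> (\<Sum>j\<in>B. g b j * y j) = 0" "j \<in> B" for y j
      using that by (rule cone(4))
  qed
  then show ?case using \<theta> by (intro exI[of _ \<theta>] expands_cong[OF \<theta>]) simp
next
  case (add s t)
  then obtain \<theta> \<eta> where 1: "expands (\<lambda>k \<phi>. weighted_sum B \<alpha> v (\<lambda>n l. s n l * c n l) k \<phi> / of_nat k ^ card B) \<theta>"
    and 2: "expands (\<lambda>k \<phi>. weighted_sum B \<alpha> v (\<lambda>n l. t n l * c n l) k \<phi> / of_nat k ^ card B) \<eta>"
    by blast
  have "weighted_sum B \<alpha> v (\<lambda>n l. (s n l + t n l) * c n l) k \<phi> =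
      weighted_sum B \<alpha> v (\<lambda>n l. s n l * c n l) k \<phi> + weighted_sum B \<alpha> v (\<lambda>n l. t n l * c n l) k \<phi>"
    if "k > 0" "test_function \<phi>" for k \<phi>
    unfolding weighted_sum_def distrib_right
    by (intro infsum_add weighted_sum_summable[OF B that(2,1)])
  then have "expands (\<lambda>k \<phi>. weighted_sum B \<alpha> v (\<lambda>n l. (s n l + t n l) * c n l) k \<phi> / of_nat k ^ card B)
      (\<lambda>n k \<phi>. \<theta> n k \<phi> + \<eta> n k \<phi>)"
    by (intro expands_cong[OF expands_add[OF 1 2]]) (simp add: add_divide_distrib)
  then show ?case by blast
next
  case (cmult s x)
  then obtain \<theta> where \<theta>: "expands (\<lambda>k \<phi>. weighted_sum B \<alpha> v (\<lambda>n l. s n l * c n l) k \<phi> / of_nat k ^ card B) \<theta>"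
    by blast
  have "weighted_sum B \<alpha> v (\<lambda>n l. x * s n l * c n l) k \<phi> = x * weighted_sum B \<alpha> v (\<lambda>n l. s n l * c n l) k \<phi>" for k \<phi>
    unfolding weighted_sum_def infsum_cmult_right'[symmetric] by (simp add: mult.assoc)
  then have "expands (\<lambda>k \<phi>. weighted_sum B \<alpha> v (\<lambda>n l. x * s n l * c n l) k \<phi> / of_nat k ^ card B)
      (\<lambda>n k \<phi>. x * \<theta> n k \<phi>)"
    by (intro expands_cong[OF expands_mult_mod[OF \<theta>, of 1 "\<lambda>_. x"]]) simp_all
  then show ?case by blast
next
  case (cong s t)
  then obtain \<theta> where \<theta>: "expands (\<lambda>k \<phi>. weighted_sum B \<alpha> v (\<lambda>n l. s n l * c n l) k \<phi> / of_nat k ^ card B) \<theta>"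
    by blast
  have "weighted_sum B \<alpha> v (\<lambda>n l. t n l * c n l) k \<phi> = weighted_sum B \<alpha> v (\<lambda>n l. s n l * c n l) k \<phi>" if "k > 0" for k \<phi>
    unfolding weighted_sum_def using cong(2) that by (intro infsum_cong) simp
  then show ?case by (intro exI[of _ \<theta>] expands_cong[OF \<theta>]) simp
qed

section \<open>The leading term\<close>

text \<open>The dehomogenization of the integral forms at scale 1, on real points.\<close>

definition forms_region :: "'b set \<Rightarrow> (('b \<Rightarrow> int) \<times> int) list \<Rightarrow> ('b \<Rightarrow> real) \<Rightarrow> bool" where
  "forms_region B fs t \<longleftrightarrow> (\<forall>f\<in>set fs. (\<Sum>b\<in>B. of_int (fst f b) * t b) + of_int (snd f) \<ge> 0)"

lemma forms_indicator_region:
  assumes "k > 0"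
  shows "forms_indicator B fs n (int k) = of_bool (forms_region B fs (\<lambda>b. of_int (n b) / real k))"
proof -
  have "form_val B f n (int k) \<ge> 0 \<longleftrightarrow> (\<Sum>b\<in>B. of_int (fst f b) * (of_int (n b) / real k)) + of_int (snd f) \<ge> (0::real)" for f
  proof -
    have "real k * (\<Sum>b\<in>B. of_int (fst f b) * (of_int (n b) / real k)) = (\<Sum>b\<in>B. of_int (fst f b) * of_int (n b))"
      unfolding sum_distrib_left using assms by (intro sum.cong refl) simp
    then have "real_of_int (form_val B f n (int k)) = real k * ((\<Sum>b\<in>B. of_int (fst f b) * (of_int (n b) / real k)) + of_int (snd f))"
      by (simp add: form_val_def distrib_left mult.commute)
    then show ?thesis
      using assms by (simp add: zero_le_mult_iff flip: of_int_0_le_iff[where 'a = real])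
  qed
  then show ?thesis by (simp add: forms_indicator_def forms_region_def)
qed

text \<open>By Fubini in the coordinate \<open>b\<close>: each line parallel to it meets the
  hyperplane in a single point.\<close>

lemma AE_hyperplane:
  fixes w :: "'b \<Rightarrow> real"
  assumes "finite B" "b \<in> B" "w b \<noteq> 0"
  shows "AE t in lborel_PiM B. (\<Sum>b\<in>B. w b * t b) + x \<noteq> 0"
proof -
  define A where "A = B - {b}"
  have B: "B = insert b A" "b \<notin> A" "finite A" using assms by (auto simp: A_def)
  have meas: "(\<lambda>t. (\<Sum>b\<in>B. w b * t b) + x) \<in> borel_measurable (lborel_PiM B)"
    by measurable
  define N where "N = {t \<in> space (lborel_PiM B). (\<Sum>b\<in>B. w b * t b) + x = 0}"
  have N: "N \<in> sets (lborel_PiM B)"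
    unfolding N_def using meas by (simp add: borel_measurable_eq)
  have "emeasure (lborel_PiM B) N = (\<integral>\<^sup>+t. indicator N t \<partial>lborel_PiM (insert b A))"
    using N B(1) by (simp add: nn_integral_indicator)
  also have "\<dots> = (\<integral>\<^sup>+s. (\<integral>\<^sup>+y. indicator N (s(b := y)) \<partial>lborel) \<partial>lborel_PiM A)"
    using N B by (intro lborel_prod.product_nn_integral_insert) auto
  also have "\<dots> = (\<integral>\<^sup>+s. 0 \<partial>lborel_PiM A)"
  proof (rule nn_integral_cong)
    fix s
    have "(\<integral>\<^sup>+y. indicator N (s(b := y)) \<partial>lborel) \<le> (\<integral>\<^sup>+y. indicator {- ((\<Sum>c\<in>A. w c * s c) + x) / w b} y \<partial>lborel)"
    proof (rule nn_integral_mono)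
      fix y
      have "y = - ((\<Sum>c\<in>A. w c * s c) + x) / w b" if "s(b := y) \<in> N"
      proof -
        have "(\<Sum>c\<in>A. w c * (s(b := y)) c) = (\<Sum>c\<in>A. w c * s c)"
          using B(2) by (intro sum.cong) auto
        then have "w b * y + (\<Sum>c\<in>A. w c * s c) + x = 0"
          using that B by (simp add: N_def)
        then show ?thesis using assms(3) by (simp add: field_simps eq_neg_iff_add_eq_0)
      qed
      then show "indicator N (s(b := y)) \<le> (indicator {- ((\<Sum>c\<in>A. w c * s c) + x) / w b} y :: ennreal)"
        by (auto simp: indicator_def)
    qed
    also have "\<dots> = 0" by (subst nn_integral_indicator) auto
    finally show "(\<integral>\<^sup>+y. indicator N (s(b := y)) \<partial>lborel) = 0" by simp
  qed
  finally have "N \<in> null_sets (lborel_PiM B)" using N by (auto simp: null_sets_def)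
  then show ?thesis by (rule AE_I') (auto simp: N_def)
qed

lemma integrable_forms_region:
  fixes v :: "'b \<Rightarrow> 'a::euclidean_space"
  assumes B: "finite B" "independent_family B v" and \<phi>: "test_function \<phi>"
  shows "integrable (lborel_PiM B) (\<lambda>t. of_bool (forms_region B fs t) * \<phi> (affine_map B \<alpha> v t))"
  unfolding forms_region_def
  by (intro integrable_test_function B \<phi> pred_intros_finite) auto

text \<open>The sum is the integral of a step function on cells of side \<open>D / k l\<close>, so
  dominated convergence applies. The step functions converge off the hyperplanes that bound the
  region, and these are null sets.\<close>

lemma Riemann_sum_tendsto:
  fixes v :: "'b \<Rightarrow> 'a::euclidean_space" and k :: "nat \<Rightarrow> nat"
  assumes B: "finite B" "independent_family B v" and \<phi>: "test_function \<phi>" and D: "D > 0"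
    and r: "r \<in> Pi\<^sub>E B (\<lambda>_. {0..<D})" and k: "\<And>l. k l > 0" "filterlim k at_top sequentially"
  shows "(\<lambda>l. (\<Sum>\<^sub>\<infinity>\<nu>\<in>Pi\<^sub>E B (\<lambda>_. UNIV).
      of_bool (forms_region B fs (\<lambda>b. (of_int (r b) + of_int D * of_int (\<nu> b)) / real (k l))) *
      \<phi> (affine_map B \<alpha> v (\<lambda>b. (of_int (r b) + of_int D * of_int (\<nu> b)) / real (k l))))
      * of_real ((of_int D / real (k l)) ^ card B))
    \<longlonglongrightarrow> (\<integral>t. of_bool (forms_region B fs t) * \<phi> (affine_map B \<alpha> v t) \<partial>lborel_PiM B)"
proof -
  define F where "F = (\<lambda>t. of_bool (forms_region B fs t) * \<phi> (affine_map B \<alpha> v t))"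
  define p where "p = (\<lambda>l (\<nu>::'b \<Rightarrow> int) b. (of_int (r b) + of_int D * of_int (\<nu> b)) / real (k l))"
  define y where "y = (\<lambda>l t. \<lambda>b\<in>B. \<lfloor>t b / (of_int D / real (k l))\<rfloor>)"
  obtain C where C: "\<And>x. norm (\<phi> x) \<le> C" "C \<ge> 0" using test_function_bounded[OF \<phi>] by blast
  have cont: "continuous_on UNIV \<phi>" using \<phi> by (auto simp: test_function_def intro: smooth_continuous)
  obtain K where K: "compact K" "{x. \<phi> x \<noteq> 0} \<subseteq> K" using \<phi> unfolding test_function_altdef by auto
  obtain R where R: "R \<ge> 0" "\<And>t b. affine_map B \<alpha> v t \<in> K \<Longrightarrow> b \<in> B \<Longrightarrow> \<bar>t b\<bar> \<le> R"
    using affine_map_bounded[OF B compact_imp_bounded[OF K(1)]] by metis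
  \<comment> \<open>The point \<open>t\<close> and the sample point belong to the same closed
    cell.\<close>
  have cmp: "\<bar>p l (y l t) b - t b\<bar> \<le> of_int D / real (k l)" if "b \<in> B" for l t b
  proof -
    define h where "h = real_of_int D / real (k l)"
    have h: "h > 0" using D k by (simp add: h_def)
    have "p l (y l t) b - t b = real_of_int (r b) / real (k l) - h * frac (t b / h)"
    proof -
      have "t b = h * (of_int \<lfloor>t b / h\<rfloor> + frac (t b / h))" using h by (simp add: frac_def)
      then have "t b = h * of_int \<lfloor>t b / h\<rfloor> + h * frac (t b / h)" by (simp only: distrib_left)
      moreover have "p l (y l t) b = real_of_int (r b) / real (k l) + h * of_int \<lfloor>t b / h\<rfloor>"
        using that by (simp add: p_def y_def h_def add_divide_distrib)
      ultimately show ?thesis by linarith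
    qed
    moreover have "0 \<le> real_of_int (r b) / real (k l)" "real_of_int (r b) / real (k l) \<le> h"
    proof -
      have "0 \<le> r b" "r b \<le> D" using r that by (auto simp: PiE_iff intro: less_imp_le)
      then show "0 \<le> real_of_int (r b) / real (k l)" "real_of_int (r b) / real (k l) \<le> h"
        by (auto simp: h_def intro!: divide_right_mono)
    qed
    moreover have "0 \<le> h * frac (t b / h)" "h * frac (t b / h) \<le> h"
      using h frac_lt_1[of "t b / h"] mult_left_mono[of "frac (t b / h)" 1 h] by auto
    ultimately show ?thesis unfolding h_def[symmetric] by linarith
  qed
  \<comment> \<open>A bound independent of \<open>l\<close>, so that a single cube dominates all
    step functions.\<close>
  have hD: "of_int D / real (k l) \<le> of_int D" for l
    using D k(1)[of l] mult_left_mono[of 1 "real (k l)" "of_int D"] by (simp add: pos_divide_le_eq)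
  have box: "\<bar>t b\<bar> \<le> R + of_int D" if "F (p l (y l t)) \<noteq> 0" "b \<in> B" for l t b
  proof -
    have "affine_map B \<alpha> v (p l (y l t)) \<in> K" using that(1) K(2) by (auto simp: F_def)
    then have "\<bar>p l (y l t) b\<bar> \<le> R" using R(2) that(2) by blast
    then show ?thesis using cmp[OF that(2), of l t] hD[of l] by linarith
  qed
  have F_meas: "F \<in> borel_measurable (lborel_PiM B)"
    unfolding F_def by (rule borel_measurable_integrable[OF integrable_forms_region[OF B \<phi>]])
  have Fp_meas: "(\<lambda>t. F (p l (y l t))) \<in> borel_measurable (lborel_PiM B)" for l
  proof -
    have 1: "(\<lambda>t. \<lambda>b\<in>B. p l (y l t) b) \<in> measurable (lborel_PiM B) (lborel_PiM B)"
      unfolding p_def y_def by (rule measurable_restrict) auto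
    have "F (\<lambda>b\<in>B. x b) = F x" for x
      by (simp add: F_def forms_region_def affine_map_def cong: sum.cong)
    then show ?thesis using measurable_compose[OF 1 F_meas] by (simp only:)
  qed
  have sum_eq: "(\<integral>t. F (p l (y l t)) \<partial>lborel_PiM B) =
      (\<Sum>\<^sub>\<infinity>\<nu>\<in>Pi\<^sub>E B (\<lambda>_. UNIV). F (p l \<nu>)) * of_real ((of_int D / real (k l)) ^ card B)" for l
  proof -
    let ?h = "of_int D / real (k l)"
    define L where "L = \<lceil>(R + of_int D) / ?h\<rceil>"
    define S where "S = Pi\<^sub>E B (\<lambda>_. {-L..L})"
    have h: "?h > 0" using D k by simp
    have S: "F (p l \<nu>) = 0" if "\<nu> \<in> Pi\<^sub>E B (\<lambda>_. UNIV) - S" for \<nu>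
    proof (rule ccontr)
      assume nz: "F (p l \<nu>) \<noteq> 0"
      define t where "t = (\<lambda>b\<in>B. ?h * of_int (\<nu> b))"
      have "y l t = \<nu>" using that h by (auto simp: y_def t_def fun_eq_iff PiE_iff extensional_def)
      then have "\<bar>?h * of_int (\<nu> b)\<bar> \<le> R + of_int D" if "b \<in> B" for b
        using box[of l t b] nz that by (simp add: t_def)
      then have "\<bar>real_of_int (\<nu> b)\<bar> \<le> (R + of_int D) / ?h" if "b \<in> B" for b
        unfolding pos_le_divide_eq[OF h] using that h by (simp only: abs_mult abs_of_pos mult.commute)
      then have "\<bar>real_of_int (\<nu> b)\<bar> \<le> of_int L" if "b \<in> B" for b
        using that unfolding L_def by (meson le_of_int_ceiling order_trans)
      then have "\<nu> \<in> S" using \<open>\<nu> \<in> _ - S\<close> by (force simp: S_def PiE_iff abs_le_iff)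
      then show False using that by simp
    qed
    have "finite S" using B(1) by (auto simp: S_def intro: finite_PiE)
    moreover have "S \<subseteq> Pi\<^sub>E B (\<lambda>_. UNIV)" by (auto simp: S_def)
    ultimately have "(\<integral>t. F (p l (y l t)) * 1 \<partial>lborel_PiM B) = of_real (?h ^ card B) * (\<Sum>\<nu>\<in>S. F (p l \<nu>)) * 1"
      using integral_floor_frac[OF B(1) h, of S "\<lambda>\<nu>. F (p l \<nu>)" "\<lambda>_. 1" 1] S
        integral_unit_cube[OF B(1)] by (simp add: y_def)
    also have "(\<Sum>\<nu>\<in>S. F (p l \<nu>)) = (\<Sum>\<^sub>\<infinity>\<nu>\<in>Pi\<^sub>E B (\<lambda>_. UNIV). F (p l \<nu>))"
      unfolding infsum_finite[OF \<open>finite S\<close>, symmetric]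
      using S \<open>S \<subseteq> _\<close> by (intro infsum_cong_neutral) auto
    finally show ?thesis by simp
  qed
  have "(\<lambda>l. \<integral>t. F (p l (y l t)) \<partial>lborel_PiM B) \<longlonglongrightarrow> (\<integral>t. F t \<partial>lborel_PiM B)"
  proof (rule integral_dominated_convergence)
    let ?box = "Pi\<^sub>E B (\<lambda>_. {-(R + of_int D)..R + of_int D})"
    show "integrable (lborel_PiM B) (\<lambda>t. C * indicator ?box t)"
      using B(1) R(1) D emeasure_lborel_PiM_box[OF B(1), of "R + of_int D"]
      by (intro integrable_mult_right integrable_real_indicator) (auto intro!: sets_PiM_I_finite)
    show "AE t in lborel_PiM B. norm (F (p l (y l t))) \<le> C * indicator ?box t" for l
    proof (rule AE_I2)
      fix t assume "t \<in> space (lborel_PiM B)"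
      then have "t \<in> ?box" if "F (p l (y l t)) \<noteq> 0"
        using box[OF that] by (force simp: space_PiM PiE_iff abs_le_iff)
      moreover have "norm (F x) \<le> C" for x using C by (auto simp: F_def)
      ultimately show "norm (F (p l (y l t))) \<le> C * indicator ?box t"
        using C(2) by (cases "F (p l (y l t)) = 0") (auto simp: indicator_def)
    qed
    \<comment> \<open>A form whose coefficients on \<open>B\<close> all vanish is constant and
      bounds no hyperplane; its sign is the same at every point.\<close>
    have "AE t in lborel_PiM B. \<forall>f\<in>set fs. (\<exists>b\<in>B. fst f b \<noteq> 0) \<longrightarrow> (\<Sum>b\<in>B. of_int (fst f b) * t b) + of_int (snd f) \<noteq> (0::real)"
    proof (rule AE_finite_allI)
      show "AE t in lborel_PiM B. (\<exists>b\<in>B. fst f b \<noteq> 0) \<longrightarrow> (\<Sum>b\<in>B. of_int (fst f b) * t b) + of_int (snd f) \<noteq> (0::real)" for f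
        using AE_hyperplane[OF B(1), of _ "\<lambda>b. of_int (fst f b)" "of_int (snd f)"] by (cases "\<exists>b\<in>B. fst f b \<noteq> 0") auto
    qed simp
    then show "AE t in lborel_PiM B. (\<lambda>l. F (p l (y l t))) \<longlonglongrightarrow> F t"
    proof eventually_elim
      case (elim t)
      have lim0: "(\<lambda>l. real_of_int D / real (k l)) \<longlonglongrightarrow> 0"
        using k(2) by (intro tendsto_divide_0[OF tendsto_const]
            filterlim_at_top_imp_at_infinity filterlim_compose[OF filterlim_real_sequentially])
      have conv: "(\<lambda>l. p l (y l t) b) \<longlonglongrightarrow> t b" if "b \<in> B" for b
        by (rule LIM_zero_cancel, rule Lim_null_comparison[OF _ lim0])
          (use cmp[OF that] in \<open>auto intro: always_eventually\<close>)
      have 1: "(\<lambda>l. \<phi> (affine_map B \<alpha> v (p l (y l t)))) \<longlonglongrightarrow> \<phi> (affine_map B \<alpha> v t)"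
      proof (rule isCont_tendsto_compose[where g = \<phi>])
        show "isCont \<phi> (affine_map B \<alpha> v t)" using cont by (simp add: continuous_on_eq_continuous_at)
        show "(\<lambda>l. affine_map B \<alpha> v (p l (y l t))) \<longlonglongrightarrow> affine_map B \<alpha> v t"
          unfolding affine_map_def by (intro tendsto_intros conv)
      qed
      have "\<forall>\<^sub>F l in sequentially. ((\<Sum>b\<in>B. of_int (fst f b) * p l (y l t) b) + of_int (snd f) \<ge> (0::real)) =
          ((\<Sum>b\<in>B. of_int (fst f b) * t b) + of_int (snd f) \<ge> (0::real))" if f: "f \<in> set fs" for f
      proof (cases "\<exists>b\<in>B. fst f b \<noteq> 0")
        case True
        let ?g = "\<lambda>x. (\<Sum>b\<in>B. of_int (fst f b) * x b) + of_int (snd f) :: real"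
        have lim: "(\<lambda>l. ?g (p l (y l t))) \<longlonglongrightarrow> ?g t" by (intro tendsto_intros conv)
        have "?g t \<noteq> 0" using elim f True by blast
        then consider "?g t > 0" | "?g t < 0" by linarith
        then show ?thesis
        proof cases
          case 1
          show ?thesis using order_tendstoD(1)[OF lim 1] by eventually_elim (use 1 in auto)
        next
          case 2
          show ?thesis using order_tendstoD(2)[OF lim 2] by eventually_elim (use 2 in auto)
        qed
      qed auto
      then have "\<forall>\<^sub>F l in sequentially. \<forall>f\<in>set fs. ((\<Sum>b\<in>B. of_int (fst f b) * p l (y l t) b) + of_int (snd f) \<ge> (0::real)) =
          ((\<Sum>b\<in>B. of_int (fst f b) * t b) + of_int (snd f) \<ge> (0::real))"
        by (intro eventually_ball_finite) auto
      then have 2: "\<forall>\<^sub>F l in sequentially. of_bool (forms_region B fs t) = (of_bool (forms_region B fs (p l (y l t))) :: complex)"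
        by eventually_elim (auto simp: forms_region_def)
      show ?case
        unfolding F_def by (intro tendsto_mult 1 tendsto_eventually) (use 2 in \<open>auto elim: eventually_mono\<close>)
    qed
  qed (use F_meas Fp_meas in auto)
  then show ?thesis unfolding sum_eq by (simp add: F_def p_def)
qed

text \<open>\<open>\<theta> 0\<close> is a limit of the normalized sums themselves, hence
  independent of the cone decomposition behind \<open>\<theta>\<close>. Every residue class modulo
  \<open>D\<close> contributes the same integral, weighted by its coefficient.\<close>

theorem expands_leading_term:
  fixes v :: "'b \<Rightarrow> 'a::euclidean_space"
  assumes B: "finite B" "independent_family B v" and c: "periodic_coeff B D c"
    and \<theta>: "expands (\<lambda>k \<phi>. weighted_sum B \<alpha> v (\<lambda>n l. forms_indicator B fs n l * c n l) k \<phi> / of_nat k ^ card B) \<theta>"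
    and k: "k > 0" and \<phi>: "test_function \<phi>"
  shows "\<theta> 0 (int k) \<phi> = (\<Sum>r\<in>Pi\<^sub>E B (\<lambda>_. {0..<D}). c r (int k)) / of_int D ^ card B *
    (\<integral>t. of_bool (forms_region B fs t) * \<phi> (affine_map B \<alpha> v t) \<partial>lborel_PiM B)"
proof -
  let ?I = "\<integral>t. of_bool (forms_region B fs t) * \<phi> (affine_map B \<alpha> v t) \<partial>lborel_PiM B"
  let ?S = "\<lambda>k. weighted_sum B \<alpha> v (\<lambda>n l. forms_indicator B fs n l * c n l) k \<phi> / of_nat k ^ card B"
  let ?R = "Pi\<^sub>E B (\<lambda>_. {0..<D})"
  have D: "D > 0" using c by (simp add: periodic_coeff_def)
  obtain E where E: "E > 0" "\<And>n k k'. k mod E = k' mod E \<Longrightarrow> \<theta> n k = \<theta> n k'"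
    using \<theta> unfolding expands_def by metis
  \<comment> \<open>Steps of \<open>E * D\<close> fix the residue of the scale modulo the period of
    \<open>\<theta>\<close> and that of \<open>c\<close>, while the scale tends to infinity.\<close>
  define K where "K = (\<lambda>l. k + nat (E * D) * l)"
  have K: "K l > 0" for l using k by (simp add: K_def)
  have intK: "int (K l) = int k + E * D * int l" for l using E D by (simp add: K_def)
  have K_lim: "filterlim K at_top sequentially"
    unfolding filterlim_at_top
  proof
    fix Z
    show "\<forall>\<^sub>F l in sequentially. Z \<le> K l"
    proof (rule eventually_sequentiallyI[of Z])
      fix l assume "Z \<le> l"
      also have "l \<le> nat (E * D) * l"
      proof -
        have "E * D > 0" using E D by simp
        then have "1 \<le> nat (E * D)" by linarith
        then show ?thesis by simp
      qed
      finally show "Z \<le> K l" by (simp add: K_def)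
    qed
  qed
  obtain C where C: "\<And>k. k > 0 \<Longrightarrow> norm (?S k - (\<Sum>n<1. \<theta> n (int k) \<phi> / of_nat k ^ n)) \<le> C / real k ^ 1"
    using \<theta> \<phi> unfolding expands_def by blast
  have "(\<lambda>l. ?S (K l) - \<theta> 0 (int k) \<phi>) \<longlonglongrightarrow> 0"
  proof (rule Lim_null_comparison)
    have "\<theta> 0 (int (K l)) = \<theta> 0 (int k)" for l
      by (rule E(2)) (simp add: intK mult.assoc)
    then show "\<forall>\<^sub>F l in sequentially. norm (?S (K l) - \<theta> 0 (int k) \<phi>) \<le> C / real (K l)"
      using C[OF K] by (intro always_eventually) simp
    show "(\<lambda>l. C / real (K l)) \<longlonglongrightarrow> 0"
      using K_lim by (intro tendsto_divide_0[OF tendsto_const]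
          filterlim_at_top_imp_at_infinity filterlim_compose[OF filterlim_real_sequentially])
  qed
  then have lim1: "(\<lambda>l. ?S (K l)) \<longlonglongrightarrow> \<theta> 0 (int k) \<phi>" by (rule LIM_zero_cancel)
  define A where "A = (\<lambda>r l. (\<Sum>\<^sub>\<infinity>\<nu>\<in>Pi\<^sub>E B (\<lambda>_. UNIV).
      of_bool (forms_region B fs (\<lambda>b. (of_int (r b) + of_int D * of_int (\<nu> b)) / real (K l))) *
      \<phi> (affine_map B \<alpha> v (\<lambda>b. (of_int (r b) + of_int D * of_int (\<nu> b)) / real (K l)))))"
  have S: "?S (K l) = (\<Sum>r\<in>?R. c r (int k) / of_int D ^ card B * (A r l * of_real ((of_int D / real (K l)) ^ card B)))" for l
  proof -
    have "(\<Sum>\<^sub>\<infinity>\<nu>\<in>Pi\<^sub>E B (\<lambda>_. UNIV). forms_indicator B fs (\<lambda>b\<in>B. r b + D * \<nu> b) (int (K l)) * c (\<lambda>b\<in>B. r b + D * \<nu> b) (int (K l)) *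
        \<phi> (affine_map B \<alpha> v (\<lambda>b. (of_int (r b) + of_int D * of_int (\<nu> b)) / real (K l)))) = c r (int k) * A r l"
      if "r \<in> ?R" for r
    proof -
      have cr: "c (\<lambda>b\<in>B. r b + D * \<nu> b) (int (K l)) = c r (int k)" for \<nu>
      proof -
        have "int (K l) mod D = int k mod D" by (simp add: intK mult.assoc mult.left_commute[of E])
        then show ?thesis
          using c unfolding periodic_coeff_def by auto
      qed
      have "forms_indicator B fs (\<lambda>b\<in>B. r b + D * \<nu> b) (int (K l)) =
          of_bool (forms_region B fs (\<lambda>b. (of_int (r b) + of_int D * of_int (\<nu> b)) / real (K l)))" for \<nu>
        unfolding forms_indicator_region[OF K] by (simp add: forms_region_def cong: sum.cong)
      then show ?thesis
        unfolding cr A_def infsum_cmult_right'[symmetric] by (simp add: mult_ac)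
    qed
    then show ?thesis
      unfolding weighted_sum_residues[OF B \<phi> K D]
      using D K[of l] by (simp add: sum_divide_distrib power_divide)
  qed
  have "(\<lambda>l. ?S (K l)) \<longlonglongrightarrow> (\<Sum>r\<in>?R. c r (int k) / of_int D ^ card B * ?I)"
    unfolding S A_def by (intro tendsto_sum tendsto_mult tendsto_const Riemann_sum_tendsto[OF B \<phi> D _ K K_lim])
  then have "\<theta> 0 (int k) \<phi> = (\<Sum>r\<in>?R. c r (int k) / of_int D ^ card B * ?I)"
    using lim1 LIMSEQ_unique by blast
  then show ?thesis by (simp add: sum_distrib_right sum_divide_distrib)
qed

section \<open>Lattices and rational polyhedra\<close>

definition int_span :: "'a::real_vector set \<Rightarrow> 'a set" where
  "int_span B = {x. \<exists>c::'a \<Rightarrow> int. x = (\<Sum>b\<in>B. of_int (c b) *\<^sub>R b)}"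

definition additive_subgroup :: "'a::ab_group_add set \<Rightarrow> bool" where
  "additive_subgroup H \<longleftrightarrow> 0 \<in> H \<and> (\<forall>x\<in>H. \<forall>y\<in>H. x - y \<in> H)"

lemma additive_subgroupD:
  assumes "additive_subgroup H"
  shows "0 \<in> H" "x \<in> H \<Longrightarrow> y \<in> H \<Longrightarrow> x - y \<in> H" "x \<in> H \<Longrightarrow> y \<in> H \<Longrightarrow> x + y \<in> H" "x \<in> H \<Longrightarrow> - x \<in> H"
proof -
  show *: "0 \<in> H" "x \<in> H \<Longrightarrow> y \<in> H \<Longrightarrow> x - y \<in> H" for x y
    using assms by (auto simp: additive_subgroup_def)
  show "x \<in> H \<Longrightarrow> - x \<in> H" for x using *(2)[OF *(1), of x] by simp
  then show "x \<in> H \<Longrightarrow> y \<in> H \<Longrightarrow> x + y \<in> H" using *(2)[of x "- y"] by simp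
qed

lemma additive_subgroup_scaleR:
  fixes H :: "'a::real_vector set"
  assumes "additive_subgroup H" "x \<in> H"
  shows "of_int n *\<^sub>R x \<in> H"
proof -
  have nat: "real m *\<^sub>R x \<in> H" for m
    by (induction m) (auto simp: scaleR_add_left additive_subgroupD[OF assms(1)] assms(2))
  show ?thesis
  proof (cases "n \<ge> 0")
    case True
    then show ?thesis using nat[of "nat n"] by simp
  next
    case False
    then show ?thesis
      using additive_subgroupD(4)[OF assms(1) nat[of "nat (- n)"]] by simp
  qed
qed

lemma additive_subgroup_int_span: "additive_subgroup (int_span B)"
  unfolding additive_subgroup_def
proof (intro conjI ballI)
  show "0 \<in> int_span B" unfolding int_span_def by (auto intro!: exI[of _ "\<lambda>_. 0"])
  fix x y assume "x \<in> int_span B" "y \<in> int_span B"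
  then obtain c d where "x = (\<Sum>b\<in>B. of_int (c b) *\<^sub>R b)" "y = (\<Sum>b\<in>B. of_int (d b) *\<^sub>R b)"
    unfolding int_span_def by auto
  then have "x - y = (\<Sum>b\<in>B. of_int (c b - d b) *\<^sub>R b)"
    by (simp add: scaleR_diff_left sum_subtractf)
  then show "x - y \<in> int_span B" unfolding int_span_def by (auto intro!: exI[of _ "\<lambda>b. c b - d b"])
qed

lemma int_span_base:
  assumes "finite B" "b \<in> B" shows "b \<in> int_span B"
proof -
  have "(\<Sum>x\<in>B. of_int (of_bool (x = b)) *\<^sub>R x) = (\<Sum>x\<in>B. if x = b then b else 0)"
    by (intro sum.cong) auto
  then show ?thesis
    unfolding int_span_def using assms by (auto intro!: exI[of _ "\<lambda>x. of_bool (x = b)"])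
qed

lemma int_span_subset_span: "int_span B \<subseteq> span B"
  unfolding int_span_def by (auto intro: span_sum span_scale span_base)

lemma int_span_insert:
  assumes "finite B" "b \<notin> B"
  shows "x \<in> int_span (insert b B) \<longleftrightarrow> (\<exists>n::int. \<exists>y\<in>int_span B. x = of_int n *\<^sub>R b + y)"
proof
  assume "x \<in> int_span (insert b B)"
  then show "\<exists>n::int. \<exists>y\<in>int_span B. x = of_int n *\<^sub>R b + y"
    using assms unfolding int_span_def by (auto simp: sum.insert)
next
  assume "\<exists>n::int. \<exists>y\<in>int_span B. x = of_int n *\<^sub>R b + y"
  then obtain n :: int and c where x: "x = of_int n *\<^sub>R b + (\<Sum>b\<in>B. of_int (c b) *\<^sub>R b)"
    unfolding int_span_def by auto
  have "(\<Sum>x\<in>B. of_int ((c(b := n)) x) *\<^sub>R x) = (\<Sum>b\<in>B. of_int (c b) *\<^sub>R b)"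
    using assms by (intro sum.cong) auto
  then have "x = (\<Sum>x\<in>insert b B. of_int ((c(b := n)) x) *\<^sub>R x)"
    using assms x by simp
  then show "x \<in> int_span (insert b B)" unfolding int_span_def by blast
qed

lemma lattice_basis_altdef: "lattice_basis B L \<longleftrightarrow> finite B \<and> independent B \<and> L = int_span B"
  by (simp add: lattice_basis_def int_span_def)

text \<open>The coefficients of \<open>b\<close> occurring in \<open>H\<close> form a subgroup of
  the integers. If it is nonzero, a vector \<open>h\<close> over its least positive element
  \<open>d\<close> completes a basis of the kernel \<open>H0\<close>, since subtracting multiples of
  \<open>h\<close> reduces the coefficient modulo \<open>d\<close>.\<close>

lemma subgroup_lattice_basis:
  fixes B :: "'a::real_vector set"
  assumes "finite B" "independent B" "additive_subgroup H" "H \<subseteq> int_span B"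
  shows "\<exists>C. C \<subseteq> H \<and> lattice_basis C H"
  using assms
proof (induction B arbitrary: H rule: finite_induct)
  case empty
  then have "H = {0}" using additive_subgroupD(1)[of H] by (auto simp: int_span_def)
  then show ?case by (intro exI[of _ "{}"]) (simp add: lattice_basis_altdef int_span_def independent_empty)
next
  case (insert b B)
  have b: "b \<notin> span B" and indB: "independent B"
    using insert.prems(1) insert.hyps by (auto simp: independent_insert)
  define H0 where "H0 = H \<inter> int_span B"
  have H0: "additive_subgroup H0"
    using insert.prems(2) additive_subgroup_int_span[of B] unfolding H0_def additive_subgroup_def by auto
  then obtain C where C: "C \<subseteq> H0" "lattice_basis C H0"
    using insert.IH[OF indB, of H0] by (auto simp: H0_def)
  define A where "A = {n::int. \<exists>y\<in>int_span B. of_int n *\<^sub>R b + y \<in> H}"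
  have Hrep: "\<exists>n\<in>A. \<exists>y\<in>int_span B. x = of_int n *\<^sub>R b + y" if "x \<in> H" for x
    using insert.prems(3) that int_span_insert[OF insert.hyps, of x] by (auto simp: A_def)
  show ?case
  proof (cases "A \<subseteq> {0}")
    case True
    then have "H \<subseteq> H0" using Hrep by (fastforce simp: H0_def)
    then have "H = H0" by (auto simp: H0_def)
    then show ?thesis using C by blast
  next
    case False
    have minus: "- n \<in> A" if n: "n \<in> A" for n
    proof -
      obtain y where "y \<in> int_span B" "of_int n *\<^sub>R b + y \<in> H" using n by (auto simp: A_def)
      then have "- y \<in> int_span B" "of_int (- n) *\<^sub>R b + - y \<in> H"
        using additive_subgroupD(4)[OF additive_subgroup_int_span] additive_subgroupD(4)[OF insert.prems(2), of "of_int n *\<^sub>R b + y"]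
        by auto
      then show ?thesis unfolding A_def by blast
    qed
    have "\<exists>n::nat. n > 0 \<and> int n \<in> A"
    proof -
      obtain n where n: "n \<in> A" "n \<noteq> 0" using False by auto
      show ?thesis
        using n minus[OF n(1)] by (intro exI[of _ "nat \<bar>n\<bar>"]) (auto simp: abs_if)
    qed
    define d where "d = (LEAST n::nat. n > 0 \<and> int n \<in> A)"
    have d: "d > 0" "int d \<in> A"
      using LeastI_ex[OF \<open>\<exists>n::nat. n > 0 \<and> int n \<in> A\<close>] by (auto simp: d_def)
    have dmin: "d \<le> n" if "n > 0" "int n \<in> A" for n using that by (auto simp: d_def intro: Least_le)
    obtain y0 where y0: "y0 \<in> int_span B" "of_int (int d) *\<^sub>R b + y0 \<in> H" using d by (auto simp: A_def)
    define h where "h = of_int (int d) *\<^sub>R b + y0"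
    have h: "h \<in> H" using y0 by (simp add: h_def)
    have hspan: "h \<notin> span B"
    proof
      assume "h \<in> span B"
      moreover have "y0 \<in> span B" using y0 int_span_subset_span by blast
      ultimately have "h - y0 \<in> span B" by (rule span_diff)
      then have "(1 / real d) *\<^sub>R (h - y0) \<in> span B" by (rule span_scale)
      moreover have "(1 / real d) *\<^sub>R (h - y0) = b" using d by (simp add: h_def)
      ultimately show False using b by simp
    qed
    have CB: "span C \<subseteq> span B"
      using C(1) int_span_subset_span[of B] by (intro span_minimal) (auto simp: H0_def)
    have hC: "h \<notin> span C" "h \<notin> C" using hspan CB span_base by blast+
    have red: "\<exists>n::int. x - of_int n *\<^sub>R h \<in> H0" if x: "x \<in> H" for x
    proof -
      obtain m y where m: "m \<in> A" "y \<in> int_span B" "x = of_int m *\<^sub>R b + y" using Hrep[OF x] by blast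
      define n where "n = m div int d"
      define e where "e = m mod int d"
      have me: "m = n * int d + e" by (simp add: n_def e_def)
      have xh: "x - of_int n *\<^sub>R h = of_int e *\<^sub>R b + (y - of_int n *\<^sub>R y0)"
        by (simp add: m(3) h_def me algebra_simps)
      have mem: "y - of_int n *\<^sub>R y0 \<in> int_span B"
        using additive_subgroupD(2)[OF additive_subgroup_int_span m(2) additive_subgroup_scaleR[OF additive_subgroup_int_span y0(1)]] .
      have memH: "x - of_int n *\<^sub>R h \<in> H"
        using additive_subgroupD(2)[OF insert.prems(2) x additive_subgroup_scaleR[OF insert.prems(2) h]] .
      have "e \<in> A" using mem memH unfolding A_def xh by blast
      moreover have "0 \<le> e" "e < int d" using d by (auto simp: e_def)
      ultimately have "e = 0" using dmin[of "nat e"] by (cases "e > 0") auto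
      then have "x - of_int n *\<^sub>R h \<in> H0" using mem memH xh by (simp add: H0_def)
      then show ?thesis by blast
    qed
    have "H = int_span (insert h C)"
    proof
      have "finite C" "H0 = int_span C" using C by (auto simp: lattice_basis_altdef)
      show "H \<subseteq> int_span (insert h C)"
      proof
        fix x assume "x \<in> H"
        then obtain n where "x - of_int n *\<^sub>R h \<in> int_span C" using red \<open>H0 = int_span C\<close> by blast
        moreover have "x = of_int n *\<^sub>R h + (x - of_int n *\<^sub>R h)" by simp
        ultimately show "x \<in> int_span (insert h C)"
          unfolding int_span_insert[OF \<open>finite C\<close> hC(2)] by blast
      qed
      show "int_span (insert h C) \<subseteq> H"
      proof
        fix x assume "x \<in> int_span (insert h C)"
        then obtain n :: int and y where "y \<in> H0" "x = of_int n *\<^sub>R h + y"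
          unfolding int_span_insert[OF \<open>finite C\<close> hC(2)] \<open>H0 = int_span C\<close> by blast
        then show "x \<in> H"
          using additive_subgroupD(3)[OF insert.prems(2) additive_subgroup_scaleR[OF insert.prems(2) h]] by (auto simp: H0_def)
      qed
    qed
    moreover have "independent (insert h C)" "finite (insert h C)"
      using C(2) hC by (auto simp: lattice_basis_altdef independent_insert)
    ultimately have "lattice_basis (insert h C) H" by (simp add: lattice_basis_altdef)
    moreover have "insert h C \<subseteq> H" using C h by (auto simp: H0_def)
    ultimately show ?thesis by blast
  qed
qed

text \<open>Functionals are imposed one at a time. A spanning vector \<open>r\<close> outside the
  kernel of \<open>a\<close> defines the projection along \<open>r\<close> onto that kernel; its
  coefficients on \<open>S\<close> are rational, so integer multiples of the images lie in
  \<open>G\<close>. The group is general because the lemma is applied to \<open>\<Lambda>\<close>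
  and to its product with the integers.\<close>

lemma rational_kernel_span:
  fixes G :: "'a::euclidean_space set"
  assumes "finite A" "additive_subgroup G" "finite R" "R \<subseteq> G" "span R = UNIV"
    and "\<And>a x. a \<in> A \<Longrightarrow> x \<in> G \<Longrightarrow> a \<bullet> x \<in> \<rat>"
  shows "\<exists>S. finite S \<and> S \<subseteq> G \<and> span S = {x. \<forall>a\<in>A. a \<bullet> x = 0}"
  using assms(1,6)
proof (induction A rule: finite_induct)
  case empty
  show ?case using assms by (intro exI[of _ R]) auto
next
  case (insert a A)
  then obtain S where S: "finite S" "S \<subseteq> G" "span S = {x. \<forall>a\<in>A. a \<bullet> x = 0}" by auto
  show ?case
  proof (cases "\<forall>s\<in>S. a \<bullet> s = 0")
    case True
    have "a \<bullet> x = 0" if "x \<in> span S" for x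
      using that by (induction rule: span_induct_alt) (auto simp: inner_add_right True)
    then show ?thesis using S by (intro exI[of _ S]) auto
  next
    case False
    then obtain r where r: "r \<in> S" "a \<bullet> r \<noteq> 0" by auto
    define \<pi> where "\<pi> = (\<lambda>x. x - ((a \<bullet> x) / (a \<bullet> r)) *\<^sub>R r)"
    have lin: "linear \<pi>"
      by (rule linearI) (auto simp: \<pi>_def inner_add_right add_divide_distrib algebra_simps)
    have "\<exists>N::int. N > 0 \<and> of_int N *\<^sub>R \<pi> s \<in> G" if s: "s \<in> S" for s
    proof -
      have "(a \<bullet> s) / (a \<bullet> r) \<in> \<rat>" using S(2) s r insert.prems by (intro Rats_divide) auto
      then obtain N :: int where N: "N > 0" "of_int N * ((a \<bullet> s) / (a \<bullet> r)) \<in> \<int>"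
        using common_denominator[of "{(a \<bullet> s) / (a \<bullet> r)}"] by auto
      then obtain m :: int where m: "of_int N * ((a \<bullet> s) / (a \<bullet> r)) = of_int m" by (auto elim: Ints_cases)
      have "of_int N *\<^sub>R \<pi> s = of_int N *\<^sub>R s - of_int m *\<^sub>R r"
        unfolding m[symmetric] by (simp add: \<pi>_def scaleR_diff_right)
      also have "\<dots> \<in> G"
        using S(2) s r by (intro additive_subgroupD(2)[OF assms(2)] additive_subgroup_scaleR[OF assms(2)]) auto
      finally show ?thesis using N(1) by blast
    qed
    then obtain N where N: "\<And>s. s \<in> S \<Longrightarrow> N s > (0::int)" "\<And>s. s \<in> S \<Longrightarrow> of_int (N s) *\<^sub>R \<pi> s \<in> G" by metis
    define T where "T = (\<lambda>s. of_int (N s) *\<^sub>R \<pi> s) ` S"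
    have \<pi>T: "\<pi> s \<in> span T" if "s \<in> S" for s
    proof -
      have "(1 / of_int (N s)) *\<^sub>R of_int (N s) *\<^sub>R \<pi> s \<in> span T"
        using that by (intro span_scale span_base) (auto simp: T_def)
      then show ?thesis using N(1)[OF that] by simp
    qed
    have "span T = {x. \<forall>c\<in>insert a A. c \<bullet> x = 0}"
    proof
      have "c \<bullet> \<pi> s = 0" if "s \<in> S" "c \<in> insert a A" for s c
      proof (cases "c = a")
        case True
        then show ?thesis using r by (simp add: \<pi>_def inner_diff_right)
      next
        case False
        then have "c \<bullet> s = 0" "c \<bullet> r = 0" using that r S(3) span_base[of _ S] by auto
        then show ?thesis by (simp add: \<pi>_def inner_diff_right)
      qed
      then have "T \<subseteq> {x. \<forall>c\<in>insert a A. c \<bullet> x = 0}" by (auto simp: T_def)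
      moreover have "subspace {x. \<forall>c\<in>insert a A. c \<bullet> x = 0}"
        by (auto simp: subspace_def inner_add_right)
      ultimately show "span T \<subseteq> {x. \<forall>c\<in>insert a A. c \<bullet> x = 0}" by (rule span_minimal)
      show "{x. \<forall>c\<in>insert a A. c \<bullet> x = 0} \<subseteq> span T"
      proof
        fix x assume x: "x \<in> {x. \<forall>c\<in>insert a A. c \<bullet> x = 0}"
        then have "x \<in> span S" using S(3) by auto
        then have "\<pi> x \<in> \<pi> ` span S" by simp
        also have "\<dots> = span (\<pi> ` S)" using lin by (simp add: linear_span_image)
        also have "\<dots> \<subseteq> span T" using \<pi>T by (intro span_minimal) auto
        finally show "x \<in> span T" using x by (simp add: \<pi>_def)
      qed
    qed
    moreover have "finite T" "T \<subseteq> G" using S(1) N by (auto simp: T_def)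
    ultimately show ?thesis by blast
  qed
qed

text \<open>The constraints tight on all of \<open>P\<close> cut out the hull. Averaging yields a
  point of \<open>P\<close> that is strict in all the others, and from it one can move a little
  towards any solution of the tight equations without leaving \<open>P\<close>.\<close>

lemma affine_hull_halfspaces:
  fixes a :: "'i \<Rightarrow> 'a::euclidean_space"
  assumes "finite I" and P: "P = {x. \<forall>i\<in>I. a i \<bullet> x \<le> b i}" and "P \<noteq> {}"
  shows "affine hull P = {x. \<forall>i\<in>{i\<in>I. \<forall>x\<in>P. a i \<bullet> x = b i}. a i \<bullet> x = b i}" (is "_ = ?A")
proof
  have "affine ?A"
    by (auto simp: affine_def inner_add_right) (metis distrib_right mult_1)
  then show "affine hull P \<subseteq> ?A" by (rule hull_minimal[rotated]) auto
  define J where "J = {i\<in>I. \<not> (\<forall>x\<in>P. a i \<bullet> x = b i)}"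
  have "\<exists>x\<in>P. \<forall>i\<in>S. a i \<bullet> x < b i" if "finite S" "S \<subseteq> J" for S
    using that
  proof (induction S rule: finite_induct)
    case empty
    then show ?case using assms(3) by auto
  next
    case (insert i S)
    then obtain x where x: "x \<in> P" "\<forall>i\<in>S. a i \<bullet> x < b i" by auto
    obtain y where y: "y \<in> P" "a i \<bullet> y < b i" using insert.prems P by (force simp: J_def)
    define z where "z = (1/2) *\<^sub>R x + (1/2) *\<^sub>R y"
    have z: "a j \<bullet> z = (a j \<bullet> x + a j \<bullet> y) / 2" for j by (simp add: z_def inner_add_right add_divide_distrib)
    have le: "a j \<bullet> x \<le> b j" "a j \<bullet> y \<le> b j" if "j \<in> I" for j using x y P that by auto
    have "a j \<bullet> z \<le> b j" if "j \<in> I" for j using le[OF that] by (simp add: z)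
    then have "z \<in> P" unfolding P by blast
    moreover have "a j \<bullet> z < b j" if "j \<in> insert i S" for j
      using that x y le[of j] insert.prems unfolding z by (force simp: J_def)
    ultimately show ?case by blast
  qed
  then obtain x where x: "x \<in> P" "\<And>i. i \<in> J \<Longrightarrow> a i \<bullet> x < b i"
    using assms(1) by (metis (no_types, lifting) J_def finite_Collect_conjI mem_Collect_eq order_refl finite_subset subsetI)
  show "?A \<subseteq> affine hull P"
  proof
    fix y assume y: "y \<in> ?A"
    have "\<forall>\<^sub>F e in at_right 0. \<forall>i\<in>J. a i \<bullet> x + e * (a i \<bullet> (y - x)) < b i"
    proof (rule eventually_ball_finite)
      show "finite J" using assms(1) by (simp add: J_def)
      show "\<forall>i\<in>J. \<forall>\<^sub>F e in at_right 0. a i \<bullet> x + e * (a i \<bullet> (y - x)) < b i"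
      proof
        fix i assume "i \<in> J"
        have "((\<lambda>e. a i \<bullet> x + e * (a i \<bullet> (y - x))) \<longlongrightarrow> a i \<bullet> x + 0 * (a i \<bullet> (y - x))) (at_right 0)"
          by (intro tendsto_intros)
        then show "\<forall>\<^sub>F e in at_right 0. a i \<bullet> x + e * (a i \<bullet> (y - x)) < b i"
          using x(2)[OF \<open>i \<in> J\<close>] by (intro order_tendstoD(2)) auto
      qed
    qed
    moreover have "\<forall>\<^sub>F e::real in at_right 0. e > 0" by (simp add: eventually_at_right_less)
    ultimately have "\<forall>\<^sub>F e in at_right 0. (\<forall>i\<in>J. a i \<bullet> x + e * (a i \<bullet> (y - x)) < b i) \<and> e > 0"
      by (rule eventually_conj)
    then obtain e where e: "\<And>i. i \<in> J \<Longrightarrow> a i \<bullet> x + e * (a i \<bullet> (y - x)) < b i" "e > 0"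
      using eventually_happens'[OF trivial_limit_at_right_real] by (metis (no_types, lifting))
    define z where "z = x + e *\<^sub>R (y - x)"
    have "a i \<bullet> z \<le> b i" if "i \<in> I" for i
    proof (cases "i \<in> J")
      case True
      then show ?thesis using e(1)[OF True] by (simp add: z_def inner_add_right)
    next
      case False
      then have "a i \<bullet> y = b i" "a i \<bullet> x = b i" using y x(1) that by (auto simp: J_def)
      then show ?thesis by (simp add: z_def inner_add_right inner_diff_right)
    qed
    then have "z \<in> P" by (simp add: P)
    \<comment> \<open>\<open>y\<close> lies on the line through the two points \<open>x\<close> and
      \<open>z\<close> of \<open>P\<close>.\<close>
    have "y = (1 - 1 / e) *\<^sub>R x + (1 / e) *\<^sub>R z" using e(2) by (simp add: z_def algebra_simps)
    then show "y \<in> affine hull P"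
      using mem_affine[OF affine_affine_hull hull_inc[OF x(1)] hull_inc[OF \<open>z \<in> P\<close>], of "1 - 1 / e" "1 / e"] by simp
  qed
qed

section \<open>The affine hull of a rational polyhedron and its lattice\<close>

locale lattice_polyhedron =
  fixes \<Lambda> P :: "'a::euclidean_space set"
  assumes lattice: "is_lattice \<Lambda>" and span_lattice: "span \<Lambda> = UNIV"
    and polyhedron: "rational_polyhedron \<Lambda> P" and nonempty: "P \<noteq> {}"
begin

lemma halfspaces:
  "\<exists>(F :: 'a set set) a b. finite F \<and> P = {x. \<forall>h\<in>F. a h \<bullet> x \<le> b h} \<and>
    (\<forall>h\<in>F. \<forall>x\<in>\<Lambda>. a h \<bullet> x \<in> \<rat>) \<and> (\<forall>h\<in>F. b h \<in> \<rat>)"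
proof -
  obtain F where F: "finite F" "P = \<Inter>F"
    "\<forall>h\<in>F. \<exists>a b. a \<noteq> 0 \<and> (\<forall>x\<in>\<Lambda>. a \<bullet> x \<in> \<rat>) \<and> b \<in> \<rat> \<and> h = {x. a \<bullet> x \<le> b}"
    using polyhedron unfolding rational_polyhedron_def by blast
  then obtain a b where ab: "\<And>h. h \<in> F \<Longrightarrow> (\<forall>x\<in>\<Lambda>. a h \<bullet> x \<in> \<rat>) \<and> b h \<in> \<rat> \<and> h = {x. a h \<bullet> x \<le> b h}"
    by metis
  then have "P = {x. \<forall>h\<in>F. a h \<bullet> x \<le> b h}" unfolding F(2) by blast
  then show ?thesis using F(1) ab by (intro exI[of _ F] exI[of _ a] exI[of _ b]) blast
qed

lemma lattice_subgroup: "additive_subgroup \<Lambda>"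
  using lattice additive_subgroup_int_span by (auto simp: is_lattice_def lattice_basis_altdef)

lemma lattice_generators:
  obtains R where "finite R" "R \<subseteq> \<Lambda>" "span R = UNIV" "independent R" "\<Lambda> = int_span R"
proof -
  obtain R where R: "finite R" "independent R" "\<Lambda> = int_span R"
    using lattice by (auto simp: is_lattice_def lattice_basis_altdef)
  have "span \<Lambda> \<subseteq> span R"
    using int_span_subset_span[of R] R by (intro span_minimal) auto
  then have "span R = UNIV" using span_lattice by auto
  moreover have "R \<subseteq> \<Lambda>" using R int_span_base by blast
  ultimately show ?thesis using that R by blast
qed

text \<open>The hull is given by equations with rational data, so
  \<open>rational_kernel_span\<close> yields lattice vectors spanning its direction. Applied to the
  homogenized equations over \<open>\<Lambda>\<close> times the integers, it yields a lattice vector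
  with nonzero last coordinate, and dividing by that coordinate gives the rational point.\<close>

lemma lin_space_subspace: "subspace (lin_space P)"
  and lin_space_diff: "x \<in> affine hull P \<Longrightarrow> y \<in> affine hull P \<Longrightarrow> x - y \<in> lin_space P"
  and affine_hull_add_lin: "x \<in> affine hull P \<Longrightarrow> y \<in> lin_space P \<Longrightarrow> x + y \<in> affine hull P"
  and span_lin_lattice: "span (\<Lambda> \<inter> lin_space P) = lin_space P"
  and rational_point: "\<exists>k>0. \<exists>x \<in> affine hull P. real k *\<^sub>R x \<in> \<Lambda>"
proof -
  obtain F :: "'a set set" and a b where "finite F \<and> P = {x. \<forall>h\<in>F. a h \<bullet> x \<le> b h} \<and>
      (\<forall>h\<in>F. \<forall>x\<in>\<Lambda>. a h \<bullet> x \<in> \<rat>) \<and> (\<forall>h\<in>F. b h \<in> \<rat>)"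
    using halfspaces by (elim exE)
  then have F: "finite F" "P = {x. \<forall>h\<in>F. a h \<bullet> x \<le> b h}"
    "\<And>h x. h \<in> F \<Longrightarrow> x \<in> \<Lambda> \<Longrightarrow> a h \<bullet> x \<in> \<rat>" "\<And>h. h \<in> F \<Longrightarrow> b h \<in> \<rat>"
    by blast+
  define E where "E = {h\<in>F. \<forall>x\<in>P. a h \<bullet> x = b h}"
  have hull: "affine hull P = {x. \<forall>h\<in>E. a h \<bullet> x = b h}"
    unfolding E_def by (rule affine_hull_halfspaces[OF F(1,2) nonempty])
  obtain p where "p \<in> P" using nonempty by auto
  then have p: "p \<in> affine hull P" by (rule hull_inc)
  have lin: "lin_space P = {x. \<forall>h\<in>E. a h \<bullet> x = 0}"
  proof
    show "lin_space P \<subseteq> {x. \<forall>h\<in>E. a h \<bullet> x = 0}"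
      by (auto simp: lin_space_def hull inner_diff_right)
    show "{x. \<forall>h\<in>E. a h \<bullet> x = 0} \<subseteq> lin_space P"
    proof
      fix x assume "x \<in> {x. \<forall>h\<in>E. a h \<bullet> x = 0}"
      then have "p + x \<in> affine hull P" using p by (auto simp: hull inner_add_right)
      moreover have "x = (p + x) - p" by simp
      ultimately show "x \<in> lin_space P" using p unfolding lin_space_def by blast
    qed
  qed
  show "subspace (lin_space P)" by (auto simp: lin subspace_def inner_add_right)
  show "x \<in> affine hull P \<Longrightarrow> y \<in> affine hull P \<Longrightarrow> x - y \<in> lin_space P"
    by (auto simp: lin_space_def)
  show "x \<in> affine hull P \<Longrightarrow> y \<in> lin_space P \<Longrightarrow> x + y \<in> affine hull P"
    by (auto simp: hull lin inner_add_right)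
  obtain R where R: "finite R" "R \<subseteq> \<Lambda>" "span R = UNIV" using lattice_generators by metis
  have "\<exists>S. finite S \<and> S \<subseteq> \<Lambda> \<and> span S = {x. \<forall>c\<in>a ` E. c \<bullet> x = 0}"
    using F(1,3) by (intro rational_kernel_span[OF _ lattice_subgroup R]) (auto simp: E_def)
  then obtain S where S: "S \<subseteq> \<Lambda>" "span S = lin_space P" unfolding lin by auto
  have "S \<subseteq> \<Lambda> \<inter> lin_space P" using S span_base by blast
  then have "lin_space P \<subseteq> span (\<Lambda> \<inter> lin_space P)" using S(2) span_mono by blast
  moreover have "span (\<Lambda> \<inter> lin_space P) \<subseteq> lin_space P"
    by (rule span_minimal) (use \<open>subspace (lin_space P)\<close> in auto)
  ultimately show "span (\<Lambda> \<inter> lin_space P) = lin_space P" by blast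
  let ?G = "\<Lambda> \<times> (\<int> :: real set)" and ?R = "insert (0, 1) ((\<lambda>x. (x, 0::real)) ` R)"
  have G: "additive_subgroup ?G"
    using lattice_subgroup by (auto simp: additive_subgroup_def zero_prod_def)
  have "span ?R = UNIV"
  proof -
    have "(x, t) \<in> span ?R" for x t
    proof -
      have "(\<lambda>x. (x, 0::real)) ` span R = span ((\<lambda>x. (x, 0::real)) ` R)"
        by (rule linear_span_image[symmetric]) (auto intro!: linearI)
      then have "(x, 0) \<in> span ((\<lambda>x. (x, 0::real)) ` R)" using R(3) by auto
      then have "(x, 0) \<in> span ?R" using span_mono[of "(\<lambda>x. (x, 0::real)) ` R" ?R] by blast
      moreover have "t *\<^sub>R (0, 1) \<in> span ?R" by (intro span_scale span_base) auto
      ultimately have "(x, 0) + t *\<^sub>R (0, 1) \<in> span ?R" by (rule span_add)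
      then show ?thesis by simp
    qed
    then show ?thesis by auto
  qed
  moreover have "?R \<subseteq> ?G" using R(2) additive_subgroupD(1)[OF lattice_subgroup] by auto
  ultimately have "\<exists>S. finite S \<and> S \<subseteq> ?G \<and> span S = {x. \<forall>c\<in>(\<lambda>h. (a h, - b h)) ` E. c \<bullet> x = 0}"
    using F R(1) by (intro rational_kernel_span[OF _ G, of _ ?R])
      (auto simp: E_def Ints_subset_Rats[THEN subsetD] intro!: Rats_diff Rats_mult)
  then obtain S where S: "S \<subseteq> ?G" "span S = {x. \<forall>c\<in>(\<lambda>h. (a h, - b h)) ` E. c \<bullet> x = 0}" by auto
  have "(p, 1) \<in> span S" using p unfolding S(2) by (auto simp: hull)
  have "\<exists>s\<in>S. snd s \<noteq> 0"
  proof (rule ccontr)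
    assume "\<not> ?thesis"
    then have "span S \<subseteq> {x. snd x = 0}"
      by (intro span_minimal) (auto simp: subspace_def)
    then show False using \<open>(p, 1) \<in> span S\<close> by auto
  qed
  then obtain x n where xn: "(x, of_int n) \<in> S" "n \<noteq> 0" "x \<in> \<Lambda>"
    using S(1) by (force elim: Ints_cases)
  have "a h \<bullet> x = b h * of_int n" if "h \<in> E" for h
    using span_base[OF xn(1)] that unfolding S(2) by (auto simp: inner_diff_right)
  then have "(1 / of_int n) *\<^sub>R x \<in> affine hull P" using xn(2) by (auto simp: hull)
  moreover have "real (nat \<bar>n\<bar>) *\<^sub>R (1 / of_int n) *\<^sub>R x \<in> \<Lambda>"
    using xn additive_subgroupD(4)[OF lattice_subgroup xn(3)] by (cases "n > 0") (auto simp: abs_if)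
  moreover have "nat \<bar>n\<bar> > 0" using xn(2) by simp
  ultimately show "\<exists>k>0. \<exists>x \<in> affine hull P. real k *\<^sub>R x \<in> \<Lambda>" by blast
qed

lemma lin_lattice_basis_exists: "\<exists>B. lattice_basis B (\<Lambda> \<inter> lin_space P)"
proof -
  obtain R where R: "finite R" "independent R" "\<Lambda> = int_span R" using lattice_generators by metis
  have "additive_subgroup (\<Lambda> \<inter> lin_space P)"
    using lattice_subgroup lin_space_subspace by (auto simp: additive_subgroup_def subspace_0 subspace_diff)
  then show ?thesis using subgroup_lattice_basis[OF R(1,2)] R(3) by blast
qed

lemma lin_lattice_basis:
  assumes "lattice_basis B (\<Lambda> \<inter> lin_space P)"
  shows "finite B" "span B = lin_space P" "card B = nat (aff_dim P)" "independent_family B id" "B \<subseteq> \<Lambda> \<inter> lin_space P"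
proof -
  have B: "finite B" "independent B" "\<Lambda> \<inter> lin_space P = int_span B"
    using assms by (auto simp: lattice_basis_altdef)
  show "finite B" by (rule B)
  show sub: "B \<subseteq> \<Lambda> \<inter> lin_space P" using B int_span_base by blast
  have "lin_space P \<subseteq> span B"
    using span_lin_lattice int_span_subset_span[of B] B(3) by (metis span_mono span_span)
  moreover have "span B \<subseteq> lin_space P"
    using sub lin_space_subspace by (intro span_minimal) auto
  ultimately show span: "span B = lin_space P" by blast
  obtain p where p: "p \<in> P" using nonempty by auto
  then have ph: "p \<in> affine hull P" by (rule hull_inc)
  have "(+) (- p) ` (affine hull P) = lin_space P"
  proof (intro equalityI subsetI)
    fix x assume "x \<in> (+) (- p) ` (affine hull P)"
    then show "x \<in> lin_space P" using lin_space_diff[OF _ ph] by force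
  next
    fix x assume "x \<in> lin_space P"
    then have "p + x \<in> affine hull P" by (rule affine_hull_add_lin[OF ph])
    then show "x \<in> (+) (- p) ` (affine hull P)" by (force simp: image_iff intro!: bexI[of _ "p + x"])
  qed
  moreover have "aff_dim (affine hull P) = int (dim ((+) (- p) ` (affine hull P)))"
    using ph by (intro aff_dim_eq_dim) (simp add: hull_hull)
  moreover have "dim (lin_space P) = card B"
    unfolding span[symmetric] using B by (simp add: dim_eq_card_independent)
  ultimately show "card B = nat (aff_dim P)" by (simp add: aff_dim_affine_hull)
  show "independent_family B id"
    unfolding independent_family_def
    using B(1,2) by (auto simp: dependent_finite)
qed

abbreviation "k0 \<equiv> index_gen \<Lambda> P"
abbreviation "\<alpha> \<equiv> index_point \<Lambda> P"

lemma index_ideal_iff: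
  "real k \<in> index_ideal \<Lambda> P \<longleftrightarrow> (\<exists>x \<in> affine hull P. real k *\<^sub>R x \<in> \<Lambda>)"
  by (auto simp: index_ideal_def)

lemma index_gen: "k0 > 0" "real k0 \<in> index_ideal \<Lambda> P"
  unfolding index_gen_def
  using LeastI_ex[of "\<lambda>k. k > 0 \<and> real k \<in> index_ideal \<Lambda> P"] rational_point index_ideal_iff by auto

lemma index_point: "\<alpha> \<in> affine hull P" "real k0 *\<^sub>R \<alpha> \<in> \<Lambda>"
  unfolding index_point_def
  using someI_ex[of "\<lambda>\<alpha>. \<alpha> \<in> affine hull P \<and> real k0 *\<^sub>R \<alpha> \<in> \<Lambda>"] index_gen(2) index_ideal_iff by auto

lemma index_point_multiple:
  assumes "k0 dvd k"
  shows "real k *\<^sub>R \<alpha> \<in> \<Lambda>"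
proof -
  obtain u where "k = k0 * u" using assms by (rule dvdE)
  then have "real k *\<^sub>R \<alpha> = of_int (int u) *\<^sub>R (real k0 *\<^sub>R \<alpha>)" by (simp add: mult.commute)
  then show ?thesis using additive_subgroup_scaleR[OF lattice_subgroup index_point(2)] by metis
qed

text \<open>If \<open>k0\<close> did not divide \<open>k\<close>, the remainder of the division
  would belong to the ideal as well and contradict the minimality of \<open>k0\<close>.\<close>

lemma index_ideal_multiple: "real k \<in> index_ideal \<Lambda> P \<longleftrightarrow> k0 dvd k"
proof
  assume "real k \<in> index_ideal \<Lambda> P"
  then obtain x where x: "x \<in> affine hull P" "real k *\<^sub>R x \<in> \<Lambda>" unfolding index_ideal_iff by auto
  show "k0 dvd k"
  proof (rule ccontr)
    assume "\<not> k0 dvd k"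
    define r where "r = k mod k0"
    define q where "q = k div k0"
    have r: "r > 0" "r < k0"
      using \<open>\<not> k0 dvd k\<close> index_gen(1) by (auto simp: r_def dvd_eq_mod_eq_0)
    have k: "k = q * k0 + r" by (simp only: q_def r_def div_mult_mod_eq)
    \<comment> \<open>Chosen so that \<open>r y = k x - q k0 \<alpha>\<close>, a difference of
      lattice vectors.\<close>
    define y where "y = \<alpha> + (real k / real r) *\<^sub>R (x - \<alpha>)"
    have "y \<in> affine hull P"
      unfolding y_def using lin_space_subspace lin_space_diff[OF x(1) index_point(1)]
      by (intro affine_hull_add_lin index_point) (auto intro: subspace_scale)
    moreover have "real r *\<^sub>R y = real k *\<^sub>R x - of_int (int q) *\<^sub>R (real k0 *\<^sub>R \<alpha>)"
    proof -
      have "real r *\<^sub>R y = real r *\<^sub>R \<alpha> + real k *\<^sub>R (x - \<alpha>)" using r by (simp add: y_def scaleR_add_right)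
      then show ?thesis by (simp add: k algebra_simps)
    qed
    moreover have "\<dots> \<in> \<Lambda>"
      by (intro additive_subgroupD(2)[OF lattice_subgroup] x additive_subgroup_scaleR[OF lattice_subgroup] index_point)
    ultimately have "real r \<in> index_ideal \<Lambda> P" unfolding index_ideal_iff by metis
    then have "k0 \<le> r" unfolding index_gen_def using r(1) by (intro Least_le) auto
    then show False using r by simp
  qed
next
  assume "k0 dvd k"
  then show "real k \<in> index_ideal \<Lambda> P"
    unfolding index_ideal_iff using index_point(1) index_point_multiple by blast
qed

text \<open>At height one, membership in the cone space is an affine condition satisfied by
  \<open>P\<close>, hence by its hull; scaling reaches every height.\<close>

lemma cone_space_mem: "x \<in> affine hull P \<Longrightarrow> (t *\<^sub>R x, t) \<in> cone_space P"
proof -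
  assume "x \<in> affine hull P"
  moreover have "affine {x. (x, 1) \<in> cone_space P}"
    unfolding affine_def
  proof (intro allI impI ballI)
    fix x y u v assume "x \<in> {x. (x, 1) \<in> cone_space P}" "y \<in> {x. (x, 1) \<in> cone_space P}" "u + v = (1::real)"
    then have "u *\<^sub>R (x, 1) + v *\<^sub>R (y, 1) \<in> cone_space P"
      unfolding cone_space_def by (intro span_add span_scale) auto
    then show "u *\<^sub>R x + v *\<^sub>R y \<in> {x. (x, 1) \<in> cone_space P}" using \<open>u + v = 1\<close> by simp
  qed
  moreover have "P \<subseteq> {x. (x, 1) \<in> cone_space P}"
  proof
    fix x assume "x \<in> P"
    then have "(1 *\<^sub>R x, 1) \<in> cone_over P" unfolding cone_over_def by fastforce
    then show "x \<in> {x. (x, 1) \<in> cone_space P}" unfolding cone_space_def by (auto intro: span_base)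
  qed
  ultimately have "(x, 1) \<in> cone_space P" using hull_minimal[of P _ affine] by blast
  then have "t *\<^sub>R (x, 1) \<in> cone_space P" unfolding cone_space_def by (rule span_scale)
  then show ?thesis by simp
qed

text \<open>As \<open>k \<alpha>\<close> is a lattice vector, subtracting it turns lattice points of
  the dilated hull into elements of \<open>\<Lambda> \<inter> lin_space P\<close>, that is, into
  integer coordinate vectors.\<close>

lemma lattice_points_dilate:
  assumes B: "lattice_basis B (\<Lambda> \<inter> lin_space P)" and k: "k > 0" "k0 dvd k"
  shows "bij_betw (\<lambda>n. real k *\<^sub>R affine_map B \<alpha> id (\<lambda>b. of_int (n b) / real k))
    {n \<in> Pi\<^sub>E B (\<lambda>_. UNIV). affine_map B \<alpha> id (\<lambda>b. of_int (n b) / real k) \<in> P} ((*\<^sub>R) (real k) ` P \<inter> \<Lambda>)"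
proof -
  note B' = lin_lattice_basis[OF B]
  have LB: "\<Lambda> \<inter> lin_space P = int_span B" using B by (simp add: lattice_basis_altdef)
  let ?h = "\<lambda>n. real k *\<^sub>R affine_map B \<alpha> id (\<lambda>b. of_int (n b) / real k)"
  have h: "?h n = real k *\<^sub>R \<alpha> + (\<Sum>b\<in>B. of_int (n b) *\<^sub>R b)" for n :: "'a \<Rightarrow> int"
    using k(1) by (simp add: affine_map_def scaleR_add_right scaleR_sum_right)
  have k\<alpha>: "real k *\<^sub>R \<alpha> \<in> \<Lambda>" by (rule index_point_multiple[OF k(2)])
  show ?thesis
    unfolding bij_betw_def
  proof
    show "inj_on ?h {n \<in> Pi\<^sub>E B (\<lambda>_. UNIV). affine_map B \<alpha> id (\<lambda>b. of_int (n b) / real k) \<in> P}"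
    proof (rule inj_onI)
      fix m n :: "'a \<Rightarrow> int"
      assume *: "m \<in> {n \<in> Pi\<^sub>E B (\<lambda>_. UNIV). affine_map B \<alpha> id (\<lambda>b. of_int (n b) / real k) \<in> P}"
        "n \<in> {n \<in> Pi\<^sub>E B (\<lambda>_. UNIV). affine_map B \<alpha> id (\<lambda>b. of_int (n b) / real k) \<in> P}" "?h m = ?h n"
      then have "(\<Sum>b\<in>B. (of_int (m b) - of_int (n b)) *\<^sub>R id b) = 0"
        unfolding h by (simp add: scaleR_diff_left sum_subtractf)
      then have "\<forall>b\<in>B. of_int (m b) - of_int (n b) = (0::real)"
        using B'(4)[unfolded independent_family_def, rule_format, of "\<lambda>b. of_int (m b) - of_int (n b)"] by blast
      then show "m = n" using *(1,2) by (intro extensionalityI[of _ B]) (auto simp: PiE_def)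
    qed
    show "?h ` {n \<in> Pi\<^sub>E B (\<lambda>_. UNIV). affine_map B \<alpha> id (\<lambda>b. of_int (n b) / real k) \<in> P} = (*\<^sub>R) (real k) ` P \<inter> \<Lambda>"
    proof (intro equalityI subsetI)
      fix y assume "y \<in> ?h ` {n \<in> Pi\<^sub>E B (\<lambda>_. UNIV). affine_map B \<alpha> id (\<lambda>b. of_int (n b) / real k) \<in> P}"
      then obtain n where n: "affine_map B \<alpha> id (\<lambda>b. of_int (n b) / real k) \<in> P" "y = ?h n" by auto
      have "(\<Sum>b\<in>B. of_int (n b) *\<^sub>R b) \<in> \<Lambda>" using LB by (auto simp: int_span_def)
      then have "y \<in> \<Lambda>" unfolding n(2) h by (intro additive_subgroupD(3)[OF lattice_subgroup] k\<alpha>)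
      then show "y \<in> (*\<^sub>R) (real k) ` P \<inter> \<Lambda>" using n by auto
    next
      fix y assume "y \<in> (*\<^sub>R) (real k) ` P \<inter> \<Lambda>"
      then obtain z where z: "z \<in> P" "y = real k *\<^sub>R z" "y \<in> \<Lambda>" by auto
      have "y - real k *\<^sub>R \<alpha> \<in> \<Lambda>" by (intro additive_subgroupD(2)[OF lattice_subgroup] z k\<alpha>)
      moreover have "real k *\<^sub>R (z - \<alpha>) \<in> lin_space P"
        by (intro subspace_scale lin_space_subspace lin_space_diff hull_inc z index_point)
      then have "y - real k *\<^sub>R \<alpha> \<in> lin_space P" by (simp add: z(2) scaleR_diff_right)
      ultimately obtain c where c: "y - real k *\<^sub>R \<alpha> = (\<Sum>b\<in>B. of_int (c b) *\<^sub>R b)"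
        using LB unfolding int_span_def by blast
      define n where "n = restrict c B"
      have "?h n = y" unfolding h using c by (simp add: n_def algebra_simps)
      moreover from this have "affine_map B \<alpha> id (\<lambda>b. of_int (n b) / real k) = z"
        using k(1) by (simp add: z(2))
      ultimately show "y \<in> ?h ` {n \<in> Pi\<^sub>E B (\<lambda>_. UNIV). affine_map B \<alpha> id (\<lambda>b. of_int (n b) / real k) \<in> P}"
        using z(1) by (intro image_eqI[of _ _ n]) (auto simp: n_def)
    qed
  qed
qed

text \<open>\<open>k0 \<alpha>\<close> and the basis vectors are lattice vectors, so the
  inequalities of \<open>P\<close> have rational coefficients in the coordinates \<open>t\<close>;
  clearing denominators makes the forms integral.\<close>

lemma polyhedron_forms:
  assumes B: "lattice_basis B (\<Lambda> \<inter> lin_space P)"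
  shows "\<exists>fs. \<forall>t. affine_map B \<alpha> id t \<in> P \<longleftrightarrow> forms_region B fs t"
proof -
  note B' = lin_lattice_basis[OF B]
  obtain F :: "'a set set" and a b where "finite F \<and> P = {x. \<forall>h\<in>F. a h \<bullet> x \<le> b h} \<and>
      (\<forall>h\<in>F. \<forall>x\<in>\<Lambda>. a h \<bullet> x \<in> \<rat>) \<and> (\<forall>h\<in>F. b h \<in> \<rat>)"
    using halfspaces by (elim exE)
  then have F: "finite F" "P = {x. \<forall>h\<in>F. a h \<bullet> x \<le> b h}"
    "\<And>h x. h \<in> F \<Longrightarrow> x \<in> \<Lambda> \<Longrightarrow> a h \<bullet> x \<in> \<rat>" "\<And>h. h \<in> F \<Longrightarrow> b h \<in> \<rat>"
    by blast+
  have "\<exists>f::('a \<Rightarrow> int) \<times> int. \<forall>t. a h \<bullet> affine_map B \<alpha> id t \<le> b h \<longleftrightarrow>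
      (\<Sum>b\<in>B. of_int (fst f b) * t b) + of_int (snd f) \<ge> (0::real)" if h: "h \<in> F" for h
  proof -
    have "a h \<bullet> \<alpha> \<in> \<rat>"
    proof -
      have "(a h \<bullet> (real k0 *\<^sub>R \<alpha>)) / real k0 \<in> \<rat>" by (intro Rats_divide F(3) h index_point) auto
      then show ?thesis using index_gen(1) by simp
    qed
    moreover have "a h \<bullet> c \<in> \<rat>" if "c \<in> B" for c using F(3)[OF h] B'(5) that by auto
    ultimately have A: "finite (insert (b h - a h \<bullet> \<alpha>) ((\<lambda>c. a h \<bullet> c) ` B))"
      "insert (b h - a h \<bullet> \<alpha>) ((\<lambda>c. a h \<bullet> c) ` B) \<subseteq> \<rat>"
      using B'(1) F(4)[OF h] by auto
    obtain M :: int where M: "M > 0" "of_int M * (b h - a h \<bullet> \<alpha>) \<in> \<int>" "\<And>c. c \<in> B \<Longrightarrow> of_int M * (a h \<bullet> c) \<in> \<int>"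
      using common_denominator[OF A] by (metis image_eqI insertI1 insertI2)
    \<comment> \<open>The floors are exact, since \<open>M\<close> makes these numbers integers. The
      signs turn an upper bound into nonnegativity of a form.\<close>
    define f where "f = (\<lambda>c. - \<lfloor>of_int M * (a h \<bullet> c)\<rfloor>, \<lfloor>of_int M * (b h - a h \<bullet> \<alpha>)\<rfloor>)"
    have "(\<Sum>c\<in>B. of_int (fst f c) * t c) + of_int (snd f) = of_int M * (b h - a h \<bullet> affine_map B \<alpha> id t)" for t
    proof -
      have "(\<Sum>c\<in>B. of_int (fst f c) * t c) = (\<Sum>c\<in>B. - (of_int M * (t c * (a h \<bullet> c))))"
        by (intro sum.cong refl) (simp add: f_def M(3))
      also have "\<dots> = - (of_int M * (\<Sum>c\<in>B. t c * (a h \<bullet> c)))" by (simp add: sum_negf sum_distrib_left)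
      finally show ?thesis
        using M(2) by (simp add: f_def affine_map_def inner_add_right inner_sum_right algebra_simps)
    qed
    then have "a h \<bullet> affine_map B \<alpha> id t \<le> b h \<longleftrightarrow> (\<Sum>b\<in>B. of_int (fst f b) * t b) + of_int (snd f) \<ge> (0::real)" for t
      using M(1) by (simp add: zero_le_mult_iff)
    then show ?thesis by blast
  qed
  then obtain f where f: "\<And>h t. h \<in> F \<Longrightarrow> a h \<bullet> affine_map B \<alpha> id t \<le> b h \<longleftrightarrow>
      (\<Sum>b\<in>B. of_int (fst (f h) b) * t b) + of_int (snd (f h)) \<ge> (0::real)" by metis
  obtain fs where "set fs = f ` F" using F(1) finite_list[of "f ` F"] by auto
  moreover have "x \<in> P \<longleftrightarrow> (\<forall>h\<in>F. a h \<bullet> x \<le> b h)" for x using F(2) by blast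
  ultimately have "affine_map B \<alpha> id t \<in> P \<longleftrightarrow> forms_region B fs t" for t
    by (simp add: forms_region_def f)
  then show ?thesis by blast
qed

end

section \<open>The polynomial part\<close>

lemma polynomial_function_bounded_linear_compose:
  assumes "bounded_linear l" "polynomial_function f"
  shows "polynomial_function (\<lambda>x. l (f x))"
  unfolding polynomial_function_def
proof (intro allI impI)
  fix g assume "bounded_linear (g :: 'b \<Rightarrow> real)"
  then have "bounded_linear (\<lambda>x. g (l x))" using assms(1) by (rule bounded_linear_compose)
  then show "real_polynomial_function (g \<circ> (\<lambda>x. l (f x)))"
    using assms(2) unfolding polynomial_function_def o_def by blast
qed

lemma polynomial_function_complex_mult:
  fixes f g :: "'a::real_normed_vector \<Rightarrow> complex"
  assumes "polynomial_function f" "polynomial_function g"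
  shows "polynomial_function (\<lambda>x. f x * g x)"
proof -
  have f: "polynomial_function (\<lambda>x. Re (f x))" "polynomial_function (\<lambda>x. Im (f x))"
    using polynomial_function_bounded_linear_compose[OF bounded_linear_Re assms(1)]
      polynomial_function_bounded_linear_compose[OF bounded_linear_Im assms(1)] by auto
  have "polynomial_function (\<lambda>x. Re (f x) *\<^sub>R g x + Im (f x) *\<^sub>R (\<i> * g x))"
    using f assms(2) polynomial_function_bounded_linear_compose[OF bounded_linear_mult_right, of g \<i>]
    by (intro polynomial_function_add polynomial_function_mult) auto
  moreover have "(\<lambda>x. Re (f x) *\<^sub>R g x + Im (f x) *\<^sub>R (\<i> * g x)) = (\<lambda>x. f x * g x)"
    by (auto simp: fun_eq_iff complex_eq_iff)
  ultimately show ?thesis by simp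
qed

lemma poly_quasi_poly_add:
  assumes "poly_quasi_poly p" "poly_quasi_poly p'"
  shows "poly_quasi_poly (\<lambda>x. p x + p' x)"
proof -
  obtain m :: nat and f g where p: "\<forall>i<m. polynomial_function (f i) \<and> quasi_polynomial \<int> (g i)"
    "\<forall>\<xi>. \<forall>k\<in>\<int>. p (\<xi>, k) = (\<Sum>i<m. f i \<xi> * g i k)"
    using assms(1) unfolding poly_quasi_poly_def by (elim exE conjE)
  obtain m' :: nat and f' g' where p': "\<forall>i<m'. polynomial_function (f' i) \<and> quasi_polynomial \<int> (g' i)"
    "\<forall>\<xi>. \<forall>k\<in>\<int>. p' (\<xi>, k) = (\<Sum>i<m'. f' i \<xi> * g' i k)"
    using assms(2) unfolding poly_quasi_poly_def by (elim exE conjE)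
  define F where "F = (\<lambda>i. if i < m then f i else f' (i - m))"
  define G where "G = (\<lambda>i. if i < m then g i else g' (i - m))"
  have "(\<Sum>i<m + n. F i \<xi> * G i k) = (\<Sum>i<m. f i \<xi> * g i k) + (\<Sum>i<n. f' i \<xi> * g' i k)" for n \<xi> k
    by (induction n) (auto simp: F_def G_def add.assoc)
  then have "\<forall>\<xi>. \<forall>k\<in>\<int>. p (\<xi>, k) + p' (\<xi>, k) = (\<Sum>i<m + m'. F i \<xi> * G i k)"
    using p p' by simp
  moreover have "\<forall>i<m + m'. polynomial_function (F i) \<and> quasi_polynomial \<int> (G i)"
    using p p' by (auto simp: F_def G_def)
  ultimately show ?thesis unfolding poly_quasi_poly_def by blast
qed

lemma poly_quasi_poly_product:
  assumes "polynomial_function f" "quasi_polynomial \<int> g"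
  shows "poly_quasi_poly (\<lambda>(\<xi>, k). f \<xi> * g k)"
  unfolding poly_quasi_poly_def using assms
  by (intro exI[of _ 1] exI[of _ "\<lambda>_. f"] exI[of _ "\<lambda>_. g"]) auto

lemma poly_quasi_poly_cong:
  assumes "poly_quasi_poly p" "\<And>\<xi> k. k \<in> \<int> \<Longrightarrow> p' (\<xi>, k) = p (\<xi>, k)"
  shows "poly_quasi_poly p'"
  using assms unfolding poly_quasi_poly_def by simp

lemma poly_quasi_poly_sum:
  assumes "finite I" "\<And>i. i \<in> I \<Longrightarrow> poly_quasi_poly (p i)"
  shows "poly_quasi_poly (\<lambda>x. \<Sum>i\<in>I. p i x)"
  using assms
proof (induction I rule: finite_induct)
  case empty
  have "poly_quasi_poly (\<lambda>(\<xi>, k). 0 * 0)"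
    by (rule poly_quasi_poly_product) (auto intro: quasi_polynomial.polynomial)
  then show ?case by (rule poly_quasi_poly_cong) auto
qed (simp add: poly_quasi_poly_add)

lemma poly_quasi_poly_mult:
  assumes "poly_quasi_poly p" "poly_quasi_poly p'"
  shows "poly_quasi_poly (\<lambda>x. p x * p' x)"
proof -
  obtain m :: nat and f g where p: "\<forall>i<m. polynomial_function (f i) \<and> quasi_polynomial \<int> (g i)"
    "\<forall>\<xi>. \<forall>k\<in>\<int>. p (\<xi>, k) = (\<Sum>i<m. f i \<xi> * g i k)"
    using assms(1) unfolding poly_quasi_poly_def by (elim exE conjE)
  obtain m' :: nat and f' g' where p': "\<forall>i<m'. polynomial_function (f' i) \<and> quasi_polynomial \<int> (g' i)"
    "\<forall>\<xi>. \<forall>k\<in>\<int>. p' (\<xi>, k) = (\<Sum>i<m'. f' i \<xi> * g' i k)"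
    using assms(2) unfolding poly_quasi_poly_def by (elim exE conjE)
  have prod: "poly_quasi_poly (\<lambda>x. \<Sum>i<m. \<Sum>j<m'. (\<lambda>(\<xi>, k). (f i \<xi> * f' j \<xi>) * (g i k * g' j k)) x)"
    using p p' by (intro poly_quasi_poly_sum poly_quasi_poly_product polynomial_function_complex_mult quasi_polynomial.mult) auto
  have "(\<Sum>i<m. f i \<xi> * g i k) * (\<Sum>j<m'. f' j \<xi> * g' j k) =
      (\<Sum>i<m. \<Sum>j<m'. (f i \<xi> * f' j \<xi>) * (g i k * g' j k))" for \<xi> k
    unfolding sum_product by (intro sum.cong refl) simp
  then show ?thesis
    by (intro poly_quasi_poly_cong[OF prod]) (simp add: p p')
qed

lemma poly_quasi_poly_fst: "polynomial_function f \<Longrightarrow> poly_quasi_poly (\<lambda>x. f (fst x))"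
  by (rule poly_quasi_poly_cong[OF poly_quasi_poly_product[of f "\<lambda>_. 1"]])
    (auto intro: quasi_polynomial.polynomial)

lemma poly_quasi_poly_snd: "quasi_polynomial \<int> g \<Longrightarrow> poly_quasi_poly (\<lambda>x. g (snd x))"
  by (rule poly_quasi_poly_cong[OF poly_quasi_poly_product[of "\<lambda>_. 1" g]]) auto

text \<open>It rewrites a polynomial on the cone space in the coordinates \<open>(\<xi>, u)\<close>
  that \<open>cone_polynomial_part\<close> uses. A linear form splits into a part in
  \<open>\<xi>\<close> and a part in \<open>u\<close>, and sums and products preserve the
  class.\<close>

lemma poly_quasi_poly_shear:
  fixes h :: "'a::real_normed_vector \<times> real \<Rightarrow> complex"
  assumes "polynomial_function h"
  shows "poly_quasi_poly (\<lambda>(\<xi>, u). h (\<xi> + (u * c) *\<^sub>R \<alpha>, u * c))"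
proof -
  have real: "poly_quasi_poly (\<lambda>x. complex_of_real (h (fst x + (snd x * c) *\<^sub>R \<alpha>, snd x * c)))"
    if "real_polynomial_function h" for h :: "'a \<times> real \<Rightarrow> real"
    using that
  proof induction
    case (linear h)
    note h = linear
    interpret bounded_linear h by (rule h)
    have "h (\<xi> + (u * c) *\<^sub>R \<alpha>, u * c) = h (\<xi>, 0) + u * (c * h (\<alpha>, 1))" for \<xi> u
    proof -
      have "(\<xi> + (u * c) *\<^sub>R \<alpha>, u * c) = (\<xi>, 0) + (u * c) *\<^sub>R (\<alpha>, 1)" by simp
      then show ?thesis by (simp only: add scaleR) simp
    qed
    moreover have "poly_quasi_poly (\<lambda>x. complex_of_real (h (fst x, 0)) + complex_of_real (snd x) * complex_of_real (c * h (\<alpha>, 1)))"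
    proof (rule poly_quasi_poly_add)
      have "bounded_linear (\<lambda>\<xi>. h (\<xi>, 0))"
        by (rule bounded_linear_compose[OF h]) (intro bounded_linear_Pair bounded_linear_ident bounded_linear_zero)
      then show "poly_quasi_poly (\<lambda>x. complex_of_real (h (fst x, 0)))"
        by (intro poly_quasi_poly_fst[where f = "\<lambda>\<xi>. complex_of_real (h (\<xi>, 0))"] polynomial_function_bounded_linear
            bounded_linear_compose[OF bounded_linear_of_real])
      have "polynomial_function (\<lambda>u. complex_of_real u * complex_of_real (c * h (\<alpha>, 1)))"
        by (intro polynomial_function_complex_mult polynomial_function_const
            polynomial_function_bounded_linear bounded_linear_of_real)
      then show "poly_quasi_poly (\<lambda>x. complex_of_real (snd x) * complex_of_real (c * h (\<alpha>, 1)))"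
        by (intro poly_quasi_poly_snd[where g = "\<lambda>u. complex_of_real u * complex_of_real (c * h (\<alpha>, 1))"] quasi_polynomial.polynomial)
    qed
    ultimately show ?case by simp
  next
    case (const y)
    show ?case by (rule poly_quasi_poly_fst[where f = "\<lambda>_. complex_of_real y"]) simp
  next
    case (add f g)
    then show ?case by (simp add: poly_quasi_poly_add)
  next
    case (mult f g)
    then show ?case by (simp add: poly_quasi_poly_mult)
  qed
  have re: "real_polynomial_function (\<lambda>x. Re (h x))" and im: "real_polynomial_function (\<lambda>x. Im (h x))"
    using assms bounded_linear_Re bounded_linear_Im unfolding polynomial_function_def o_def by auto
  have i: "poly_quasi_poly (\<lambda>x::'a \<times> real. \<i>)"
    by (rule poly_quasi_poly_fst[where f = "\<lambda>_. \<i>"]) simp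
  show ?thesis
    by (rule poly_quasi_poly_cong[OF poly_quasi_poly_add[OF real[OF re] poly_quasi_poly_mult[OF i real[OF im]]]])
      (simp add: complex_eq[symmetric])
qed

lemma poly_quasi_poly_polynomial:
  assumes "poly_quasi_poly p" "k \<in> \<int>"
  shows "polynomial_function (\<lambda>\<xi>. p (\<xi>, k))"
proof -
  obtain m :: nat and f g where p: "\<forall>i<m. polynomial_function (f i) \<and> quasi_polynomial \<int> (g i)"
    "\<forall>\<xi>. \<forall>k\<in>\<int>. p (\<xi>, k) = (\<Sum>i<m. f i \<xi> * g i k)"
    using assms(1) unfolding poly_quasi_poly_def by (elim exE conjE)
  have "polynomial_function (\<lambda>\<xi>. \<Sum>i<m. f i \<xi> * g i k)"
    using p(1) by (intro polynomial_function_sum polynomial_function_complex_mult) auto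
  then show ?thesis using p(2) assms(2) by simp
qed

section \<open>Polynomials vanishing on lattice cosets\<close>

lemma real_polynomial_zero:
  fixes f :: "real \<Rightarrow> real"
  assumes "real_polynomial_function f" "\<And>m::int. f (of_int D * of_int m) = 0" "D > 0"
  shows "f t = 0"
proof -
  obtain a n where f: "f = (\<lambda>x. \<Sum>i\<le>n. a i * x ^ i)"
    using assms(1) unfolding real_polynomial_function_iff_sum by blast
  have "infinite (range (\<lambda>m::int. real_of_int D * of_int m))"
    using assms(3) finite_imageD[of "\<lambda>m::int. real_of_int D * of_int m" UNIV] infinite_UNIV_int
    by (auto simp: inj_on_def)
  moreover have "range (\<lambda>m::int. real_of_int D * of_int m) \<subseteq> {x. (\<Sum>i\<le>n. a i * x ^ i) = 0}"
    using assms(2) f by auto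
  ultimately have "infinite {x. (\<Sum>i\<le>n. a i * x ^ i) = 0}" using finite_subset by blast
  then have "\<forall>i\<le>n. a i = 0" using polyfun_finite_roots[of a n] by blast
  then show ?thesis by (simp add: f)
qed

text \<open>Coordinates are released one at a time: \<open>S\<close> collects those that may already
  be arbitrary reals. In the next coordinate the function is a polynomial with infinitely many
  zeros.\<close>

lemma polynomial_zero_on_lattice_coset:
  fixes f :: "'a::real_normed_vector \<Rightarrow> complex"
  assumes f: "polynomial_function f" and B: "finite B" and D: "D > 0" and x0: "x0 \<in> span B"
    and zero: "\<And>m::'a \<Rightarrow> int. f (x0 + (\<Sum>b\<in>B. (of_int D * of_int (m b)) *\<^sub>R b)) = 0"
    and \<xi>: "\<xi> \<in> span B"
  shows "f \<xi> = 0"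
proof -
  have all: "f (x0 + (\<Sum>b\<in>B. t b *\<^sub>R b)) = 0" if "finite S" "S \<subseteq> B" "\<forall>b\<in>B - S. \<exists>m::int. t b = of_int D * of_int m" for S t
    using that
  proof (induction S arbitrary: t rule: finite_induct)
    case empty
    then obtain m :: "'a \<Rightarrow> int" where "\<forall>b\<in>B. t b = of_int D * of_int (m b)" by (metis Diff_empty)
    then show ?case using zero[of m] by (simp cong: sum.cong)
  next
    case (insert c S)
    define y where "y = x0 + (\<Sum>b\<in>B - {c}. t b *\<^sub>R b)"
    define g where "g = (\<lambda>s. f (y + s *\<^sub>R c))"
    have eq: "g s = f (x0 + (\<Sum>b\<in>B. (t(c := s)) b *\<^sub>R b))" for s
    proof -
      have "(\<Sum>b\<in>B. (t(c := s)) b *\<^sub>R b) = s *\<^sub>R c + (\<Sum>b\<in>B - {c}. (t(c := s)) b *\<^sub>R b)"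
        using insert.prems B by (subst sum.remove[of _ c]) auto
      also have "(\<Sum>b\<in>B - {c}. (t(c := s)) b *\<^sub>R b) = (\<Sum>b\<in>B - {c}. t b *\<^sub>R b)"
        by (intro sum.cong) auto
      finally show ?thesis by (simp add: g_def y_def algebra_simps)
    qed
    have "polynomial_function (\<lambda>s. y + s *\<^sub>R c)"
      by (intro polynomial_function_add polynomial_function_const polynomial_function_bounded_linear bounded_linear_scaleR_left)
    then have g: "polynomial_function g"
      unfolding g_def using polynomial_function_compose[OF _ f] by (simp add: o_def)
    have "g (of_int D * of_int m) = 0" for m :: int
      unfolding eq using insert.prems by (intro insert.IH) (auto split: if_splits)
    moreover have "real_polynomial_function (\<lambda>s. Re (g s))" "real_polynomial_function (\<lambda>s. Im (g s))"
      using g bounded_linear_Re bounded_linear_Im unfolding polynomial_function_def o_def by auto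
    ultimately have "Re (g (t c)) = 0" "Im (g (t c)) = 0"
      using real_polynomial_zero[OF _ _ D, of "\<lambda>s. Re (g s)" "t c"] real_polynomial_zero[OF _ _ D, of "\<lambda>s. Im (g s)" "t c"]
      by simp_all
    then have "g (t c) = 0" by (simp add: complex_eq_iff)
    then show ?case unfolding eq by simp
  qed
  have "\<xi> - x0 \<in> span B" using \<xi> x0 by (rule span_diff)
  then obtain t where "\<xi> - x0 = (\<Sum>b\<in>B. t b *\<^sub>R b)" unfolding span_finite[OF B] by auto
  then have "\<xi> = x0 + (\<Sum>b\<in>B. t b *\<^sub>R b)" by (simp add: algebra_simps)
  then show ?thesis using all[of B t] B by simp
qed

section \<open>Cosets, residues and averages\<close>

definition lattice_point :: "'a::real_vector set \<Rightarrow> ('a \<Rightarrow> int) \<Rightarrow> 'a" where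
  "lattice_point B n = (\<Sum>b\<in>B. of_int (n b) *\<^sub>R b)"

lemma lattice_point_shift: "lattice_point B (\<lambda>b. n b + D * m b) = lattice_point B n + of_int D *\<^sub>R lattice_point B m"
  by (simp add: lattice_point_def scaleR_add_left sum.distrib scaleR_sum_right)

lemma lattice_point_add: "lattice_point B (\<lambda>b. n b + m b) = lattice_point B n + lattice_point B m"
  using lattice_point_shift[of B n 1 m] by simp

lemma lattice_point_restrict: "lattice_point B (restrict n B) = lattice_point B n"
  by (simp add: lattice_point_def cong: sum.cong)

lemma lattice_point_mod:
  "lattice_point B (\<lambda>b\<in>B. n b mod D) = lattice_point B n - of_int D *\<^sub>R lattice_point B (\<lambda>b. n b div D)"
proof -
  have "lattice_point B n = lattice_point B (\<lambda>b. n b mod D + D * (n b div D))" by simp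
  then show ?thesis unfolding lattice_point_shift lattice_point_restrict by simp
qed

lemma int_span_altdef: "int_span B = range (lattice_point B)"
  by (auto simp: int_span_def lattice_point_def)

lemma lattice_coset_eq_iff:
  assumes "additive_subgroup \<Gamma>"
  shows "(+) x ` \<Gamma> = (+) y ` \<Gamma> \<longleftrightarrow> x - y \<in> \<Gamma>"
proof
  assume "(+) x ` \<Gamma> = (+) y ` \<Gamma>"
  then have "x \<in> (+) y ` \<Gamma>" using additive_subgroupD(1)[OF assms] by (force simp: image_iff)
  then show "x - y \<in> \<Gamma>" by auto
next
  have *: "(+) x ` \<Gamma> \<subseteq> (+) y ` \<Gamma>" if "x - y \<in> \<Gamma>" for x y
  proof
    fix z assume "z \<in> (+) x ` \<Gamma>"
    then obtain g where "g \<in> \<Gamma>" "z = x + g" by auto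
    then have "(x - y) + g \<in> \<Gamma>" "z = y + ((x - y) + g)" using additive_subgroupD(3)[OF assms that] by auto
    then show "z \<in> (+) y ` \<Gamma>" by blast
  qed
  assume "x - y \<in> \<Gamma>"
  moreover from this have "y - x \<in> \<Gamma>" using additive_subgroupD(4)[OF assms, of "x - y"] by simp
  ultimately show "(+) x ` \<Gamma> = (+) y ` \<Gamma>" using *[of x y] *[of y x] by blast
qed

text \<open>By pigeonhole some \<open>j\<close> between 1 and the index sends a given
  \<open>x\<close> into \<open>\<Gamma>\<close>, and the factorial of the index is a multiple of
  every such \<open>j\<close>.\<close>

lemma finite_index_multiple:
  assumes L: "additive_subgroup L" and \<Gamma>: "additive_subgroup \<Gamma>" and fin: "finite (lattice_cosets L \<Gamma>)"
  shows "\<exists>N::int. N > 0 \<and> (\<forall>x\<in>L. of_int N *\<^sub>R x \<in> \<Gamma>)"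
proof -
  define c where "c = card (lattice_cosets L \<Gamma>)"
  have "\<exists>j\<in>{1..c}. of_int (int j) *\<^sub>R x \<in> \<Gamma>" if x: "x \<in> L" for x
  proof -
    let ?f = "\<lambda>j::nat. (+) (of_int (int j) *\<^sub>R x) ` \<Gamma>"
    have "?f ` {0..c} \<subseteq> lattice_cosets L \<Gamma>"
      unfolding lattice_cosets_def using additive_subgroup_scaleR[OF L x] by (auto simp del: of_int_of_nat_eq)
    then have "card (?f ` {0..c}) \<le> c" unfolding c_def using fin by (intro card_mono)
    then have "\<not> inj_on ?f {0..c}" by (intro pigeonhole) simp
    then obtain i j where ij: "i \<le> c" "j \<le> c" "i < j" "?f i = ?f j"
      by (auto simp: inj_on_def) (metis linorder_neqE_nat)
    have "of_int (int j) *\<^sub>R x - of_int (int i) *\<^sub>R x \<in> \<Gamma>"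
      using ij(4) lattice_coset_eq_iff[OF \<Gamma>] by metis
    then have "of_int (int (j - i)) *\<^sub>R x \<in> \<Gamma>"
      using ij(3) by (simp add: scaleR_diff_left[symmetric] of_nat_diff)
    then show ?thesis using ij by (intro bexI[of _ "j - i"]) auto
  qed
  then have "of_int (int (fact c)) *\<^sub>R x \<in> \<Gamma>" if "x \<in> L" for x
  proof -
    obtain j where j: "j \<in> {1..c}" "of_int (int j) *\<^sub>R x \<in> \<Gamma>"
      using \<open>\<And>x. x \<in> L \<Longrightarrow> \<exists>j\<in>{1..c}. of_int (int j) *\<^sub>R x \<in> \<Gamma>\<close> \<open>x \<in> L\<close> by blast
    have "j dvd fact c" using j(1) by (intro dvd_fact) auto
    then obtain m where "fact c = j * m" by (rule dvdE)
    then have "of_int (int (fact c)) *\<^sub>R x = of_int (int m) *\<^sub>R (of_int (int j) *\<^sub>R x)"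
      by (simp add: mult.commute flip: of_nat_mult)
    then show ?thesis using additive_subgroup_scaleR[OF \<Gamma> j(2)] by metis
  qed
  then show ?thesis by (intro exI[of _ "int (fact c)"]) simp
qed

text \<open>The residues modulo \<open>D\<close> are equidistributed among the cosets, because translation by a lattice
  vector permutes both.\<close>

lemma average_over_residues:
  fixes p :: "'a::real_vector set \<Rightarrow> complex"
  assumes B: "lattice_basis B L" and \<Gamma>: "additive_subgroup \<Gamma>" "\<Gamma> \<subseteq> L"
    and D: "D > 0" "\<And>x. x \<in> L \<Longrightarrow> of_int D *\<^sub>R x \<in> \<Gamma>"
  shows "(\<Sum>C\<in>lattice_cosets L \<Gamma>. p C) / of_nat (card (lattice_cosets L \<Gamma>)) =
    (\<Sum>n\<in>Pi\<^sub>E B (\<lambda>_. {0..<D}). p ((+) (lattice_point B n) ` \<Gamma>)) / of_int D ^ card B"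
proof -
  define T where "T = Pi\<^sub>E B (\<lambda>_. {0..<D})"
  define f where "f = (\<lambda>n. (+) (lattice_point B n) ` \<Gamma>)"
  have finB: "finite B" and L: "L = range (lattice_point B)"
    using B by (auto simp: lattice_basis_altdef int_span_altdef)
  have finT: "finite T" using finB by (auto simp: T_def intro: finite_PiE)
  have cardT: "card T = nat D ^ card B" using finB by (simp add: T_def card_PiE)
  have fmod: "f (\<lambda>b\<in>B. n b mod D) = f n" for n
  proof -
    have "lattice_point B (\<lambda>b\<in>B. n b mod D) - lattice_point B n \<in> \<Gamma>"
      unfolding lattice_point_mod using additive_subgroupD(4)[OF \<Gamma>(1) D(2)] L by auto
    then show ?thesis unfolding f_def lattice_coset_eq_iff[OF \<Gamma>(1)] .
  qed
  have modT: "(\<lambda>b\<in>B. n b mod D) \<in> T" for n :: "'a \<Rightarrow> int" using D(1) by (auto simp: T_def)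
  have img: "f ` T = lattice_cosets L \<Gamma>"
  proof
    show "f ` T \<subseteq> lattice_cosets L \<Gamma>" by (auto simp: f_def lattice_cosets_def L)
    show "lattice_cosets L \<Gamma> \<subseteq> f ` T"
    proof
      fix C assume "C \<in> lattice_cosets L \<Gamma>"
      then obtain n where "C = f n" by (auto simp: f_def lattice_cosets_def L)
      then show "C \<in> f ` T" using fmod[of n] modT[of n] by (intro image_eqI) auto
    qed
  qed
  have le: "card {n\<in>T. f n = f m} \<le> card {n\<in>T. f n = f m'}" for m m'
  proof (rule card_inj_on_le)
    \<comment> \<open>Translation by \<open>c\<close>, reduced modulo \<open>D\<close>, carries the
      residues over the coset of \<open>m\<close> injectively to residues over the coset of
      \<open>m'\<close>. By symmetry all cosets have equally many residues.\<close>
    define c where "c = (\<lambda>b. m' b - m b)"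
    let ?h = "\<lambda>n. \<lambda>b\<in>B. (n b + c b) mod D"
    show "inj_on ?h {n\<in>T. f n = f m}"
    proof (rule inj_onI)
      fix x y assume xy: "x \<in> {n\<in>T. f n = f m}" "y \<in> {n\<in>T. f n = f m}" "?h x = ?h y"
      have "x b = y b" if b: "b \<in> B" for b
      proof -
        have "(x b + c b) mod D = (y b + c b) mod D" using fun_cong[OF xy(3), of b] b by simp
        then have "D dvd (x b - y b)" by (simp add: mod_eq_dvd_iff)
        then have "x b mod D = y b mod D" by (simp add: mod_eq_dvd_iff)
        moreover have "0 \<le> x b" "x b < D" "0 \<le> y b" "y b < D" using xy(1,2) b by (auto simp: T_def PiE_iff)
        ultimately show ?thesis by simp
      qed
      then show "x = y" using xy(1,2) by (intro extensionalityI[of _ B]) (auto simp: T_def PiE_def)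
    qed
    show "?h ` {n\<in>T. f n = f m} \<subseteq> {n\<in>T. f n = f m'}"
    proof
      fix y assume "y \<in> ?h ` {n\<in>T. f n = f m}"
      then obtain n where n: "n \<in> T" "f n = f m" "y = ?h n" by auto
      have "f y = f (\<lambda>b. n b + c b)" unfolding n(3) by (rule fmod)
      also have "\<dots> = f m'"
      proof -
        have "lattice_point B n - lattice_point B m \<in> \<Gamma>" using n(2) unfolding f_def lattice_coset_eq_iff[OF \<Gamma>(1)] .
        moreover have "lattice_point B m' = lattice_point B m + lattice_point B c"
          unfolding lattice_point_add[symmetric] by (simp add: c_def)
        ultimately show ?thesis unfolding f_def lattice_coset_eq_iff[OF \<Gamma>(1)] lattice_point_add by simp
      qed
      finally show "y \<in> {n\<in>T. f n = f m'}" using modT n(3) by simp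
    qed
  qed (use finT in simp)
  define K where "K = card {n\<in>T. f n = f (\<lambda>_. 0)}"
  have K: "card {n\<in>T. f n = C} = K" if "C \<in> f ` T" for C
    using that unfolding K_def by (auto intro!: le_antisym le)
  have group: "(\<Sum>n\<in>T. g (f n)) = of_nat K * (\<Sum>C\<in>f ` T. g C)" for g :: "'a set \<Rightarrow> complex"
  proof -
    have "(\<Sum>n\<in>T. g (f n)) = (\<Sum>C\<in>f ` T. \<Sum>n\<in>{n\<in>T. f n = C}. g (f n))"
      by (rule sum.image_gen[OF finT])
    also have "\<dots> = (\<Sum>C\<in>f ` T. of_nat K * g C)"
      by (intro sum.cong refl) (simp add: K)
    finally show ?thesis by (simp add: sum_distrib_left)
  qed
  have "of_nat (card T) = (of_nat K * of_nat (card (f ` T)) :: complex)" using group[of "\<lambda>_. 1"] by simp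
  moreover have "of_nat (card T) = (of_int D ^ card B :: complex)" using D(1) by (simp add: cardT)
  ultimately have eq: "of_int D ^ card B = (of_nat K * of_nat (card (f ` T)) :: complex)" by simp
  then have "of_nat K \<noteq> (0 :: complex)" using D(1) by (metis mult_zero_left of_int_0_eq_iff power_not_zero less_irrefl)
  moreover have "(\<Sum>n\<in>T. p ((+) (lattice_point B n) ` \<Gamma>)) = of_nat K * (\<Sum>C\<in>lattice_cosets L \<Gamma>. p C)"
    using group[of p] unfolding img by (simp add: f_def)
  ultimately show ?thesis
    unfolding T_def[symmetric] eq img by simp
qed

lemma int_quasi_polynomial:
  assumes "D > 0" "\<And>k k'. k mod D = k' mod D \<Longrightarrow> e k = e (k'::int)"
  shows "quasi_polynomial \<int> (\<lambda>u::real. e \<lfloor>u\<rfloor>)"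
proof (rule quasi_polynomial.periodic)
  have "e \<lfloor>x + real (nat D) * y\<rfloor> = e \<lfloor>x\<rfloor>" if xy: "x \<in> \<int>" "y \<in> \<int>" for x y
  proof -
    obtain m n :: int where "x = of_int m" "y = of_int n" using xy by (metis Ints_cases)
    then have "\<lfloor>x + real (nat D) * y\<rfloor> = m + D * n" "\<lfloor>x\<rfloor> = m"
      using assms(1) by (simp_all flip: of_int_mult of_int_add)
    then show ?thesis using assms(2)[of "m + D * n" m] by simp
  qed
  then show "periodic_on \<int> (\<lambda>u::real. e \<lfloor>u\<rfloor>)"
    unfolding periodic_on_def using assms(1) by (intro exI[of _ "nat D"]) simp
qed

text \<open>The \<open>e i\<close> are constant on cosets of \<open>D L\<close>, so a decomposition
  exists and \<open>polynomial_part\<close> chooses one, possibly for another sublattice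
  \<open>\<Gamma>\<close>. Modulo a multiple \<open>D'\<close> of \<open>D * N\<close>, where
  \<open>N L \<subseteq> \<Gamma>\<close>, residues determine both the coset of
  \<open>\<Gamma>\<close> and the coefficients, and the average over cosets becomes one over
  residues. All multiples are allowed because the final period contains a further factor.\<close>

theorem polynomial_part_eq:
  fixes q :: "'a::real_normed_vector \<times> real \<Rightarrow> complex"
  assumes B: "lattice_basis B L" and "\<forall>i<m::nat. periodic_coeff B D (e i)" and D: "D > 0"
    and "\<forall>i<m. poly_quasi_poly (g i)"
    and q: "\<And>n (u::int). q (lattice_point B n, of_int u) = (\<Sum>i<m. e i n u * g i (lattice_point B n, of_int u))"
  shows "(\<forall>u::int. polynomial_function (\<lambda>\<xi>. polynomial_part L q (\<xi>, of_int u))) \<and>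
    (\<exists>D0>0. D dvd D0 \<and> (\<forall>D'>0. D0 dvd D' \<longrightarrow> (\<forall>u::int. \<forall>\<xi>\<in>span B. polynomial_part L q (\<xi>, of_int u) =
      (\<Sum>i<m. (\<Sum>n\<in>Pi\<^sub>E B (\<lambda>_. {0..<D'}). e i n u) / of_int D' ^ card B * g i (\<xi>, of_int u)))))"
proof -
  note e = assms(2)[rule_format] and g = assms(4)[rule_format]
  have finB: "finite B" and indB: "independent B" and L: "L = range (lattice_point B)"
    using B by (auto simp: lattice_basis_altdef int_span_altdef)
  have Lsub: "additive_subgroup L" using B additive_subgroup_int_span by (auto simp: lattice_basis_altdef)
  have pq: "poly_quasi_poly (\<lambda>(\<xi>, u). \<Sum>i<m. e i n \<lfloor>u\<rfloor> * g i (\<xi>, u))" for n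
  proof -
    have "poly_quasi_poly (\<lambda>x. \<Sum>i<m. (\<lambda>x. e i n \<lfloor>snd x\<rfloor>) x * g i x)"
    proof (intro poly_quasi_poly_sum poly_quasi_poly_mult)
      fix i assume "i \<in> {..<m}"
      then show "poly_quasi_poly (g i)" using g by simp
      show "poly_quasi_poly (\<lambda>x::'a \<times> real. e i n \<lfloor>snd x\<rfloor>)"
        using e[of i] \<open>i \<in> _\<close>
        by (intro poly_quasi_poly_snd[where g = "\<lambda>u. e i n \<lfloor>u\<rfloor>"] int_quasi_polynomial[OF D]) (auto intro: periodic_coeffD)
    qed simp
    then show ?thesis by (rule poly_quasi_poly_cong) simp
  qed
  define \<Gamma>0 where "\<Gamma>0 = (\<lambda>x. of_int D *\<^sub>R x) ` L"
  have \<Gamma>0_sub: "additive_subgroup \<Gamma>0"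
    unfolding additive_subgroup_def
  proof (intro conjI ballI)
    show "0 \<in> \<Gamma>0" using additive_subgroupD(1)[OF Lsub] by (force simp: \<Gamma>0_def)
    fix x y assume "x \<in> \<Gamma>0" "y \<in> \<Gamma>0"
    then obtain x' y' where "x' \<in> L" "y' \<in> L" "x = of_int D *\<^sub>R x'" "y = of_int D *\<^sub>R y'" by (auto simp: \<Gamma>0_def)
    then show "x - y \<in> \<Gamma>0"
      using additive_subgroupD(2)[OF Lsub, of x' y'] by (auto simp: \<Gamma>0_def scaleR_diff_right[symmetric])
  qed
  have \<Gamma>0_L: "\<Gamma>0 \<subseteq> L" using additive_subgroup_scaleR[OF Lsub] by (auto simp: \<Gamma>0_def)
  have "is_lattice \<Gamma>0"
    using subgroup_lattice_basis[OF finB indB \<Gamma>0_sub] \<Gamma>0_L by (auto simp: is_lattice_def L int_span_altdef)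
  have cosets: "lattice_cosets L \<Gamma>0 = (\<lambda>n. (+) (lattice_point B n) ` \<Gamma>0) ` Pi\<^sub>E B (\<lambda>_. {0..<D})"
  proof
    show "lattice_cosets L \<Gamma>0 \<subseteq> (\<lambda>n. (+) (lattice_point B n) ` \<Gamma>0) ` Pi\<^sub>E B (\<lambda>_. {0..<D})"
    proof
      fix C assume "C \<in> lattice_cosets L \<Gamma>0"
      then obtain n where n: "C = (+) (lattice_point B n) ` \<Gamma>0" by (auto simp: lattice_cosets_def L)
      have "lattice_point B n - lattice_point B (\<lambda>b\<in>B. n b mod D) \<in> \<Gamma>0"
        unfolding lattice_point_mod by (auto simp: \<Gamma>0_def L)
      then have "C = (+) (lattice_point B (\<lambda>b\<in>B. n b mod D)) ` \<Gamma>0"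
        unfolding n lattice_coset_eq_iff[OF \<Gamma>0_sub] .
      moreover have "(\<lambda>b\<in>B. n b mod D) \<in> Pi\<^sub>E B (\<lambda>_. {0..<D})" using D by auto
      ultimately show "C \<in> (\<lambda>n. (+) (lattice_point B n) ` \<Gamma>0) ` Pi\<^sub>E B (\<lambda>_. {0..<D})" by blast
    qed
  qed (auto simp: lattice_cosets_def L)
  have "finite (lattice_cosets L \<Gamma>0)"
    unfolding cosets using finB by (intro finite_imageI finite_PiE) auto
  have "\<exists>p. polynomial_decomposition L q \<Gamma>0 p"
  proof -
    have "\<exists>pc. poly_quasi_poly pc \<and> (\<forall>x\<in>C. \<forall>k\<in>\<int>. q (x, k) = pc (x, k))" if "C \<in> lattice_cosets L \<Gamma>0" for C
    proof -
      obtain n where n: "C = (+) (lattice_point B n) ` \<Gamma>0" using \<open>C \<in> _\<close> by (auto simp: lattice_cosets_def L)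
      have "q (x, k) = (\<Sum>i<m. e i n \<lfloor>k\<rfloor> * g i (x, k))" if x: "x \<in> C" and k: "k \<in> \<int>" for x k
      proof -
        obtain l where "x = lattice_point B n + of_int D *\<^sub>R lattice_point B l"
          using x unfolding n \<Gamma>0_def L by blast
        then have x': "x = lattice_point B (\<lambda>b. n b + D * l b)" by (simp add: lattice_point_shift)
        obtain u :: int where k': "k = of_int u" using k by (rule Ints_cases)
        have "e i (\<lambda>b. n b + D * l b) u = e i n u" if "i < m" for i
          by (rule periodic_coeffD[OF e[OF that]]) auto
        then show ?thesis unfolding x' k' q by simp
      qed
      then show ?thesis using pq[of n] by (intro exI[of _ "\<lambda>(\<xi>, u). \<Sum>i<m. e i n \<lfloor>u\<rfloor> * g i (\<xi>, u)"]) auto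
    qed
    then obtain p where "\<And>C. C \<in> lattice_cosets L \<Gamma>0 \<Longrightarrow> poly_quasi_poly (p C) \<and> (\<forall>x\<in>C. \<forall>k\<in>\<int>. q (x, k) = p C (x, k))"
      by metis
    then show ?thesis
      unfolding polynomial_decomposition_def
      using \<open>is_lattice \<Gamma>0\<close> \<Gamma>0_L \<open>finite (lattice_cosets L \<Gamma>0)\<close> by blast
  qed
  then have "\<exists>Q \<Gamma> p. polynomial_decomposition L q \<Gamma> p \<and>
     Q = (\<lambda>x. (\<Sum>C \<in> lattice_cosets L \<Gamma>. p C x) / of_nat (card (lattice_cosets L \<Gamma>)))" by blast
  from someI_ex[OF this] obtain \<Gamma> p where dec: "polynomial_decomposition L q \<Gamma> p"
    and Q: "polynomial_part L q = (\<lambda>x. (\<Sum>C \<in> lattice_cosets L \<Gamma>. p C x) / of_nat (card (lattice_cosets L \<Gamma>)))"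
    unfolding polynomial_part_def by blast
  have \<Gamma>: "additive_subgroup \<Gamma>" "\<Gamma> \<subseteq> L" "finite (lattice_cosets L \<Gamma>)"
    and pC: "\<And>C. C \<in> lattice_cosets L \<Gamma> \<Longrightarrow> poly_quasi_poly (p C)"
      "\<And>C x k. C \<in> lattice_cosets L \<Gamma> \<Longrightarrow> x \<in> C \<Longrightarrow> k \<in> \<int> \<Longrightarrow> q (x, k) = p C (x, k)"
    using dec additive_subgroup_int_span
    unfolding polynomial_decomposition_def is_lattice_def lattice_basis_altdef by auto
  obtain N :: int where N: "N > 0" "\<And>x. x \<in> L \<Longrightarrow> of_int N *\<^sub>R x \<in> \<Gamma>"
    using finite_index_multiple[OF Lsub \<Gamma>(1,3)] by blast
  have poly: "polynomial_function (\<lambda>\<xi>. polynomial_part L q (\<xi>, of_int u))" for u :: int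
    unfolding Q divide_inverse
    by (intro polynomial_function_complex_mult polynomial_function_sum polynomial_function_const
        poly_quasi_poly_polynomial pC \<Gamma>(3)) auto
  have "polynomial_part L q (\<xi>, of_int u) =
      (\<Sum>i<m. (\<Sum>n\<in>Pi\<^sub>E B (\<lambda>_. {0..<D'}). e i n u) / of_int D' ^ card B * g i (\<xi>, of_int u))"
    if D': "D' > 0" "D * N dvd D'" and \<xi>: "\<xi> \<in> span B" for D' \<xi> and u :: int
  proof -
    have D'\<Gamma>: "of_int D' *\<^sub>R x \<in> \<Gamma>" if "x \<in> L" for x
    proof -
      obtain M where "D' = D * N * M" using D'(2) by (rule dvdE)
      then have "of_int D' *\<^sub>R x = of_int (D * M) *\<^sub>R (of_int N *\<^sub>R x)" by simp
      then show ?thesis using additive_subgroup_scaleR[OF \<Gamma>(1) N(2)[OF that], of "D * M"] by metis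
    qed
    have "D dvd D'" using D'(2) by (rule dvd_mult_left)
    \<comment> \<open>On the coset of \<open>D' L\<close> through \<open>lattice_point B n\<close>
      both sides equal \<open>q\<close>, and polynomials that agree there agree on
      \<open>span B\<close>.\<close>
    have val: "p ((+) (lattice_point B n) ` \<Gamma>) (\<xi>, of_int u) = (\<Sum>i<m. e i n u * g i (\<xi>, of_int u))"
      if \<xi>: "\<xi> \<in> span B" for n \<xi> and u :: int
    proof -
      let ?C = "(+) (lattice_point B n) ` \<Gamma>"
      have C: "?C \<in> lattice_cosets L \<Gamma>" by (auto simp: lattice_cosets_def L)
      define f where "f = (\<lambda>\<xi>. p ?C (\<xi>, of_int u) - (\<Sum>i<m. e i n u * g i (\<xi>, of_int u)))"
      have "f \<xi> = 0"
      proof (rule polynomial_zero_on_lattice_coset[OF _ finB D'(1) _ _ \<xi>, of _ "lattice_point B n"])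
        show "polynomial_function f"
          unfolding f_def
          by (intro polynomial_function_diff polynomial_function_sum polynomial_function_complex_mult
              polynomial_function_const poly_quasi_poly_polynomial pC(1) C g) auto
        show "lattice_point B n \<in> span B"
          unfolding lattice_point_def by (intro span_sum span_scale span_base)
        fix l :: "'a \<Rightarrow> int"
        let ?x = "lattice_point B n + (\<Sum>b\<in>B. (of_int D' * of_int (l b)) *\<^sub>R b)"
        have x: "?x = lattice_point B n + of_int D' *\<^sub>R lattice_point B l"
          by (simp add: lattice_point_def scaleR_sum_right)
        then have x': "?x = lattice_point B (\<lambda>b. n b + D' * l b)" by (simp add: lattice_point_shift)
        have "?x \<in> ?C" unfolding x using D'\<Gamma>[of "lattice_point B l"] L by auto
        then have "p ?C (?x, of_int u) = q (?x, of_int u)" using pC(2)[OF C] by simp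
        also have "\<dots> = (\<Sum>i<m. e i n u * g i (?x, of_int u))"
        proof -
          have "e i (\<lambda>b. n b + D' * l b) u = e i n u" if "i < m" for i
            using \<open>D dvd D'\<close> by (intro periodic_coeffD[OF e[OF that]]) (auto elim!: dvdE simp: mult.assoc)
          then show ?thesis unfolding x' q by simp
        qed
        finally show "f ?x = 0" by (simp add: f_def)
      qed
      then show ?thesis by (simp add: f_def)
    qed
    have "polynomial_part L q (\<xi>, of_int u) =
        (\<Sum>i<m. (\<Sum>n\<in>Pi\<^sub>E B (\<lambda>_. {0..<D'}). e i n u) / of_int D' ^ card B * g i (\<xi>, of_int u))"
      if "\<xi> \<in> span B" for \<xi> and u :: int
    proof -
      have "polynomial_part L q (\<xi>, of_int u) =
          (\<Sum>n\<in>Pi\<^sub>E B (\<lambda>_. {0..<D'}). p ((+) (lattice_point B n) ` \<Gamma>) (\<xi>, of_int u)) / of_int D' ^ card B"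
        unfolding Q by (rule average_over_residues[OF B \<Gamma>(1,2) D'(1) D'\<Gamma>])
      also have "\<dots> = (\<Sum>i<m. \<Sum>n\<in>Pi\<^sub>E B (\<lambda>_. {0..<D'}). e i n u * g i (\<xi>, of_int u)) / of_int D' ^ card B"
        unfolding val[OF that] by (subst sum.swap) simp
      finally show ?thesis by (simp add: sum_distrib_right sum_divide_distrib)
    qed
    then show ?thesis using \<xi> by blast
  qed
  then show ?thesis using D N poly by (intro conjI exI[of _ "D * N"]) auto
qed

section \<open>The expansion for rational polyhedra\<close>

lemma infsum_finite_sum:
  fixes f :: "'i \<Rightarrow> 'b \<Rightarrow> complex"
  assumes "finite I" "\<And>i. i \<in> I \<Longrightarrow> f i summable_on A"
  shows "(\<Sum>\<^sub>\<infinity>x\<in>A. \<Sum>i\<in>I. f i x) = (\<Sum>i\<in>I. infsum (f i) A)"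
proof -
  have "((\<lambda>x. \<Sum>i\<in>I. f i x) has_sum (\<Sum>i\<in>I. infsum (f i) A)) A"
    using assms by (induction I rule: finite_induct) (auto intro: has_sum_add)
  then show ?thesis by (rule infsumI)
qed

lemma expands_compose_mult:
  assumes S: "expands S \<theta>" and h: "smooth h"
  shows "expands (\<lambda>k \<phi>. S k (\<lambda>x. h x * \<phi> x)) (\<lambda>n k \<phi>. \<theta> n k (\<lambda>x. h x * \<phi> x))"
  unfolding expands_def
proof (intro conjI allI impI)
  show "distribution (\<lambda>\<phi>. \<theta> n k (\<lambda>x. h x * \<phi> x))" for n k
    using S h by (intro distribution_mult) (auto simp: expands_def)
  obtain D :: int where "D > 0" "\<And>n k k'. k mod D = k' mod D \<Longrightarrow> \<theta> n k = \<theta> n k'"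
    using S unfolding expands_def by metis
  then show "\<exists>D>0. \<forall>n k k'. k mod D = k' mod D \<longrightarrow>
      (\<lambda>\<phi>. \<theta> n k (\<lambda>x. h x * \<phi> x)) = (\<lambda>\<phi>. \<theta> n k' (\<lambda>x. h x * \<phi> x))"
    by (intro exI[of _ D]) metis
  fix \<phi> :: "'a \<Rightarrow> complex" and N assume "test_function \<phi>"
  then have "test_function (\<lambda>x. h x * \<phi> x)" by (rule test_function_mult[OF h])
  then show "\<exists>C. \<forall>k>0. norm (S k (\<lambda>x. h x * \<phi> x) - (\<Sum>n<N. \<theta> n (int k) (\<lambda>x. h x * \<phi> x) / of_nat k ^ n)) \<le> C / real k ^ N"
    using S unfolding expands_def by (elim conjE allE impE)
qed

text \<open>The sum up to \<open>N\<close> has \<open>Suc N\<close> terms, so \<open>expands\<close>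
  bounds its error by \<open>C / k\<close> relative to \<open>k ^ (n0 - N)\<close>.\<close>

lemma expands_imp_asymptotic_expansion:
  assumes S: "expands (\<lambda>k \<phi>. T k \<phi> / of_nat k ^ n0) \<theta>"
  shows "has_asymptotic_expansion T n0 \<theta>"
  unfolding has_asymptotic_expansion_def
proof (intro conjI allI impI)
  show "distribution (\<theta> n k)" for n k using S by (simp add: expands_def)
  obtain D :: int where D: "D > 0" "\<And>n k k'. k mod D = k' mod D \<Longrightarrow> \<theta> n k = \<theta> n k'"
    using S unfolding expands_def by metis
  have "\<theta> n (k1 + D * k) = \<theta> n k1" for n k1 k by (rule D(2)) simp
  then show "periodic_family (\<theta> n)" for n
    unfolding periodic_family_def using D(1) by (intro exI[of _ D]) simp
  fix \<phi> :: "'a \<Rightarrow> complex" and N assume \<phi>: "test_function \<phi>"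
  let ?f = "\<lambda>k. T k \<phi> - of_nat k ^ n0 * (\<Sum>n\<le>N. \<theta> n (int k) \<phi> / of_nat k ^ n)"
  let ?g = "\<lambda>k. of_nat k powi (int n0 - int N) :: complex"
  have "\<exists>C. \<forall>k>0. norm (T k \<phi> / of_nat k ^ n0 - (\<Sum>n<Suc N. \<theta> n (int k) \<phi> / of_nat k ^ n)) \<le> C / real k ^ Suc N"
    using S \<phi> unfolding expands_def by (elim conjE allE impE)
  then obtain C where C: "\<And>k. k > 0 \<Longrightarrow>
      norm (T k \<phi> / of_nat k ^ n0 - (\<Sum>n<Suc N. \<theta> n (int k) \<phi> / of_nat k ^ n)) \<le> C / real k ^ Suc N"
    by blast
  show "?f \<in> o(?g)"
  proof (rule smalloI_tendsto)
    have le: "norm (?f k / ?g k) \<le> C / real k" if k: "k > 0" for k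
    proof -
      have "?f k = of_nat k ^ n0 * (T k \<phi> / of_nat k ^ n0 - (\<Sum>n<Suc N. \<theta> n (int k) \<phi> / of_nat k ^ n))"
        using k by (simp add: right_diff_distrib lessThan_Suc_atMost)
      moreover have "?g k = of_nat k ^ n0 / of_nat k ^ N"
        using k by (simp add: power_int_diff)
      ultimately have "?f k / ?g k = of_nat k ^ N * (T k \<phi> / of_nat k ^ n0 - (\<Sum>n<Suc N. \<theta> n (int k) \<phi> / of_nat k ^ n))"
        using k by simp
      then have "norm (?f k / ?g k) \<le> real k ^ N * (C / real k ^ Suc N)"
        by (simp only: norm_mult norm_power norm_of_nat) (intro mult_left_mono C[OF k], simp)
      also have "\<dots> = C / real k" using k by simp
      finally show ?thesis .
    qed
    show "(\<lambda>k. ?f k / ?g k) \<longlonglongrightarrow> 0"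
    proof (rule Lim_null_comparison)
      show "\<forall>\<^sub>F k in sequentially. norm (?f k / ?g k) \<le> C / real k"
        using eventually_gt_at_top[of 0] by eventually_elim (rule le)
      show "(\<lambda>k. C / real k) \<longlonglongrightarrow> 0" by (rule lim_const_over_n)
    qed
    show "\<forall>\<^sub>F k in sequentially. ?g k \<noteq> 0"
      using eventually_gt_at_top[of 0] by eventually_elim simp
  qed
qed

section \<open>Coordinates on the cone over the polyhedron\<close>

context lattice_polyhedron
begin

text \<open>The base point chosen in \<open>hull_measure\<close> differs from
  \<open>\<alpha>\<close> by a vector of \<open>lin_space P\<close>, that is, by a translation of
  the coordinates, which Lebesgue measure does not see. The basis is the chosen one, through which
  the measure is defined.\<close>

lemma integral_hull_measure:
  assumes B: "lattice_basis B (\<Lambda> \<inter> lin_space P)" "B = (SOME B. lattice_basis B (\<Lambda> \<inter> lin_space P))"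
    and F: "F \<in> borel_measurable borel"
  shows "(\<integral>\<xi>. F \<xi> \<partial>hull_measure \<Lambda> P) = (\<integral>t. (F (affine_map B \<alpha> id t) :: complex) \<partial>lborel_PiM B)"
proof -
  note B' = lin_lattice_basis[OF B(1)]
  define x0 where "x0 = (SOME x. x \<in> affine hull P)"
  have "x0 \<in> affine hull P" unfolding x0_def using index_point(1) by (rule someI)
  then have "x0 - \<alpha> \<in> span B" unfolding B'(2) by (rule lin_space_diff[OF _ index_point(1)])
  then obtain s where "x0 - \<alpha> = (\<Sum>b\<in>B. s b *\<^sub>R b)" unfolding span_finite[OF B'(1)] by auto
  then have s: "x0 = \<alpha> + (\<Sum>b\<in>B. s b *\<^sub>R b)" by (simp add: algebra_simps)
  have hull: "hull_measure \<Lambda> P = distr (lborel_PiM B) borel (affine_map B x0 id)"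
    unfolding hull_measure_def Let_def B(2)[symmetric] x0_def[symmetric] affine_map_def by simp
  have "(\<integral>\<xi>. F \<xi> \<partial>hull_measure \<Lambda> P) = (\<integral>t. F (affine_map B x0 id t) \<partial>lborel_PiM B)"
    unfolding hull by (rule integral_distr[OF affine_map_measurable F])
  also have "(\<lambda>t. F (affine_map B x0 id t)) = (\<lambda>t. F (affine_map B \<alpha> id (\<lambda>b\<in>B. s b + 1 * t b)))"
    by (simp add: affine_map_def s scaleR_add_left sum.distrib add.assoc cong: sum.cong)
  also have "integral\<^sup>L (lborel_PiM B) \<dots> = (\<integral>t. F (affine_map B \<alpha> id t) \<partial>lborel_PiM B)"
    using integral_lborel_PiM_affine[OF B'(1) zero_less_one measurable_compose[OF affine_map_measurable F], of \<alpha> id s]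
    by simp
  finally show ?thesis .
qed

lemma index_quotient:
  assumes "k0 dvd k"
  shows "of_int (int k div int k0) * real k0 = real k"
proof -
  have "int k div int k0 * int k0 = int k" using assms by simp
  then show ?thesis by (metis of_int_mult of_int_of_nat_eq)
qed

lemma polyhedron_measurable: "P \<in> sets borel"
proof -
  obtain F :: "'a set set" and a b where "finite F \<and> P = {x. \<forall>h\<in>F. a h \<bullet> x \<le> b h} \<and>
      (\<forall>h\<in>F. \<forall>x\<in>\<Lambda>. a h \<bullet> x \<in> \<rat>) \<and> (\<forall>h\<in>F. b h \<in> \<rat>)"
    using halfspaces by (elim exE)
  then have "P = (\<Inter>h\<in>F. {x. a h \<bullet> x \<le> b h})" by auto
  then have "closed P" by (auto intro: closed_halfspace_le)
  then show ?thesis by (rule borel_closed)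
qed

text \<open>The character \<open>(\<lambda>, k) \<mapsto> exp (2 \<pi> \<i> G (\<lambda>, k))\<close> in the coordinates \<open>\<lambda> = \<Sum> n\<^sub>b b + u k\<^sub>0 \<alpha>\<close>, \<open>k = u k\<^sub>0\<close>.\<close>

definition cone_character :: "'a set \<Rightarrow> ('a \<times> real \<Rightarrow> real) \<Rightarrow> ('a \<Rightarrow> int) \<Rightarrow> int \<Rightarrow> complex" where
  "cone_character B G n u = exp (2 * \<i> * of_real pi *
    of_real ((\<Sum>b\<in>B. of_int (n b) * G (b, 0)) + of_int u * G (real k0 *\<^sub>R \<alpha>, real k0)))"

lemma cone_lattice_points:
  assumes B: "lattice_basis B (\<Lambda> \<inter> lin_space P)"
  shows "(lattice_point B n + of_int u *\<^sub>R (real k0 *\<^sub>R \<alpha>), of_int u * real k0) \<in> cone_space P \<inter> (\<Lambda> \<times> \<int>)"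
    (is "?x \<in> _")
proof -
  note B' = lin_lattice_basis[OF B]
  have "lattice_point B n \<in> \<Lambda> \<inter> lin_space P"
    using B by (auto simp: lattice_basis_altdef int_span_altdef)
  then have n: "lattice_point B n \<in> \<Lambda>" "lattice_point B n \<in> lin_space P" by auto
  have "\<alpha> + lattice_point B n \<in> affine hull P" by (rule affine_hull_add_lin[OF index_point(1) n(2)])
  then have "(1 *\<^sub>R (\<alpha> + lattice_point B n), 1) \<in> cone_space P" by (rule cone_space_mem)
  moreover have "(1 *\<^sub>R \<alpha>, 1) \<in> cone_space P" by (rule cone_space_mem[OF index_point(1)])
  ultimately have "(1 *\<^sub>R (\<alpha> + lattice_point B n), 1) - (1 *\<^sub>R \<alpha>, 1) + (of_int u * real k0) *\<^sub>R (1 *\<^sub>R \<alpha>, 1) \<in> cone_space P"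
    unfolding cone_space_def by (intro span_add span_diff span_scale)
  then have "?x \<in> cone_space P" by simp
  moreover have "?x \<in> \<Lambda> \<times> \<int>"
    using additive_subgroupD(3)[OF lattice_subgroup n(1) additive_subgroup_scaleR[OF lattice_subgroup index_point(2)]]
    by (simp add: Ints_mult)
  ultimately show ?thesis by blast
qed

lemma cone_character_eq:
  assumes "linear G"
  shows "cone_character B G n u = exp (2 * \<i> * of_real pi *
    of_real (G (lattice_point B n + of_int u *\<^sub>R (real k0 *\<^sub>R \<alpha>), of_int u * real k0)))"
proof -
  have "(lattice_point B n + of_int u *\<^sub>R (real k0 *\<^sub>R \<alpha>), of_int u * real k0) =
      (\<Sum>b\<in>B. of_int (n b) *\<^sub>R (b, 0)) + of_int u *\<^sub>R (real k0 *\<^sub>R \<alpha>, real k0)"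
    by (simp add: lattice_point_def prod_eq_iff fst_sum snd_sum)
  then have "G (lattice_point B n + of_int u *\<^sub>R (real k0 *\<^sub>R \<alpha>), of_int u * real k0) =
      (\<Sum>b\<in>B. of_int (n b) * G (b, 0)) + of_int u * G (real k0 *\<^sub>R \<alpha>, real k0)"
    using assms by (simp only: linear_add linear_sum linear_cmul real_scaleR_def)
  then show ?thesis by (simp only: cone_character_def)
qed

text \<open>Moving \<open>n\<close> and \<open>u\<close> by multiples of \<open>M\<close> moves the
  cone point by \<open>M\<close> times a lattice point, so \<open>G\<close> changes by an
  integer.\<close>

lemma cone_character_periodic:
  assumes B: "lattice_basis B (\<Lambda> \<inter> lin_space P)" and G: "linear G" and M: "M > 0" "M dvd D" "D > 0"
    and int: "\<And>x. x \<in> cone_space P \<inter> (\<Lambda> \<times> \<int>) \<Longrightarrow> of_int M * G x \<in> \<int>"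
  shows "periodic_coeff B D (cone_character B G)"
  unfolding periodic_coeff_def
proof (intro conjI allI impI)
  fix n n' :: "'a \<Rightarrow> int" and u u' :: int
  assume n: "\<forall>b\<in>B. n b mod D = n' b mod D" and u: "u mod D = u' mod D"
  define l where "l = (\<lambda>b. (n b - n' b) div M)"
  define j where "j = (u - u') div M"
  have l: "n b = n' b + M * l b" if "b \<in> B" for b
  proof -
    have "M dvd n b - n' b" using n that M(2) by (metis mod_eq_dvd_iff dvd_trans)
    then show ?thesis by (simp add: l_def)
  qed
  have "M dvd u - u'" using u M(2) by (metis mod_eq_dvd_iff dvd_trans)
  then have j: "u = u' + M * j" by (simp add: j_def)
  let ?x = "(lattice_point B l + of_int j *\<^sub>R (real k0 *\<^sub>R \<alpha>), of_int j * real k0)"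
  have "lattice_point B n = lattice_point B n' + of_int M *\<^sub>R lattice_point B l"
    unfolding lattice_point_shift[symmetric] by (simp add: lattice_point_def l cong: sum.cong)
  then have "(lattice_point B n + of_int u *\<^sub>R (real k0 *\<^sub>R \<alpha>), of_int u * real k0) =
      (lattice_point B n' + of_int u' *\<^sub>R (real k0 *\<^sub>R \<alpha>), of_int u' * real k0) + of_int M *\<^sub>R ?x"
    by (simp add: j algebra_simps)
  then have G': "G (lattice_point B n + of_int u *\<^sub>R (real k0 *\<^sub>R \<alpha>), of_int u * real k0) =
      G (lattice_point B n' + of_int u' *\<^sub>R (real k0 *\<^sub>R \<alpha>), of_int u' * real k0) + of_int M * G ?x"
    using G by (simp only: linear_add linear_cmul) simp
  obtain z :: int where z: "of_int M * G ?x = of_int z"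
    using int[OF cone_lattice_points[OF B, of l j]] by (rule Ints_cases)
  have "exp (2 * \<i> * of_real pi * of_int z) = (1::complex)"
    using exp_integer_2pi[of "of_int z"] by (simp add: mult_ac)
  then show "cone_character B G n u = cone_character B G n' u'"
    unfolding cone_character_eq[OF G] G' z by (simp add: distrib_left exp_add)
qed (rule M(3))

end

theorem proposition1p2:
  fixes \<Lambda> P :: "'a::euclidean_space set"
    and q r :: "'a \<times> real \<Rightarrow> complex"
    and d\<^sub>0 :: nat
  assumes "is_lattice \<Lambda>" and "span \<Lambda> = UNIV"
    and "rational_polyhedron \<Lambda> P" and "P \<noteq> {}"
    and "quasi_polynomial (\<Lambda> \<times> \<int>) q"
    and "r = restrict q (cone_space P \<inter> (\<Lambda> \<times> \<int>))"
    and "homogeneous_quasi_polynomial (cone_space P \<inter> (\<Lambda> \<times> \<int>)) d\<^sub>0 r"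
  shows "\<exists>\<theta>. has_asymptotic_expansion (Theta \<Lambda> P q) (nat (aff_dim P) + d\<^sub>0) \<theta> \<and>
    (\<forall>k\<ge>1. \<forall>\<phi>. test_function \<phi> \<longrightarrow>
       of_nat k ^ d\<^sub>0 * \<theta> 0 (int k) \<phi> =
         (LINT \<xi>:P|hull_measure \<Lambda> P.
            cone_polynomial_part \<Lambda> P r (real k *\<^sub>R \<xi>, real k) * \<phi> \<xi>))"
proof -
  interpret lattice_polyhedron \<Lambda> P
    using assms(1-4) by unfold_locales

  \<comment> \<open>Characters and polynomial factors in lattice coordinates\<close>
  let ?S = "cone_space P \<inter> (\<Lambda> \<times> \<int>)"
  define B where "B = (SOME B. lattice_basis B (\<Lambda> \<inter> lin_space P))"
  have B: "lattice_basis B (\<Lambda> \<inter> lin_space P)"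
    unfolding B_def by (rule someI_ex[OF lin_lattice_basis_exists])
  note B' = lin_lattice_basis[OF B]
  obtain fs where fs: "\<And>t. affine_map B \<alpha> id t \<in> P \<longleftrightarrow> forms_region B fs t"
    using polyhedron_forms[OF B] by blast
  have k0: "k0 > 0" by (rule index_gen(1))
  have "\<exists>(m::nat) c G h. (\<forall>i<m. finite_order_mod_dual ?S (G i) \<and> homogeneous_polynomial d\<^sub>0 (h i)) \<and>
      (\<forall>x\<in>?S. r x = (\<Sum>i<m. c i * (exp (2 * \<i> * of_real pi * of_real (G i x)) * h i x)))"
    using assms(7) unfolding homogeneous_quasi_polynomial_def .
  then obtain m :: nat and c G h where Gh: "\<forall>i<m. finite_order_mod_dual ?S (G i) \<and> homogeneous_polynomial d\<^sub>0 (h i)"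
    and r: "\<forall>x\<in>?S. r x = (\<Sum>i<m. c i * (exp (2 * \<i> * of_real pi * of_real (G i x)) * h i x))"
    by (elim exE conjE)
  have lin: "linear (G i)" if "i < m" for i using Gh that by (auto simp: finite_order_mod_dual_def)
  have h_poly: "polynomial_function (h i)" and h_hom: "h i (t *\<^sub>R x) = of_real (t ^ d\<^sub>0) * h i x" if "i < m" for i t x
    using Gh that unfolding homogeneous_polynomial_def by blast+
  have "\<exists>M::int. M > 0 \<and> (\<forall>x\<in>?S. of_int M * G i x \<in> \<int>)" if i: "i < m" for i
  proof -
    obtain M :: nat where "M > 0" "\<forall>x\<in>?S. real M * G i x \<in> \<int>"
      using Gh i by (auto simp: finite_order_mod_dual_def)
    then show ?thesis by (intro exI[of _ "int M"]) simp
  qed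
  then obtain M where M: "\<And>i. i < m \<Longrightarrow> M i > (0::int)" "\<And>i x. i < m \<Longrightarrow> x \<in> ?S \<Longrightarrow> of_int (M i) * G i x \<in> \<int>"
    by metis
  \<comment> \<open>A common period of all characters, as each \<open>M i\<close> divides
    it.\<close>
  define D where "D = (\<Prod>i<m. M i)"
  have D: "D > 0" unfolding D_def using M(1) by (intro prod_pos) auto
  define e where "e = (\<lambda>i. cone_character B (G i))"
  have e: "periodic_coeff B D (e i)" if "i < m" for i
    unfolding e_def using that D M
    by (intro cone_character_periodic[OF B lin, of i "M i"]) (auto simp: D_def)
  \<comment> \<open>The polynomial factors in the coordinates \<open>(\<xi>, u)\<close>. Together
    with the characters \<open>e i\<close> they give \<open>r\<close> the product shape that
    \<open>polynomial_part_eq\<close> expects.\<close>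
  define g where "g = (\<lambda>i (\<xi>, u). c i * h i (\<xi> + (u * real k0) *\<^sub>R \<alpha>, u * real k0))"
  have g: "poly_quasi_poly (g i)" if "i < m" for i
  proof -
    have "polynomial_function (\<lambda>x. c i * h i x)"
      by (intro polynomial_function_complex_mult polynomial_function_const h_poly that)
    then show ?thesis unfolding g_def by (rule poly_quasi_poly_shear)
  qed
  define q\<alpha> where "q\<alpha> = (\<lambda>(\<gamma>, u). r (\<gamma> + (u * real k0) *\<^sub>R \<alpha>, u * real k0))"
  have q\<alpha>: "q\<alpha> (lattice_point B n, of_int u) = (\<Sum>i<m. e i n u * g i (lattice_point B n, of_int u))" for n u
  proof -
    define x where "x = (lattice_point B n + (of_int u * real k0) *\<^sub>R \<alpha>, of_int u * real k0)"
    have x: "x = (lattice_point B n + of_int u *\<^sub>R (real k0 *\<^sub>R \<alpha>), of_int u * real k0)" by (simp add: x_def)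
    have "q\<alpha> (lattice_point B n, of_int u) = r x" by (simp add: q\<alpha>_def x_def)
    also have "\<dots> = (\<Sum>i<m. c i * (exp (2 * \<i> * of_real pi * of_real (G i x)) * h i x))"
      using r cone_lattice_points[OF B, of n u] unfolding x by blast
    also have "\<dots> = (\<Sum>i<m. e i n u * g i (lattice_point B n, of_int u))"
    proof (rule sum.cong[OF refl])
      fix i assume "i \<in> {..<m}"
      then have "exp (2 * \<i> * of_real pi * of_real (G i x)) = e i n u"
        unfolding x e_def using cone_character_eq[OF lin] by simp
      then show "c i * (exp (2 * \<i> * of_real pi * of_real (G i x)) * h i x) = e i n u * g i (lattice_point B n, of_int u)"
        by (simp add: g_def x_def)
    qed
    finally show ?thesis .
  qed

  \<comment> \<open>The polynomial part and the periodic coefficients\<close>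
  let ?Q = "polynomial_part (\<Lambda> \<inter> lin_space P) q\<alpha>"
  have "\<forall>i<m. periodic_coeff B D (e i)" "\<forall>i<m. poly_quasi_poly (g i)" using e g by blast+
  note part = polynomial_part_eq[OF B this(1) D this(2) q\<alpha>]
  have Q_poly: "polynomial_function (\<lambda>\<xi>. ?Q (\<xi>, of_int u))" for u :: int
    by (rule conjunct1[OF part, rule_format])
  obtain D0 where D0: "D0 > 0" "D dvd D0" and Q0: "\<forall>D'>0. D0 dvd D' \<longrightarrow> (\<forall>u::int. \<forall>\<xi>\<in>span B.
      ?Q (\<xi>, of_int u) = (\<Sum>i<m. (\<Sum>n\<in>Pi\<^sub>E B (\<lambda>_. {0..<D'}). e i n u) / of_int D' ^ card B * g i (\<xi>, of_int u)))"
    using conjunct2[OF part] by (elim exE conjE)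
  note Q = Q0[rule_format]
  \<comment> \<open>\<open>D0\<close> is a period in \<open>u = k / k0\<close>, and the factor
    \<open>k0\<close> turns it into a period in \<open>k\<close>. Being a multiple of
    \<open>D0\<close>, it also fits the formula for the polynomial part, so both means run over the
    same residues.\<close>
  define D' where "D' = D0 * int k0"
  have D': "D' > 0" using D0 k0 by (simp add: D'_def)
  \<comment> \<open>The value 0 when \<open>k0\<close> does not divide \<open>k\<close> matches both
    the absence of lattice points in the dilate of \<open>P\<close> and the convention in
    \<open>cone_polynomial_part\<close>.\<close>
  define C where "C = (\<lambda>i n (k::int). if int k0 dvd k then e i n (k div int k0) else 0)"
  have C: "periodic_coeff B D' (C i)" if i: "i < m" for i
    unfolding periodic_coeff_def
  proof (intro conjI allI impI D')
    fix n n' :: "'a \<Rightarrow> int" and k k' :: int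
    assume n: "\<forall>b\<in>B. n b mod D' = n' b mod D'" and k: "k mod D' = k' mod D'"
    have "D dvd D'" using D0(2) by (simp add: D'_def)
    then have n': "n b mod D = n' b mod D" if "b \<in> B" for b
      using n that by (metis mod_mod_cancel)
    obtain l where l: "k = k' + D' * l"
      using k by (metis mod_eq_dvd_iff dvdE diff_add_cancel add.commute)
    have "int k0 dvd D' * l" by (simp add: D'_def)
    then have dvd: "int k0 dvd k \<longleftrightarrow> int k0 dvd k'" unfolding l by (simp add: dvd_add_left_iff)
    have "(k div int k0) mod D = (k' div int k0) mod D" if "int k0 dvd k'"
    proof -
      have "k div int k0 = k' div int k0 + D0 * l"
        unfolding l D'_def using k0 that by (simp add: div_add mult.assoc mult.left_commute[of D0])
      then show ?thesis using D0(2) by (auto elim!: dvdE simp: mult.assoc)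
    qed
    then show "C i n k = C i n' k'"
      using dvd n' by (auto simp: C_def intro!: periodic_coeffD[OF e[OF i]])
  qed
  define S where "S = (\<lambda>i k \<phi>. weighted_sum B \<alpha> id (\<lambda>n l. forms_indicator B fs n l * C i n l) k \<phi>)"
  have "\<exists>\<theta>. expands (\<lambda>k \<phi>. S i k \<phi> / of_nat k ^ card B) \<theta>" if "i < m" for i
    unfolding S_def by (rule expands_conic[OF conic_forms_indicator[OF B'(1)] B'(1,4) C[OF that]])
  then obtain \<eta> where \<eta>: "\<And>i. i < m \<Longrightarrow> expands (\<lambda>k \<phi>. S i k \<phi> / of_nat k ^ card B) (\<eta> i)" by metis
  \<comment> \<open>By homogeneity \<open>h i (k x, k)\<close> is \<open>k ^ d\<^sub>0\<close> times
    \<open>h i (x, 1)\<close>; this smooth factor is attached to the test function.\<close>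
  define H where "H = (\<lambda>i x. h i (x, 1))"
  have H: "smooth (H i)" if "i < m" for i
  proof -
    have "polynomial_function (\<lambda>x::'a. (x, 1::real))"
    proof -
      have "polynomial_function (\<lambda>x::'a. (x, 0::real) + (0, 1))"
        by (intro polynomial_function_add polynomial_function_const polynomial_function_bounded_linear
            bounded_linear_Pair bounded_linear_ident bounded_linear_zero)
      then show ?thesis by simp
    qed
    then have "polynomial_function (H i)"
      using polynomial_function_compose[OF _ h_poly[OF that]] by (simp add: H_def o_def)
    then show ?thesis by (rule smooth_polynomial)
  qed
  have H\<phi>: "test_function (\<lambda>x. H i x * \<phi> x)" if "i < m" "test_function \<phi>" for i \<phi>
    using that by (intro test_function_mult H)
  define \<theta> where "\<theta> = (\<lambda>n k \<phi>. \<Sum>i<m. c i * \<eta> i n k (\<lambda>x. H i x * \<phi> x))"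

  \<comment> \<open>The lattice sum and its expansion\<close>
  have Theta: "Theta \<Lambda> P q k \<phi> / of_nat k ^ (card B + d\<^sub>0) = (\<Sum>i<m. c i * (S i k (\<lambda>x. H i x * \<phi> x) / of_nat k ^ card B))"
    if k: "k > 0" and \<phi>: "test_function \<phi>" for k \<phi>
  proof -
    let ?p = "\<lambda>n. affine_map B \<alpha> id (\<lambda>b. of_int (n b) / real k)"
    have "Theta \<Lambda> P q k \<phi> = of_nat k ^ d\<^sub>0 * (\<Sum>i<m. c i * S i k (\<lambda>x. H i x * \<phi> x))"
    proof (cases "k0 dvd k")
      case True
      have int_k: "int k0 dvd int k" using True by simp
      define u where "u = int k div int k0"
      have u: "of_int u * real k0 = real k"
        unfolding u_def by (rule index_quotient[OF True])
      have val: "q (real k *\<^sub>R ?p n, real k) = of_nat k ^ d\<^sub>0 * (\<Sum>i<m. c i * (C i n (int k) * H i (?p n)))" for n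
      proof -
        have x: "(real k *\<^sub>R ?p n, real k) = (lattice_point B n + of_int u *\<^sub>R (real k0 *\<^sub>R \<alpha>), of_int u * real k0)"
          using k by (simp add: affine_map_def lattice_point_def scaleR_add_right scaleR_sum_right u)
        then have S: "(real k *\<^sub>R ?p n, real k) \<in> ?S" using cone_lattice_points[OF B, of n u] by (simp only:)
        then have "q (real k *\<^sub>R ?p n, real k) = r (real k *\<^sub>R ?p n, real k)" by (simp add: assms(6))
        also have "\<dots> = (\<Sum>i<m. c i * (exp (2 * \<i> * of_real pi * of_real (G i (real k *\<^sub>R ?p n, real k))) * h i (real k *\<^sub>R ?p n, real k)))"
          using r S by blast
        also have "\<dots> = (\<Sum>i<m. of_nat k ^ d\<^sub>0 * (c i * (C i n (int k) * H i (?p n))))"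
        proof (rule sum.cong[OF refl])
          fix i assume "i \<in> {..<m}"
          then have i: "i < m" by simp
          have "exp (2 * \<i> * of_real pi * of_real (G i (real k *\<^sub>R ?p n, real k))) = C i n (int k)"
            unfolding x using int_k cone_character_eq[OF lin[OF i]] by (simp only: C_def e_def u_def if_True)
          moreover have "h i (real k *\<^sub>R ?p n, real k) = of_nat k ^ d\<^sub>0 * H i (?p n)"
            using h_hom[OF i, of "real k" "(?p n, 1)"] by (simp add: H_def)
          ultimately show "c i * (exp (2 * \<i> * of_real pi * of_real (G i (real k *\<^sub>R ?p n, real k))) * h i (real k *\<^sub>R ?p n, real k)) =
              of_nat k ^ d\<^sub>0 * (c i * (C i n (int k) * H i (?p n)))" by simp
        qed
        finally show ?thesis by (simp only: sum_distrib_left)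
      qed
      let ?A = "Pi\<^sub>E B (\<lambda>_. UNIV :: int set)"
      have "Theta \<Lambda> P q k \<phi> = (\<Sum>\<^sub>\<infinity>n\<in>{n \<in> ?A. ?p n \<in> P}. q (real k *\<^sub>R ?p n, real k) * \<phi> ((real k *\<^sub>R ?p n) /\<^sub>R real k))"
        unfolding Theta_def by (rule infsum_reindex_bij_betw[OF lattice_points_dilate[OF B k True], symmetric])
      also have "\<dots> = (\<Sum>\<^sub>\<infinity>n\<in>?A. of_nat k ^ d\<^sub>0 * (\<Sum>i<m. c i * ((forms_indicator B fs n (int k) * C i n (int k)) * (H i (?p n) * \<phi> (?p n)))))"
      proof (rule infsum_cong_neutral)
        fix n assume "n \<in> {n \<in> ?A. ?p n \<in> P} \<inter> ?A"
        then have "forms_indicator B fs n (int k) = 1" by (simp add: forms_indicator_region[OF k] fs)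
        then show "q (real k *\<^sub>R ?p n, real k) * \<phi> ((real k *\<^sub>R ?p n) /\<^sub>R real k) =
            of_nat k ^ d\<^sub>0 * (\<Sum>i<m. c i * ((forms_indicator B fs n (int k) * C i n (int k)) * (H i (?p n) * \<phi> (?p n))))"
          using k by (simp add: val sum_distrib_right mult.assoc)
      next
        fix n assume "n \<in> ?A - {n \<in> ?A. ?p n \<in> P}"
        then have "forms_indicator B fs n (int k) = 0" by (simp add: forms_indicator_region[OF k] fs)
        then show "of_nat k ^ d\<^sub>0 * (\<Sum>i<m. c i * ((forms_indicator B fs n (int k) * C i n (int k)) * (H i (?p n) * \<phi> (?p n)))) = 0"
          by simp
      qed auto
      also have "\<dots> = of_nat k ^ d\<^sub>0 * (\<Sum>i<m. \<Sum>\<^sub>\<infinity>n\<in>?A. c i * ((forms_indicator B fs n (int k) * C i n (int k)) * (H i (?p n) * \<phi> (?p n))))"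
        by (subst infsum_cmult_right', subst infsum_finite_sum) (auto intro!: summable_on_cmult_right weighted_sum_summable[OF B'(1,4) H\<phi>[OF _ \<phi>] k])
      finally show ?thesis by (simp only: infsum_cmult_right' S_def weighted_sum_def)
    next
      case False
      have "(*\<^sub>R) (real k) ` P \<inter> \<Lambda> = {}"
      proof (rule ccontr)
        assume "\<not> ?thesis"
        then have "real k \<in> index_ideal \<Lambda> P"
          unfolding index_ideal_iff by (auto intro: hull_inc)
        then show False using False index_ideal_multiple by simp
      qed
      moreover have "\<not> int k0 dvd int k" using False by simp
      ultimately show ?thesis by (simp add: Theta_def S_def weighted_sum_def C_def)
    qed
    then show ?thesis using k by (simp add: power_add sum_divide_distrib)
  qed
  have "expands (\<lambda>k \<phi>. \<Sum>i<m. c i * (S i k (\<lambda>x. H i x * \<phi> x) / of_nat k ^ card B)) \<theta>"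
    unfolding \<theta>_def
    \<comment> \<open>The constants \<open>c i\<close> are periodic factors of period 1.\<close>
    by (intro expands_sum finite_lessThan expands_mult_mod[where D = 1 and c = "\<lambda>_. c _"]
        expands_compose_mult[OF \<eta> H]) auto
  then have "expands (\<lambda>k \<phi>. Theta \<Lambda> P q k \<phi> / of_nat k ^ (card B + d\<^sub>0)) \<theta>"
    by (rule expands_cong) (rule Theta)
  then have "has_asymptotic_expansion (Theta \<Lambda> P q) (nat (aff_dim P) + d\<^sub>0) \<theta>"
    unfolding B'(3)[symmetric] by (rule expands_imp_asymptotic_expansion)

  \<comment> \<open>The leading term\<close>
  moreover have "of_nat k ^ d\<^sub>0 * \<theta> 0 (int k) \<phi> =
      (LINT \<xi>:P|hull_measure \<Lambda> P. cone_polynomial_part \<Lambda> P r (real k *\<^sub>R \<xi>, real k) * \<phi> \<xi>)"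
    if k: "k > 0" and \<phi>: "test_function \<phi>" for k \<phi>
  proof -
    \<comment> \<open>The mean of the coefficient over residues: it multiplies the integral in
      \<open>expands_leading_term\<close> and, when \<open>k0\<close> divides \<open>k\<close>, is
      also the coefficient produced by \<open>polynomial_part_eq\<close>.\<close>
    define a where "a = (\<lambda>i. (\<Sum>n\<in>Pi\<^sub>E B (\<lambda>_. {0..<D'}). C i n (int k)) / of_int D' ^ card B)"
    define F where "F = (\<lambda>\<xi>. indicator P \<xi> *\<^sub>R (cone_polynomial_part \<Lambda> P r (real k *\<^sub>R \<xi>, real k) * \<phi> \<xi>))"
    have cpp: "cone_polynomial_part \<Lambda> P r (\<xi>, real k) =
        (if k0 dvd k then ?Q (\<xi> - real k *\<^sub>R \<alpha>, of_int (int k div int k0)) else 0)" for \<xi>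
    proof (cases "k0 dvd k")
      case True
      have u: "of_int (int k div int k0) * real k0 = real k" by (rule index_quotient[OF True])
      then have "real k / real k0 = of_int (int k div int k0)" using k0 by (simp add: divide_eq_eq)
      with u show ?thesis
        using True k0 index_ideal_multiple[of k]
        by (simp add: cone_polynomial_part_def Let_def q\<alpha>_def)
    next
      case False
      then show ?thesis
        using index_ideal_multiple[of k] by (simp add: cone_polynomial_part_def Let_def)
    qed
    have cont: "continuous_on UNIV \<phi>" using \<phi> by (auto simp: test_function_def intro: smooth_continuous)
    \<comment> \<open>\<open>?Q\<close> is polynomial in \<open>\<xi>\<close> on the whole ambient
      space and not merely on \<open>span B\<close>; this gives a measurable integrand for a measure
      that lives on that space.\<close>
    have "continuous_on UNIV (\<lambda>\<xi>. cone_polynomial_part \<Lambda> P r (real k *\<^sub>R \<xi>, real k))"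
    proof (cases "k0 dvd k")
      case True
      have "continuous_on UNIV (\<lambda>\<xi>. ?Q (real k *\<^sub>R \<xi> - real k *\<^sub>R \<alpha>, of_int (int k div int k0)))"
        by (rule continuous_on_compose2[OF continuous_on_polymonial_function[OF Q_poly]])
          (auto intro!: continuous_intros)
      then show ?thesis using True by (simp add: cpp)
    qed (simp add: cpp)
    then have F: "F \<in> borel_measurable borel"
      unfolding F_def using cont polyhedron_measurable
      by (intro borel_measurable_scaleR borel_measurable_indicator borel_measurable_continuous_onI continuous_on_mult)
    have val: "F (affine_map B \<alpha> id t) = (\<Sum>i<m. (of_nat k ^ d\<^sub>0 * (c i * a i)) *
        (of_bool (forms_region B fs t) * (H i (affine_map B \<alpha> id t) * \<phi> (affine_map B \<alpha> id t))))" for t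
    proof -
      let ?\<xi> = "affine_map B \<alpha> id t"
      have "cone_polynomial_part \<Lambda> P r (real k *\<^sub>R ?\<xi>, real k) = (\<Sum>i<m. a i * (c i * (of_nat k ^ d\<^sub>0 * H i ?\<xi>)))"
      proof (cases "k0 dvd k")
        case True
        define u where "u = int k div int k0"
        have int_k: "int k0 dvd int k" using True by simp
        have u: "of_int u * real k0 = real k"
          unfolding u_def by (rule index_quotient[OF True])
        \<comment> \<open>The formula for the polynomial part holds on \<open>span B\<close>, which
          is reached after subtracting \<open>k \<alpha>\<close>.\<close>
        have "real k *\<^sub>R (\<Sum>b\<in>B. t b *\<^sub>R b) \<in> span B" by (intro span_scale span_sum span_base)
        then have span: "real k *\<^sub>R ?\<xi> - real k *\<^sub>R \<alpha> \<in> span B" by (simp add: affine_map_def scaleR_add_right)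
        have "cone_polynomial_part \<Lambda> P r (real k *\<^sub>R ?\<xi>, real k) = ?Q (real k *\<^sub>R ?\<xi> - real k *\<^sub>R \<alpha>, of_int u)"
          using True by (simp add: cpp u_def)
        also have "\<dots> = (\<Sum>i<m. (\<Sum>n\<in>Pi\<^sub>E B (\<lambda>_. {0..<D'}). e i n u) / of_int D' ^ card B * g i (real k *\<^sub>R ?\<xi> - real k *\<^sub>R \<alpha>, of_int u))"
          by (rule Q[OF D' _ span]) (simp add: D'_def)
        also have "\<dots> = (\<Sum>i<m. a i * (c i * (of_nat k ^ d\<^sub>0 * H i ?\<xi>)))"
        proof (rule sum.cong[OF refl])
          fix i assume "i \<in> {..<m}"
          then have "h i (real k *\<^sub>R ?\<xi>, real k) = of_nat k ^ d\<^sub>0 * H i ?\<xi>"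
            using h_hom[of i "real k" "(?\<xi>, 1)"] by (simp add: H_def)
          then have "g i (real k *\<^sub>R ?\<xi> - real k *\<^sub>R \<alpha>, of_int u) = c i * (of_nat k ^ d\<^sub>0 * H i ?\<xi>)"
            by (simp add: g_def u)
          moreover have "(\<Sum>n\<in>Pi\<^sub>E B (\<lambda>_. {0..<D'}). e i n u) / of_int D' ^ card B = a i"
            using int_k by (simp add: a_def C_def u_def)
          ultimately show "(\<Sum>n\<in>Pi\<^sub>E B (\<lambda>_. {0..<D'}). e i n u) / of_int D' ^ card B * g i (real k *\<^sub>R ?\<xi> - real k *\<^sub>R \<alpha>, of_int u) =
              a i * (c i * (of_nat k ^ d\<^sub>0 * H i ?\<xi>))" by simp
        qed
        finally show ?thesis .
      next
        case False
        then have "\<not> int k0 dvd int k" by simp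
        then have "a i = 0" for i by (simp add: a_def C_def)
        then show ?thesis using False by (simp add: cpp)
      qed
      then show ?thesis
        by (simp add: F_def indicator_def fs sum_distrib_left mult_ac)
    qed
    have lead: "\<eta> i 0 (int k) (\<lambda>x. H i x * \<phi> x) = a i *
        (\<integral>t. of_bool (forms_region B fs t) * (H i (affine_map B \<alpha> id t) * \<phi> (affine_map B \<alpha> id t)) \<partial>lborel_PiM B)"
      if "i < m" for i
      unfolding a_def using expands_leading_term[OF B'(1,4) C \<eta>[unfolded S_def] k H\<phi>[OF _ \<phi>]] that by blast
    have "(LINT \<xi>:P|hull_measure \<Lambda> P. cone_polynomial_part \<Lambda> P r (real k *\<^sub>R \<xi>, real k) * \<phi> \<xi>) =
        (\<integral>\<xi>. F \<xi> \<partial>hull_measure \<Lambda> P)"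
      by (simp add: set_lebesgue_integral_def F_def)
    also have "\<dots> = (\<integral>t. F (affine_map B \<alpha> id t) \<partial>lborel_PiM B)"
      by (rule integral_hull_measure[OF B B_def F])
    also have "\<dots> = (\<Sum>i<m. (of_nat k ^ d\<^sub>0 * (c i * a i)) *
        (\<integral>t. of_bool (forms_region B fs t) * (H i (affine_map B \<alpha> id t) * \<phi> (affine_map B \<alpha> id t)) \<partial>lborel_PiM B))"
      unfolding val
      by (subst Bochner_Integration.integral_sum)
        (auto intro!: integrable_mult_right integrable_forms_region[OF B'(1,4) H\<phi>[OF _ \<phi>]])
    also have "\<dots> = of_nat k ^ d\<^sub>0 * \<theta> 0 (int k) \<phi>"
      unfolding \<theta>_def sum_distrib_left by (intro sum.cong refl) (simp add: lead)
    finally show ?thesis by simp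
  qed
  ultimately show ?thesis by (intro exI[of _ \<theta>]) auto
qed

end
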